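(* Let $(M^3,g,\mathcal{F})$ be a spin Riemannian flow, given by a unit vector field $\xi$, carrying a non-zero $(\alpha,\beta)$-transversal Killing spinor for real $\alpha$ and $\beta$. Let $J$ be the canonical almost-Hermitian structure on $Q$, let $b:M\to\mathbb{R}$ be the function with $h=bJ$, and let $db_{|_Q}$ be the orthogonal projection of $\mathrm{grad}(b)$ onto $Q$. Then: (i) $\alpha=0$ or $\kappa=0$. (ii) $d\kappa^\flat(e_1,e_2)=2(\xi(b)-4\alpha\beta)$ for every local positively oriented orthonormal basis $\{e_1,e_2\}$ of $Q$. (iii) For every $Z\in\Gamma(Q)$, $$\begin{aligned}\mathrm{Scal}_M&=2\bigl(4\beta^2-b^2-4\alpha b-\mathrm{div}^M(\kappa)\bigr),\\ \mathrm{Ric}_M(\xi)&=\bigl(2b^2-\mathrm{div}^M(\kappa)\bigr)\xi+J\bigl(2b\kappa-db_{|_Q}\bigr),\\ \mathrm{Ric}_M(Z)&=2(2\beta^2-b^2-2\alpha b)Z+(4\alpha\beta-\xi(b))J(Z)+g\bigl(J(2b\kappa-db_{|_Q}),Z\bigr)\xi+\nabla_Z\kappa-g(Z,\kappa)\kappa.\end{aligned}$$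
   Context: Manifolds are connected. A Riemannian flow $(M^{3},g,\mathcal{F})$ is a Riemannian $3$-manifold with the foliation tangent to a smooth unit vector field $\xi$ such that $(\mathcal{L}_\xi g)(Z,W)=0$ for all $Z,W\perp\xi$. Put $Q=\xi^\perp$, $h(Z)=\nabla^M_Z\xi$ for $Z\in Q$ (skew-symmetric on $Q$), $\kappa=\nabla^M_\xi\xi\in\Gamma(Q)$, $\Omega(Z,W)=g(h(Z),W)$ on $Q$ extended by $\Omega(\xi,\cdot)=0$. The connection $\nabla$ on $Q$ is $\nabla_\xi Z=[\xi,Z]^Q$, $\nabla_XZ=(\nabla^M_XZ)^Q$ for $X\in\Gamma(Q)$. $M$ is oriented and $Q$ is oriented so that $\{Z,W\}$ is positive iff $\{\xi,Z,W\}$ is positive; $J$ is the rotation $J(e_1)=e_2$, $J(e_2)=-e_1$ in any positively oriented local orthonormal basis $\{e_1,e_2\}$ of $Q$, and $h=bJ$ for a smooth function $b$. On the spinor bundle $\Sigma M$, with Clifford multiplication "$\cdot$" ($X\cdot X=-|X|^2$; $e_i\wedge e_j$ acts as $e_i\cdot e_j\cdot$; normalized so that $-\xi\cdot e_1\cdot e_2\cdot=\mathrm{Id}$), the transversal connection is $\nabla_\xi\varphi=\nabla^M_\xi\varphi-\frac12\Omega\cdot\varphi-\frac12\xi\cdot\kappa\cdot\varphi$, $\nabla_Z\varphi=\nabla^M_Z\varphi-\frac12\xi\cdot h(Z)\cdot\varphi$ for $Z\in\Gamma(Q)$. An $(\alpha,\beta)$-transversal Killing spinor is a smooth section $\psi$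 of $\Sigma M$ with $\nabla_\xi\psi=\alpha\,\xi\cdot\psi$ and $\nabla_Z\psi=\beta\,\xi\cdot Z\cdot\psi$ for all $Z\in\Gamma(Q)$. $\mathrm{Ric}_M$ is the Ricci endomorphism of $(M,g)$. Sign convention: $\mathrm{div}^M(X)=-\mathrm{trace}(Y\mapsto\nabla^M_YX)$. *)

theory Defs
  imports "HOL-Analysis.Analysis"
begin

section \<open>Smooth maps between Euclidean spaces\<close>

text \<open>Only used for open sets \<open>S\<close>.\<close>

primrec cdiff_on ::
    "nat \<Rightarrow> 'a::euclidean_space set \<Rightarrow> ('a \<Rightarrow> 'b::real_normed_vector) \<Rightarrow> bool" where
  "cdiff_on 0 S f \<longleftrightarrow> continuous_on S f"
| "cdiff_on (Suc n) S f \<longleftrightarrow> (\<forall>x\<in>S. f differentiable (at x)) \<and>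
     (\<forall>v. cdiff_on n S (\<lambda>x. frechet_derivative f (at x) v))"

definition smooth_on :: "'a::euclidean_space set \<Rightarrow> ('a \<Rightarrow> 'b::real_normed_vector) \<Rightarrow> bool" where
  "smooth_on S f \<longleftrightarrow> (\<forall>n. cdiff_on n S f)"


section \<open>Oriented smooth 3-manifolds\<close>

text \<open>
  The manifold is the whole of a topological type \<open>'m\<close>. A chart is a pair of its domain and its
  coordinate map, and an orientation is given by an atlas whose transition maps have positive
  Jacobian.
\<close>

type_synonym 'm chart = "'m set \<times> ('m \<Rightarrow> real^3)"
type_synonym 'm atlas = "'m chart set"

abbreviation chart_dom :: "'m chart \<Rightarrow> 'm set" where "chart_dom c \<equiv> fst c"
abbreviation coord :: "'m chart \<Rightarrow> 'm \<Rightarrow> real^3" where "coord c \<equiv> snd c"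

definition param :: "'m chart \<Rightarrow> real^3 \<Rightarrow> 'm" where
  "param c = inv_into (chart_dom c) (coord c)"

definition is_chart :: "'m::topological_space chart \<Rightarrow> bool" where
  "is_chart c \<longleftrightarrow> open (chart_dom c) \<and> open (coord c ` chart_dom c) \<and>
     homeomorphism (chart_dom c) (coord c ` chart_dom c) (coord c) (param c)"

definition oriented_manifold :: "'m::{t2_space, second_countable_topology} atlas \<Rightarrow> bool" where
  "oriented_manifold A \<longleftrightarrow>
     connected (UNIV :: 'm set) \<and>
     (\<forall>c\<in>A. is_chart c) \<and> (\<Union>c\<in>A. chart_dom c) = UNIV \<and>
     (\<forall>c\<in>A. \<forall>c'\<in>A.
        smooth_on (coord c ` (chart_dom c \<inter> chart_dom c')) (coord c' \<circ> param c) \<and>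
        (\<forall>x \<in> coord c ` (chart_dom c \<inter> chart_dom c').
           det (matrix (frechet_derivative (coord c' \<circ> param c) (at x))) > 0))"

definition smooth_fn ::
    "'m atlas \<Rightarrow> 'm set \<Rightarrow> ('m \<Rightarrow> 'b::real_normed_vector) \<Rightarrow> bool" where
  "smooth_fn A U f \<longleftrightarrow> (\<forall>c\<in>A. smooth_on (coord c ` (chart_dom c \<inter> U)) (f \<circ> param c))"

text \<open>
  The tangent space at \<open>p\<close> is identified with \<open>real^3\<close> by means of a chart \<open>chart_at A p\<close> chosen
  once and for all at \<open>p\<close>. A vector field is therefore a map \<open>'m \<Rightarrow> real^3\<close>, but since the chosen
  chart jumps from point to point, smoothness and derivatives of vector fields must be expressed
  through their components \<open>\<lambda>q. dirderiv A q (X q) (coord c)\<close> in a fixed chart \<open>c\<close>.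
\<close>

definition chart_at :: "'m atlas \<Rightarrow> 'm \<Rightarrow> 'm chart" where
  "chart_at A p = (SOME c. c \<in> A \<and> p \<in> chart_dom c)"

text \<open>\<open>dirderiv A p v f\<close> is the derivative of \<open>f\<close> at \<open>p\<close> along the tangent vector \<open>v\<close>.\<close>

definition dirderiv ::
    "'m atlas \<Rightarrow> 'm \<Rightarrow> real^3 \<Rightarrow> ('m \<Rightarrow> 'b::real_normed_vector) \<Rightarrow> 'b" where
  "dirderiv A p v f =
     frechet_derivative (f \<circ> param (chart_at A p)) (at (coord (chart_at A p) p)) v"

type_synonym 'm vfield = "'m \<Rightarrow> real^3"

definition smooth_vf :: "'m atlas \<Rightarrow> 'm set \<Rightarrow> 'm vfield \<Rightarrow> bool" where
  "smooth_vf A U X \<longleftrightarrow>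
     (\<forall>c\<in>A. smooth_fn A (U \<inter> chart_dom c) (\<lambda>q. dirderiv A q (X q) (coord c)))"

text \<open>\<open>[X,Y]\<^sup>k = X(Y\<^sup>k) - Y(X\<^sup>k)\<close> in the chart chosen at \<open>p\<close>.\<close>

definition lie_bracket :: "'m atlas \<Rightarrow> 'm vfield \<Rightarrow> 'm vfield \<Rightarrow> 'm vfield" where
  "lie_bracket A X Y p =
     dirderiv A p (X p) (\<lambda>q. dirderiv A q (Y q) (coord (chart_at A p))) -
     dirderiv A p (Y p) (\<lambda>q. dirderiv A q (X q) (coord (chart_at A p)))"

text \<open>
  The vector field, defined near \<open>p\<close>, with constant components \<open>v\<close> in the chart chosen at \<open>p\<close>;
  its value at \<open>p\<close> is \<open>v\<close>.
\<close>

definition coord_field :: "'m atlas \<Rightarrow> 'm \<Rightarrow> real^3 \<Rightarrow> 'm vfield" where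
  "coord_field A p v q =
     frechet_derivative (coord (chart_at A q) \<circ> param (chart_at A p)) (at (coord (chart_at A p) q)) v"

text \<open>Since the atlas is oriented, the chart chosen at each point is positively oriented.\<close>

definition positive_basis :: "real^3 \<Rightarrow> real^3 \<Rightarrow> real^3 \<Rightarrow> bool" where
  "positive_basis u v w \<longleftrightarrow> det (vector [u, v, w] :: real^3^3) > 0"

text \<open>Exterior derivative of a 1-form, \<open>d\<omega>(X,Y) = X(\<omega>(Y)) - Y(\<omega>(X)) - \<omega>([X,Y])\<close>.\<close>

definition ext_deriv1 ::
    "'m atlas \<Rightarrow> ('m \<Rightarrow> real^3 \<Rightarrow> real) \<Rightarrow> 'm vfield \<Rightarrow> 'm vfield \<Rightarrow> 'm \<Rightarrow> real" where
  "ext_deriv1 A \<omega> X Y p =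
     dirderiv A p (X p) (\<lambda>q. \<omega> q (Y q)) - dirderiv A p (Y p) (\<lambda>q. \<omega> q (X q))
     - \<omega> p (lie_bracket A X Y p)"


section \<open>Riemannian metric and Levi-Civita connection\<close>

type_synonym 'm metric = "'m \<Rightarrow> real^3 \<Rightarrow> real^3 \<Rightarrow> real"

definition riemannian_metric :: "'m::topological_space atlas \<Rightarrow> 'm metric \<Rightarrow> bool" where
  "riemannian_metric A g \<longleftrightarrow>
     (\<forall>p. bilinear (g p) \<and> (\<forall>v w. g p v w = g p w v) \<and> (\<forall>v. v \<noteq> 0 \<longrightarrow> g p v v > 0)) \<and>
     (\<forall>U X Y. open U \<and> smooth_vf A U X \<and> smooth_vf A U Y \<longrightarrow>
        smooth_fn A U (\<lambda>q. g q (X q) (Y q)))"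

text \<open>
  A connection on the tangent bundle takes a point, a tangent vector at that point and a
  vector field which is smooth near the point. Its values on other arguments are unspecified.
\<close>

type_synonym 'm connection = "'m \<Rightarrow> real^3 \<Rightarrow> 'm vfield \<Rightarrow> real^3"

definition affine_connection :: "'m::topological_space atlas \<Rightarrow> 'm connection \<Rightarrow> bool" where
  "affine_connection A nab \<longleftrightarrow>
     (\<forall>U X Y. open U \<and> smooth_vf A U X \<and> smooth_vf A U Y \<longrightarrow>
        smooth_vf A U (\<lambda>q. nab q (X q) Y) \<and>
        (\<forall>p\<in>U. linear (\<lambda>v. nab p v Y)) \<and>
        (\<forall>p\<in>U. \<forall>v. nab p v (\<lambda>q. X q + Y q) = nab p v X + nab p v Y)) \<and>
     (\<forall>U f Y. open U \<and> smooth_fn A U f \<and> smooth_vf A U Y \<longrightarrow>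
        (\<forall>p\<in>U. \<forall>v. nab p v (\<lambda>q. f q *\<^sub>R Y q) = dirderiv A p v f *\<^sub>R Y p + f p *\<^sub>R nab p v Y))"

definition levi_civita ::
    "'m::topological_space atlas \<Rightarrow> 'm metric \<Rightarrow> 'm connection \<Rightarrow> bool" where
  "levi_civita A g nab \<longleftrightarrow> affine_connection A nab \<and>
     (\<forall>U X Y. open U \<and> smooth_vf A U X \<and> smooth_vf A U Y \<longrightarrow>
        (\<forall>p\<in>U. nab p (X p) Y - nab p (Y p) X = lie_bracket A X Y p) \<and>
        (\<forall>p\<in>U. \<forall>v. dirderiv A p v (\<lambda>q. g q (X q) (Y q)) =
           g p (nab p v X) (Y p) + g p (X p) (nab p v Y)))"

definition curvature ::
    "'m atlas \<Rightarrow> 'm connection \<Rightarrow> 'm vfield \<Rightarrow> 'm vfield \<Rightarrow> 'm vfield \<Rightarrow> 'm vfield" where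
  "curvature A nab X Y Z p =
     nab p (X p) (\<lambda>q. nab q (Y q) Z) - nab p (Y p) (\<lambda>q. nab q (X q) Z)
     - nab p (lie_bracket A X Y p) Z"

text \<open>The value of the curvature tensor on tangent vectors, which are first extended to fields.\<close>

definition riem ::
    "'m atlas \<Rightarrow> 'm connection \<Rightarrow> 'm \<Rightarrow> real^3 \<Rightarrow> real^3 \<Rightarrow> real^3 \<Rightarrow> real^3" where
  "riem A nab p u v w =
     curvature A nab (coord_field A p u) (coord_field A p v) (coord_field A p w) p"

definition ricci_form :: "'m atlas \<Rightarrow> 'm connection \<Rightarrow> 'm \<Rightarrow> real^3 \<Rightarrow> real^3 \<Rightarrow> real" where
  "ricci_form A nab p v w = trace (matrix (\<lambda>u. riem A nab p u v w))"

definition ricci :: "'m atlas \<Rightarrow> 'm metric \<Rightarrow> 'm connection \<Rightarrow> 'm \<Rightarrow> real^3 \<Rightarrow> real^3" where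
  "ricci A g nab p v = (THE r. \<forall>w. g p r w = ricci_form A nab p v w)"

definition scal :: "'m atlas \<Rightarrow> 'm metric \<Rightarrow> 'm connection \<Rightarrow> 'm \<Rightarrow> real" where
  "scal A g nab p = trace (matrix (ricci A g nab p))"

text \<open>Note the sign: this is minus the usual divergence.\<close>

definition divergence :: "'m connection \<Rightarrow> 'm vfield \<Rightarrow> 'm \<Rightarrow> real" where
  "divergence nab X p = - trace (matrix (\<lambda>v. nab p v X))"

definition grad :: "'m atlas \<Rightarrow> 'm metric \<Rightarrow> ('m \<Rightarrow> real) \<Rightarrow> 'm vfield" where
  "grad A g f p = (THE w. \<forall>v. g p w v = dirderiv A p v f)"


section \<open>Riemannian flows\<close>

definition riemannian_flow ::
    "'m::topological_space atlas \<Rightarrow> 'm metric \<Rightarrow> 'm vfield \<Rightarrow> bool" where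
  "riemannian_flow A g \<xi> \<longleftrightarrow>
     smooth_vf A UNIV \<xi> \<and> (\<forall>p. g p (\<xi> p) (\<xi> p) = 1) \<and>
     (\<forall>U Z W. open U \<and> smooth_vf A U Z \<and> smooth_vf A U W \<and>
        (\<forall>p\<in>U. g p (Z p) (\<xi> p) = 0 \<and> g p (W p) (\<xi> p) = 0) \<longrightarrow>
        (\<forall>p\<in>U. dirderiv A p (\<xi> p) (\<lambda>q. g q (Z q) (W q))
           - g p (lie_bracket A \<xi> Z p) (W p) - g p (Z p) (lie_bracket A \<xi> W p) = 0))"

definition in_Q :: "'m metric \<Rightarrow> 'm vfield \<Rightarrow> 'm \<Rightarrow> real^3 \<Rightarrow> bool" where
  "in_Q g \<xi> p z \<longleftrightarrow> g p z (\<xi> p) = 0"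

definition proj_Q :: "'m metric \<Rightarrow> 'm vfield \<Rightarrow> 'm \<Rightarrow> real^3 \<Rightarrow> real^3" where
  "proj_Q g \<xi> p v = v - g p v (\<xi> p) *\<^sub>R \<xi> p"

definition positive_onb_Q :: "'m metric \<Rightarrow> 'm vfield \<Rightarrow> 'm \<Rightarrow> real^3 \<Rightarrow> real^3 \<Rightarrow> bool" where
  "positive_onb_Q g \<xi> p e\<^sub>1 e\<^sub>2 \<longleftrightarrow>
     in_Q g \<xi> p e\<^sub>1 \<and> in_Q g \<xi> p e\<^sub>2 \<and>
     g p e\<^sub>1 e\<^sub>1 = 1 \<and> g p e\<^sub>2 e\<^sub>2 = 1 \<and> g p e\<^sub>1 e\<^sub>2 = 0 \<and> positive_basis (\<xi> p) e\<^sub>1 e\<^sub>2"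

text \<open>The rotation with \<open>J e\<^sub>1 = e\<^sub>2\<close> and \<open>J e\<^sub>2 = - e\<^sub>1\<close>; only meaningful on \<open>Q\<close>.\<close>

definition J_Q :: "'m metric \<Rightarrow> 'm vfield \<Rightarrow> 'm \<Rightarrow> real^3 \<Rightarrow> real^3" where
  "J_Q g \<xi> p z = (THE w. \<exists>e\<^sub>1 e\<^sub>2 s t. positive_onb_Q g \<xi> p e\<^sub>1 e\<^sub>2 \<and>
     z = s *\<^sub>R e\<^sub>1 + t *\<^sub>R e\<^sub>2 \<and> w = s *\<^sub>R e\<^sub>2 - t *\<^sub>R e\<^sub>1)"

definition kappa :: "'m connection \<Rightarrow> 'm vfield \<Rightarrow> 'm vfield" where
  "kappa nab \<xi> p = nab p (\<xi> p) \<xi>"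

definition h_tensor :: "'m connection \<Rightarrow> 'm vfield \<Rightarrow> 'm \<Rightarrow> real^3 \<Rightarrow> real^3" where
  "h_tensor nab \<xi> p z = nab p z \<xi>"

definition Omega ::
    "'m metric \<Rightarrow> 'm connection \<Rightarrow> 'm vfield \<Rightarrow> 'm \<Rightarrow> real^3 \<Rightarrow> real^3 \<Rightarrow> real" where
  "Omega g nab \<xi> p v w = g p (h_tensor nab \<xi> p (proj_Q g \<xi> p v)) (proj_Q g \<xi> p w)"

text \<open>
  The connection on \<open>Q\<close>, extended linearly from \<open>v = \<xi>\<close> and \<open>v \<in> Q\<close>; \<open>Z\<close> is a section of \<open>Q\<close>.
\<close>

definition transversal_nabla ::
    "'m atlas \<Rightarrow> 'm metric \<Rightarrow> 'm connection \<Rightarrow> 'm vfield \<Rightarrow> 'm connection" where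
  "transversal_nabla A g nab \<xi> p v Z =
     g p v (\<xi> p) *\<^sub>R proj_Q g \<xi> p (lie_bracket A \<xi> Z p)
     + proj_Q g \<xi> p (nab p (proj_Q g \<xi> p v) Z)"


section \<open>Spin structures and spinors\<close>

text \<open>
  The complex spin representation of the Clifford algebra of \<open>real^3\<close> (with \<open>v\<cdot>v = -|v|\<^sup>2\<close>), given
  by \<open>-\<i>\<close> times the Pauli matrices. Of the two inequivalent representations it is the one in which
  \<open>-\<gamma>\<^sub>1\<gamma>\<^sub>2\<gamma>\<^sub>3\<close> is the identity. Under it \<open>Spin(3)\<close> becomes \<open>SU(2)\<close>, and the covering
  \<open>Spin(3) \<rightarrow> SO(3)\<close> sends \<open>s\<close> to the \<open>R\<close> with \<open>s \<gamma>\<^sub>b s\<^sup>-\<^sup>1 = \<Sum>\<^sub>a R\<^sub>a\<^sub>b \<gamma>\<^sub>a\<close>.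
\<close>

definition cgamma :: "3 \<Rightarrow> complex^2^2" where
  "cgamma a =
     (if a = 1 then vector [vector [0, - \<i>], vector [- \<i>, 0]]
      else if a = 2 then vector [vector [0, - 1], vector [1, 0]]
      else vector [vector [- \<i>, 0], vector [0, \<i>]])"

lemma cgamma_clifford:
  "cgamma a ** cgamma b + cgamma b ** cgamma a = (if a = b then mat (- 2) else 0)"
  using exhaust_3[of a] exhaust_3[of b]
  by (auto simp: cgamma_def vec_eq_iff forall_2 matrix_matrix_mult_def sum_2 mat_def)

lemma cgamma_volume: "- (cgamma 1 ** cgamma 2 ** cgamma 3) = mat 1"
  by (simp add: cgamma_def vec_eq_iff forall_2 matrix_matrix_mult_def sum_2 mat_def)

definition SU2 :: "(complex^2^2) set" where
  "SU2 = {s. s ** (\<chi> i j. cnj (s $ j $ i)) = mat 1 \<and> det s = 1}"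

text \<open>
  A spin structure, as a lift to \<open>Spin(3)\<close> of a cocycle of the bundle of positively oriented
  orthonormal frames: an open cover with a frame on each member, and lifts of the transition
  functions which satisfy the cocycle condition. Over \<open>sdom S i\<close> the frame trivializes the
  spinor bundle, and trivializations are glued by \<open>slift\<close>.
\<close>

record ('i, 'm) spin_data =
  sindex :: "'i set"
  sdom :: "'i \<Rightarrow> 'm set"
  sframe :: "'i \<Rightarrow> 3 \<Rightarrow> 'm \<Rightarrow> real^3"
  slift :: "'i \<Rightarrow> 'i \<Rightarrow> 'm \<Rightarrow> complex^2^2"

definition spin_structure ::
    "'m::topological_space atlas \<Rightarrow> 'm metric \<Rightarrow> ('i, 'm) spin_data \<Rightarrow> bool" where
  "spin_structure A g S \<longleftrightarrow>
     (\<Union>i\<in>sindex S. sdom S i) = UNIV \<and>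
     (\<forall>i\<in>sindex S. open (sdom S i) \<and> (\<forall>a. smooth_vf A (sdom S i) (sframe S i a)) \<and>
        (\<forall>p\<in>sdom S i.
           (\<forall>a b. g p (sframe S i a p) (sframe S i b p) = (if a = b then 1 else 0)) \<and>
           positive_basis (sframe S i 1 p) (sframe S i 2 p) (sframe S i 3 p))) \<and>
     (\<forall>i\<in>sindex S. \<forall>j\<in>sindex S.
        smooth_fn A (sdom S i \<inter> sdom S j) (slift S i j) \<and>
        (\<forall>p \<in> sdom S i \<inter> sdom S j. slift S i j p \<in> SU2 \<and>
           (\<forall>b. slift S i j p ** cgamma b =
              (\<Sum>a\<in>UNIV. g p (sframe S i a p) (sframe S j b p) *\<^sub>R cgamma a) ** slift S i j p))) \<and>
     (\<forall>i\<in>sindex S. \<forall>j\<in>sindex S. \<forall>k\<in>sindex S. \<forall>p \<in> sdom S i \<inter> sdom S j \<inter> sdom S k.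
        slift S i j p ** slift S j k p = slift S i k p)"

text \<open>\<open>\<psi> i\<close> is the local representative of the section \<open>\<psi>\<close> in the \<open>i\<close>-th trivialization.\<close>

type_synonym ('i, 'm) spinor = "'i \<Rightarrow> 'm \<Rightarrow> complex^2"

definition spinor_field ::
    "'m atlas \<Rightarrow> ('i, 'm) spin_data \<Rightarrow> ('i, 'm) spinor \<Rightarrow> bool" where
  "spinor_field A S \<psi> \<longleftrightarrow>
     (\<forall>i\<in>sindex S. smooth_fn A (sdom S i) (\<psi> i)) \<and>
     (\<forall>i\<in>sindex S. \<forall>j\<in>sindex S. \<forall>p \<in> sdom S i \<inter> sdom S j. \<psi> i p = slift S i j p *v \<psi> j p)"

definition nonzero_spinor :: "('i, 'm) spin_data \<Rightarrow> ('i, 'm) spinor \<Rightarrow> bool" where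
  "nonzero_spinor S \<psi> \<longleftrightarrow> (\<exists>i\<in>sindex S. \<exists>p\<in>sdom S i. \<psi> i p \<noteq> 0)"

text \<open>
  The following operations are written in the \<open>i\<close>-th trivialization, at \<open>p \<in> sdom S i\<close>.
\<close>

definition cliff ::
    "'m metric \<Rightarrow> ('i, 'm) spin_data \<Rightarrow> 'i \<Rightarrow> 'm \<Rightarrow> real^3 \<Rightarrow> complex^2 \<Rightarrow> complex^2" where
  "cliff g S i p v x = (\<Sum>a\<in>UNIV. g p v (sframe S i a p) *\<^sub>R (cgamma a *v x))"

text \<open>A 2-form \<open>\<omega>\<close> acts by \<open>\<Sum>\<^sub>a\<^sub><\<^sub>b \<omega>(e\<^sub>a,e\<^sub>b) e\<^sub>a\<cdot>e\<^sub>b\<cdot>\<close>, which is half the sum over all \<open>a,b\<close>.\<close>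

definition cliff2 ::
    "('i, 'm) spin_data \<Rightarrow> 'i \<Rightarrow> 'm \<Rightarrow> (real^3 \<Rightarrow> real^3 \<Rightarrow> real) \<Rightarrow> complex^2 \<Rightarrow> complex^2" where
  "cliff2 S i p \<omega> x =
     (1/2) *\<^sub>R (\<Sum>a\<in>UNIV. \<Sum>b\<in>UNIV.
       \<omega> (sframe S i a p) (sframe S i b p) *\<^sub>R (cgamma a *v (cgamma b *v x)))"

text \<open>
  The spinorial Levi-Civita connection,
  \<open>\<nabla>\<^sub>v\<psi> = v(\<psi>) + 1/2 \<Sum>\<^sub>a\<^sub><\<^sub>b g(\<nabla>\<^sub>v e\<^sub>a, e\<^sub>b) e\<^sub>a\<cdot>e\<^sub>b\<cdot>\<psi>\<close>.
\<close>

definition spin_nabla ::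
    "'m atlas \<Rightarrow> 'm metric \<Rightarrow> 'm connection \<Rightarrow> ('i, 'm) spin_data \<Rightarrow>
     'i \<Rightarrow> 'm \<Rightarrow> real^3 \<Rightarrow> ('i, 'm) spinor \<Rightarrow> complex^2" where
  "spin_nabla A g nab S i p v \<psi> =
     dirderiv A p v (\<psi> i) +
     (1/4) *\<^sub>R (\<Sum>a\<in>UNIV. \<Sum>b\<in>UNIV.
       g p (nab p v (sframe S i a)) (sframe S i b p) *\<^sub>R (cgamma a *v (cgamma b *v \<psi> i p)))"

text \<open>The transversal spinorial connection in the direction of \<open>\<xi>\<close> and of \<open>z \<in> Q\<close>.\<close>

definition transversal_spin_nabla_xi ::
    "'m atlas \<Rightarrow> 'm metric \<Rightarrow> 'm connection \<Rightarrow> 'm vfield \<Rightarrow> ('i, 'm) spin_data \<Rightarrow>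
     'i \<Rightarrow> 'm \<Rightarrow> ('i, 'm) spinor \<Rightarrow> complex^2" where
  "transversal_spin_nabla_xi A g nab \<xi> S i p \<psi> =
     spin_nabla A g nab S i p (\<xi> p) \<psi>
     - (1/2) *\<^sub>R cliff2 S i p (Omega g nab \<xi> p) (\<psi> i p)
     - (1/2) *\<^sub>R cliff g S i p (\<xi> p) (cliff g S i p (kappa nab \<xi> p) (\<psi> i p))"

definition transversal_spin_nabla_Q ::
    "'m atlas \<Rightarrow> 'm metric \<Rightarrow> 'm connection \<Rightarrow> 'm vfield \<Rightarrow> ('i, 'm) spin_data \<Rightarrow>
     'i \<Rightarrow> 'm \<Rightarrow> real^3 \<Rightarrow> ('i, 'm) spinor \<Rightarrow> complex^2" where
  "transversal_spin_nabla_Q A g nab \<xi> S i p z \<psi> =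
     spin_nabla A g nab S i p z \<psi>
     - (1/2) *\<^sub>R cliff g S i p (\<xi> p) (cliff g S i p (h_tensor nab \<xi> p z) (\<psi> i p))"

text \<open>
  The equation for \<open>Z \<in> \<Gamma>(Q)\<close> only involves the values of \<open>Z\<close> at single points, so it is stated
  for vectors \<open>z \<in> Q\<^sub>p\<close>.
\<close>

definition transversal_killing_spinor ::
    "'m atlas \<Rightarrow> 'm metric \<Rightarrow> 'm connection \<Rightarrow> 'm vfield \<Rightarrow> ('i, 'm) spin_data \<Rightarrow>
     real \<Rightarrow> real \<Rightarrow> ('i, 'm) spinor \<Rightarrow> bool" where
  "transversal_killing_spinor A g nab \<xi> S \<alpha> \<beta> \<psi> \<longleftrightarrow> spinor_field A S \<psi> \<and>
     (\<forall>i\<in>sindex S. \<forall>p\<in>sdom S i.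
        transversal_spin_nabla_xi A g nab \<xi> S i p \<psi> = \<alpha> *\<^sub>R cliff g S i p (\<xi> p) (\<psi> i p) \<and>
        (\<forall>z. in_Q g \<xi> p z \<longrightarrow>
           transversal_spin_nabla_Q A g nab \<xi> S i p z \<psi> =
             \<beta> *\<^sub>R cliff g S i p (\<xi> p) (cliff g S i p z (\<psi> i p))))"

end

theory Submission
  imports Defs
begin

text \<open>
  In dimension three every operator in the Killing equation is Clifford multiplication by a vector, so
  the equation reads \<open>\<nabla>\<^sub>v\<psi> = K(v) \<cdot> \<psi>\<close> with an explicit \<open>K\<close> built from \<open>\<xi>\<close>, \<open>\<kappa>\<close>, \<open>b\<close>, \<open>\<alpha>\<close>, \<open>\<beta>\<close>. Such
  multiplications are skew, whence \<open>|\<psi>|\<close> is locally constant and \<open>\<psi>\<close> vanishes nowhere. It therefore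
  determines an orthonormal frame in which it has constant components, and the Killing equation turns
  into \<open>\<nabla>\<^sub>v e\<^sub>c = 2 K(v) \<times> e\<^sub>c\<close>. Comparing with \<open>\<nabla>\<^sub>v \<xi> = g(v,\<xi>)\<kappa> + h(v)\<close>, the components of \<open>\<xi>\<close> in this
  frame have derivative \<open>-2\<beta>\<close> times the projection of \<open>v\<close> to \<open>Q\<close>, so the curvature
  \<open>R(u,v)w = 2 (dK(u,v) + 2 K(u) \<times> K(v)) \<times> w\<close> only involves the first derivatives of \<open>b\<close> and \<open>\<kappa>\<close>. The
  first Bianchi identity is equivalent to (i) and (ii), and taking traces gives (iii).
\<close>

section \<open>Smooth maps\<close>

text \<open>A tangent vector is stored in a chart that may jump with its base point, so a vector
  field cannot be differentiated as a map into \<open>real^3\<close>. Every computation is therefore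
  moved to coefficient vectors (\<open>hat\<close>) in a smooth positive orthonormal frame, where
  the Levi-Civita connection is the ordinary derivative plus twice a cross product. The factor 2 is
  that of the double cover. A nowhere vanishing spinor of constant norm is a quaternion q of
  constant norm, its frame consists of the imaginary quaternions q e_c conj(q) divided by |q|^2, and
  if dq = a q with a imaginary, then the derivative of q e_c conj(q) is its commutator with a, which
  is twice the cross product. The new frame is only a rotation of the old one, and \<open>K\<close>
  is built from inner and cross products alone, so it has the same expression in both frames. Taking
  \<xi> = e_3 at the point of interest, which costs just a constant rotation, then leaves polynomial
  identities in \<alpha>, \<beta>, b, \<kappa> and first derivatives.\<close>

lemma frechet_derivative_cong_open:
  assumes "open S" "x \<in> S" "\<And>y. y \<in> S \<Longrightarrow> f y = g y"
  shows "frechet_derivative f (at x) = frechet_derivative g (at x)"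
proof -
  \<comment> \<open>\<open>frechet_derivative\<close> is a choice from this predicate, so equivalent
    predicates give the same choice even where neither function is differentiable.\<close>
  have "(f has_derivative D) (at x) \<longleftrightarrow> (g has_derivative D) (at x)" for D
    using assms by (metis has_derivative_transform_within_open)
  then show ?thesis
    by (simp add: frechet_derivative_def)
qed

lemma differentiable_cong_open:
  assumes "open S" "x \<in> S" "\<And>y. y \<in> S \<Longrightarrow> f y = g y" "f differentiable (at x)"
  shows "g differentiable (at x)"
  using assms unfolding differentiable_def by (metis has_derivative_transform_within_open)

lemma cdiff_on_cong:
  assumes "open S" "\<And>x. x \<in> S \<Longrightarrow> f x = g x" "cdiff_on n S f"
  shows "cdiff_on n S g"
  using assms(2,3)
proof (induction n arbitrary: f g)
  case 0
  then show ?case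
    by (simp add: continuous_on_eq)
next
  case (Suc n)
  have "g differentiable (at x)" if "x \<in> S" for x
    using Suc.prems assms(1) that by (auto intro: differentiable_cong_open[of S x f g])
  moreover have "cdiff_on n S (\<lambda>x. frechet_derivative g (at x) v)" for v
    using Suc.IH[of "\<lambda>x. frechet_derivative f (at x) v" "\<lambda>x. frechet_derivative g (at x) v"]
      Suc.prems frechet_derivative_cong_open[of S _ f g] assms(1)
    by auto
  ultimately show ?case by simp
qed

lemma cdiff_on_subset: "cdiff_on n S f \<Longrightarrow> T \<subseteq> S \<Longrightarrow> cdiff_on n T f"
  by (induction n arbitrary: f) (auto intro: continuous_on_subset)

lemma cdiff_on_Suc_D: "open S \<Longrightarrow> cdiff_on (Suc n) S f \<Longrightarrow> cdiff_on n S f"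
proof (induction n arbitrary: f)
  case 0
  then show ?case
    by (auto intro!: continuous_at_imp_continuous_on differentiable_imp_continuous_within)
next
  case (Suc n)
  then show ?case by simp
qed

lemma cdiff_on_const: "cdiff_on n S (\<lambda>x. c)"
  by (induction n arbitrary: c) auto

text \<open>Allows the derivative to be exhibited by a formula \<open>D\<close> instead of
  \<open>frechet_derivative\<close>; the inductive closure proofs below rest on it.\<close>

lemma cdiff_on_SucI:
  assumes "open S" "\<And>x. x \<in> S \<Longrightarrow> (f has_derivative D x) (at x)" "\<And>v. cdiff_on n S (\<lambda>x. D x v)"
  shows "cdiff_on (Suc n) S f"
proof -
  have "D x v = frechet_derivative f (at x) v" if "x \<in> S" for x v
    using frechet_derivative_at[OF assms(2)[OF that]] by simp
  then have "cdiff_on n S (\<lambda>x. frechet_derivative f (at x) v)" for v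
    by (intro cdiff_on_cong[OF assms(1) _ assms(3)])
  moreover have "f differentiable (at x)" if "x \<in> S" for x
    using assms(2)[OF that] by (rule differentiableI)
  ultimately show ?thesis by simp
qed

lemma cdiff_on_SucD:
  assumes "cdiff_on (Suc n) S f"
  shows "x \<in> S \<Longrightarrow> (f has_derivative frechet_derivative f (at x)) (at x)"
    and "cdiff_on n S (\<lambda>x. frechet_derivative f (at x) v)"
  using assms by (simp_all add: frechet_derivative_works[symmetric])

lemma cdiff_on_add:
  assumes "open S" "cdiff_on n S f" "cdiff_on n S g"
  shows "cdiff_on n S (\<lambda>x. f x + g x)"
  using assms(2,3)
proof (induction n arbitrary: f g)
  case 0
  then show ?case by (simp add: continuous_on_add)
next
  case (Suc n)
  show ?case
    by (rule cdiff_on_SucI[OF assms(1),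
          where D="\<lambda>x v. frechet_derivative f (at x) v + frechet_derivative g (at x) v"];
      intro has_derivative_add Suc.IH
        cdiff_on_SucD[OF Suc.prems(1)] cdiff_on_SucD[OF Suc.prems(2)])
qed

lemma cdiff_on_bilinear:
  assumes "open S" "bounded_bilinear B" "cdiff_on n S f" "cdiff_on n S g"
  shows "cdiff_on n S (\<lambda>x. B (f x) (g x))"
  using assms(3,4)
proof (induction n arbitrary: f g)
  case 0
  then show ?case
    using bounded_bilinear.continuous_on[OF assms(2)] by auto
next
  case (Suc n)
  \<comment> \<open>The product rule leaves one factor undifferentiated, so the induction hypothesis
    is also applied to \<open>f\<close> and \<open>g\<close> themselves at the lower order.\<close>
  note f = cdiff_on_Suc_D[OF assms(1) Suc.prems(1)] and g = cdiff_on_Suc_D[OF assms(1) Suc.prems(2)]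
  show ?case
    by (rule cdiff_on_SucI[OF assms(1), where D="\<lambda>x v.
          B (f x) (frechet_derivative g (at x) v) + B (frechet_derivative f (at x) v) (g x)"];
      intro bounded_bilinear.FDERIV[OF assms(2)] cdiff_on_add[OF assms(1)]
        Suc.IH f g cdiff_on_SucD[OF Suc.prems(1)] cdiff_on_SucD[OF Suc.prems(2)])
qed

lemma cdiff_on_sum:
  assumes "open S" "finite I" "\<And>i. i \<in> I \<Longrightarrow> cdiff_on n S (f i)"
  shows "cdiff_on n S (\<lambda>x. \<Sum>i\<in>I. f i x)"
  using assms(2,3)
  by (induction I) (auto simp: cdiff_on_const intro: cdiff_on_add[OF assms(1)])

lemma cdiff_on_linear:
  assumes "open S" "bounded_linear L" "cdiff_on n S f"
  shows "cdiff_on n S (\<lambda>x. L (f x))"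
  using assms(3)
proof (induction n arbitrary: f)
  case 0
  then show ?case
    using bounded_linear.continuous_on[OF assms(2)] by auto
next
  case (Suc n)
  show ?case
    by (rule cdiff_on_SucI[OF assms(1), where D="\<lambda>x v. L (frechet_derivative f (at x) v)"];
      intro bounded_linear.has_derivative[OF assms(2)] Suc.IH
        cdiff_on_SucD[OF Suc.prems])
qed

lemma linear_sum_Basis:
  fixes L :: "'a::euclidean_space \<Rightarrow> 'b::real_normed_vector"
  assumes "linear L"
  shows "L v = (\<Sum>i\<in>Basis. (v \<bullet> i) *\<^sub>R L i)"
proof -
  have "L v = L (\<Sum>i\<in>Basis. (v \<bullet> i) *\<^sub>R i)"
    by (simp add: euclidean_representation)
  then show ?thesis
    by (simp add: linear_sum[OF assms] linear_scale[OF assms])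
qed

lemma cdiff_on_compose:
  fixes f :: "'b::euclidean_space \<Rightarrow> 'c::real_normed_vector" and g :: "'a::euclidean_space \<Rightarrow> 'b"
  assumes "open S" "open T" "g ` S \<subseteq> T" "cdiff_on n T f" "cdiff_on n S g"
  shows "cdiff_on n S (\<lambda>x. f (g x))"
  using assms(4,5)
proof (induction n arbitrary: f)
  case 0
  then show ?case
    using assms(3) by (auto intro: continuous_on_compose2)
next
  case (Suc n)
  \<comment> \<open>The chain rule evaluates the derivative of \<open>f\<close> in a direction that
    varies with x. Expanding that direction in \<open>Basis\<close> leaves derivatives in fixed
    directions, to which the induction hypothesis applies.\<close>
  let ?D = "\<lambda>x v. \<Sum>i\<in>Basis. (frechet_derivative g (at x) v \<bullet> i) *\<^sub>R frechet_derivative f (at (g x)) i"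
  have D: "((\<lambda>x. f (g x)) has_derivative ?D x) (at x)" if "x \<in> S" for x
  proof -
    have f: "f differentiable (at (g x))" and g: "g differentiable (at x)"
      using Suc.prems that assms(3) by auto
    have "((\<lambda>x. f (g x)) has_derivative (\<lambda>v. frechet_derivative f (at (g x)) (frechet_derivative g (at x) v))) (at x)"
      using diff_chain_at[of g _ x f] f g by (simp add: frechet_derivative_works o_def)
    moreover have "frechet_derivative f (at (g x)) (frechet_derivative g (at x) v) = ?D x v" for v
      using linear_sum_Basis[OF linear_frechet_derivative[OF f]] .
    ultimately show ?thesis by simp
  qed
  have g': "cdiff_on n S g"
    using cdiff_on_Suc_D[OF assms(1) Suc.prems(2)] .
  have "cdiff_on n S (\<lambda>x. (frechet_derivative g (at x) v \<bullet> i) *\<^sub>R frechet_derivative f (at (g x)) i)" for v i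
    by (rule cdiff_on_bilinear[OF assms(1) bounded_bilinear_scaleR])
      (intro cdiff_on_linear[OF assms(1) bounded_linear_inner_left] cdiff_on_SucD(2)[OF Suc.prems(2)]
        Suc.IH[of "\<lambda>y. frechet_derivative f (at y) i"] cdiff_on_SucD(2)[OF Suc.prems(1)] g')+
  then have "cdiff_on n S (\<lambda>x. ?D x v)" for v
    by (intro cdiff_on_sum[OF assms(1) finite_Basis])
  then show ?case
    using D by (intro cdiff_on_SucI[OF assms(1)]) auto
qed

lemma smooth_on_cong:
  assumes "open S" "\<And>x. x \<in> S \<Longrightarrow> f x = g x" "smooth_on S f"
  shows "smooth_on S g"
  using assms(3) cdiff_on_cong[OF assms(1,2)] by (simp add: smooth_on_def)

lemma smooth_on_subset: "smooth_on S f \<Longrightarrow> T \<subseteq> S \<Longrightarrow> smooth_on T f"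
  unfolding smooth_on_def using cdiff_on_subset by blast

lemma smooth_on_const: "smooth_on S (\<lambda>x. c)"
  by (simp add: smooth_on_def cdiff_on_const)

lemma smooth_on_ident: "smooth_on S (\<lambda>x. x)"
  unfolding smooth_on_def
proof
  show "cdiff_on n S (\<lambda>x. x)" for n
    by (cases n) (auto simp: cdiff_on_const)
qed

lemma smooth_on_add:
  "open S \<Longrightarrow> smooth_on S f \<Longrightarrow> smooth_on S g \<Longrightarrow> smooth_on S (\<lambda>x. f x + g x)"
  by (simp add: smooth_on_def cdiff_on_add)

lemma smooth_on_sum:
  "open S \<Longrightarrow> finite I \<Longrightarrow> (\<And>i. i \<in> I \<Longrightarrow> smooth_on S (f i)) \<Longrightarrow> smooth_on S (\<lambda>x. \<Sum>i\<in>I. f i x)"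
  by (simp add: smooth_on_def cdiff_on_sum)

lemma smooth_on_bilinear:
  "open S \<Longrightarrow> bounded_bilinear B \<Longrightarrow> smooth_on S f \<Longrightarrow> smooth_on S g \<Longrightarrow> smooth_on S (\<lambda>x. B (f x) (g x))"
  by (simp add: smooth_on_def cdiff_on_bilinear)

lemma smooth_on_linear:
  "open S \<Longrightarrow> bounded_linear L \<Longrightarrow> smooth_on S f \<Longrightarrow> smooth_on S (\<lambda>x. L (f x))"
  by (simp add: smooth_on_def cdiff_on_linear)

lemma smooth_on_compose:
  "open S \<Longrightarrow> open T \<Longrightarrow> g ` S \<subseteq> T \<Longrightarrow> smooth_on T f \<Longrightarrow> smooth_on S g \<Longrightarrow> smooth_on S (\<lambda>x. f (g x))"
  by (simp add: smooth_on_def cdiff_on_compose)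

lemma smooth_on_differentiable:
  assumes "smooth_on S f" "x \<in> S" shows "f differentiable (at x)"
proof -
  have "cdiff_on (Suc 0) S f"
    using assms(1) unfolding smooth_on_def by (rule spec)
  then show ?thesis
    using assms(2) by simp
qed

lemma smooth_on_has_derivative:
  "smooth_on S f \<Longrightarrow> x \<in> S \<Longrightarrow> (f has_derivative frechet_derivative f (at x)) (at x)"
  by (rule frechet_derivative_works[THEN iffD1, OF smooth_on_differentiable])

lemma smooth_on_frechet_derivative:
  assumes "smooth_on S f" shows "smooth_on S (\<lambda>x. frechet_derivative f (at x) v)"
  unfolding smooth_on_def
proof
  fix n
  have "cdiff_on (Suc n) S f"
    using assms unfolding smooth_on_def by (rule spec)
  then show "cdiff_on n S (\<lambda>x. frechet_derivative f (at x) v)"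
    by simp
qed

lemma smooth_on_frechet_derivative_along:
  assumes "open S" "smooth_on S f" "smooth_on S X"
  shows "smooth_on S (\<lambda>x. frechet_derivative f (at x) (X x))"
proof -
  have "smooth_on S (\<lambda>x. (X x \<bullet> i) *\<^sub>R frechet_derivative f (at x) i)" for i
    by (rule smooth_on_bilinear[OF assms(1) bounded_bilinear_scaleR])
      (intro smooth_on_linear[OF assms(1) bounded_linear_inner_left] assms smooth_on_frechet_derivative)+
  then have "smooth_on S (\<lambda>x. \<Sum>i\<in>Basis. (X x \<bullet> i) *\<^sub>R frechet_derivative f (at x) i)"
    by (intro smooth_on_sum[OF assms(1) finite_Basis])
  moreover have "(\<Sum>i\<in>Basis. (X x \<bullet> i) *\<^sub>R frechet_derivative f (at x) i) = frechet_derivative f (at x) (X x)"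
    if "x \<in> S" for x
    by (rule linear_sum_Basis[OF linear_frechet_derivative[OF smooth_on_differentiable[OF assms(2) that]],
          symmetric])
  ultimately show ?thesis
    by (rule smooth_on_cong[OF assms(1), rotated])
qed

section \<open>Symmetry of second derivatives\<close>

lemma DERIV_along_line:
  fixes f :: "'a::real_normed_vector \<Rightarrow> real"
  assumes "f differentiable (at (c + s *\<^sub>R u))"
  shows "((\<lambda>s. f (c + s *\<^sub>R u)) has_real_derivative frechet_derivative f (at (c + s *\<^sub>R u)) u) (at s)"
proof -
  let ?F = "frechet_derivative f (at (c + s *\<^sub>R u))"
  have f: "(f has_derivative ?F) (at (c + s *\<^sub>R u))"
    using assms frechet_derivative_works by blast
  have l: "((\<lambda>s. c + s *\<^sub>R u) has_derivative (\<lambda>t. t *\<^sub>R u)) (at s)"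
    by (auto intro!: derivative_eq_intros)
  have "((\<lambda>s. f (c + s *\<^sub>R u)) has_derivative (\<lambda>t. ?F (t *\<^sub>R u))) (at s)"
    using diff_chain_at[OF l, of f ?F] f by (simp add: o_def)
  moreover have "?F (t *\<^sub>R u) = t * ?F u" for t
    using linear_scale[OF linear_frechet_derivative[OF assms]] by simp
  ultimately show ?thesis
    by (simp add: has_field_derivative_def mult.commute[of _ "?F u"])
qed

text \<open>The mean value theorem is used twice: along u for the difference of \<open>f\<close>
  over the step h v, then along v for the u-derivative. The second difference is symmetric in u and
  v while the derivative on the right is not, and this forces the mixed derivatives to
  agree.\<close>

lemma second_difference_mean_value:
  fixes f :: "'a::euclidean_space \<Rightarrow> real"
  assumes "cdiff_on (Suc (Suc 0)) S f" "ball x e \<subseteq> S" "h > 0" "h * (norm u + norm v) < e"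
  obtains y where "dist y x \<le> h * (norm u + norm v)"
    "f (x + h *\<^sub>R u + h *\<^sub>R v) - f (x + h *\<^sub>R u) - f (x + h *\<^sub>R v) + f x
      = h\<^sup>2 * frechet_derivative (\<lambda>y. frechet_derivative f (at y) u) (at y) v"
proof -
  let ?Fu = "\<lambda>y. frechet_derivative f (at y) u"
  have bound: "norm (s *\<^sub>R u + t *\<^sub>R v) \<le> h * (norm u + norm v)"
    if "0 \<le> s" "s \<le> h" "0 \<le> t" "t \<le> h" for s t
  proof -
    have "norm (s *\<^sub>R u + t *\<^sub>R v) \<le> s * norm u + t * norm v"
      using that norm_triangle_ineq[of "s *\<^sub>R u" "t *\<^sub>R v"] by simp
    also have "\<dots> \<le> h * norm u + h * norm v"
      using that by (intro add_mono mult_right_mono) auto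
    finally show ?thesis
      by (simp add: algebra_simps)
  qed
  have inS: "x + s *\<^sub>R u + t *\<^sub>R v \<in> S"
    if "0 \<le> s" "s \<le> h" "0 \<le> t" "t \<le> h" for s t
  proof -
    have "dist x (x + s *\<^sub>R u + t *\<^sub>R v) = norm (s *\<^sub>R u + t *\<^sub>R v)"
      by (subst dist_commute) (simp add: dist_norm add.assoc)
    then show ?thesis
      using bound[OF that] assms(2,4) by (auto simp: subset_iff)
  qed
  have df: "f differentiable (at y)" and dFu: "?Fu differentiable (at y)" if "y \<in> S" for y
    using assms(1) that by auto
  let ?\<phi> = "\<lambda>s. f ((x + h *\<^sub>R v) + s *\<^sub>R u) - f (x + s *\<^sub>R u)"
  have "\<exists>s>0. s < h \<and> ?\<phi> h - ?\<phi> 0 = (h - 0) * (?Fu ((x + h *\<^sub>R v) + s *\<^sub>R u) - ?Fu (x + s *\<^sub>R u))"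
  proof (rule MVT2[OF assms(3)])
    fix s assume s: "0 \<le> s" "s \<le> h"
    have "(x + h *\<^sub>R v) + s *\<^sub>R u \<in> S" "x + s *\<^sub>R u \<in> S"
      using inS[of s h] inS[of s 0] s by (simp_all add: algebra_simps)
    then show "(?\<phi> has_real_derivative (?Fu ((x + h *\<^sub>R v) + s *\<^sub>R u) - ?Fu (x + s *\<^sub>R u))) (at s)"
      by (intro DERIV_diff DERIV_along_line df)
  qed
  then obtain s where s: "0 < s" "s < h"
    and 1: "?\<phi> h - ?\<phi> 0 = h * (?Fu ((x + h *\<^sub>R v) + s *\<^sub>R u) - ?Fu (x + s *\<^sub>R u))"
    by auto
  let ?\<psi> = "\<lambda>t. ?Fu ((x + s *\<^sub>R u) + t *\<^sub>R v)"
  have "\<exists>t>0. t < h \<and> ?\<psi> h - ?\<psi> 0 = (h - 0) * frechet_derivative ?Fu (at ((x + s *\<^sub>R u) + t *\<^sub>R v)) v"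
  proof (rule MVT2[OF assms(3)])
    fix t assume t: "0 \<le> t" "t \<le> h"
    show "(?\<psi> has_real_derivative frechet_derivative ?Fu (at ((x + s *\<^sub>R u) + t *\<^sub>R v)) v) (at t)"
      using inS[of s t] s t by (intro DERIV_along_line dFu) auto
  qed
  then obtain t where t: "0 < t" "t < h"
    and 2: "?\<psi> h - ?\<psi> 0 = h * frechet_derivative ?Fu (at (x + s *\<^sub>R u + t *\<^sub>R v)) v"
    by auto
  show ?thesis
  proof
    show "dist (x + s *\<^sub>R u + t *\<^sub>R v) x \<le> h * (norm u + norm v)"
      using bound[of s t] s t by (simp add: dist_norm add.assoc)
    have "?\<phi> h - ?\<phi> 0 = h * (?\<psi> h - ?\<psi> 0)"
      using 1 by (simp add: algebra_simps)
    then show "f (x + h *\<^sub>R u + h *\<^sub>R v) - f (x + h *\<^sub>R u) - f (x + h *\<^sub>R v) + f x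
      = h\<^sup>2 * frechet_derivative ?Fu (at (x + s *\<^sub>R u + t *\<^sub>R v)) v"
      unfolding 2 by (simp add: power2_eq_square algebra_simps)
  qed
qed

lemma frechet_derivative_commute_real:
  fixes f :: "'a::euclidean_space \<Rightarrow> real"
  assumes "open S" "x \<in> S" "cdiff_on (Suc (Suc 0)) S f"
  shows "frechet_derivative (\<lambda>y. frechet_derivative f (at y) u) (at x) v
    = frechet_derivative (\<lambda>y. frechet_derivative f (at y) v) (at x) u"
proof -
  let ?D = "\<lambda>u v y. frechet_derivative (\<lambda>y. frechet_derivative f (at y) u) (at y) v"
  have "\<bar>?D u v x - ?D v u x\<bar> \<le> \<epsilon>" if "\<epsilon> > 0" for \<epsilon>
  proof -
    have "\<exists>d>0. \<forall>y. dist y x < d \<longrightarrow> dist (?D u v y) (?D u v x) < \<epsilon> / 2" for u v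
    proof -
      have "continuous_on S (?D u v)"
        using assms(3) by simp
      then have "isCont (?D u v) x"
        using assms(1,2) continuous_on_eq_continuous_at by blast
      then show ?thesis
        unfolding continuous_at_eps_delta using that half_gt_zero by blast
    qed
    then obtain d1 d2 where d: "d1 > 0" "d2 > 0"
      and d1: "\<And>y. dist y x < d1 \<Longrightarrow> dist (?D u v y) (?D u v x) < \<epsilon> / 2"
      and d2: "\<And>y. dist y x < d2 \<Longrightarrow> dist (?D v u y) (?D v u x) < \<epsilon> / 2"
      by meson
    obtain e where e: "e > 0" "ball x e \<subseteq> S"
      using assms(1,2) open_contains_ball by blast
    define m where "m = min e (min d1 d2)"
    \<comment> \<open>The summand 1 keeps the denominator positive when u = v = 0 and makes the
      bound by \<open>m\<close> strict.\<close>
    define h where "h = m / (norm u + norm v + 1)"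
    have "m > 0"
      using d e by (simp add: m_def)
    then have h: "h > 0" "h * (norm u + norm v) < m"
      using pos_divide_less_eq[of "norm u + norm v + 1" "m * (norm u + norm v)" m]
      by (simp_all add: h_def add_nonneg_pos)
    then have hm: "h * (norm u + norm v) < e" "h * (norm u + norm v) < d1" "h * (norm u + norm v) < d2"
      by (simp_all add: m_def)
    have hm': "h * (norm v + norm u) < e"
      using hm(1) by (simp add: add.commute)
    obtain y where y: "dist y x \<le> h * (norm u + norm v)"
      "f (x + h *\<^sub>R u + h *\<^sub>R v) - f (x + h *\<^sub>R u) - f (x + h *\<^sub>R v) + f x = h\<^sup>2 * ?D u v y"
      using second_difference_mean_value[OF assms(3) e(2) h(1) hm(1)] .
    obtain z where z: "dist z x \<le> h * (norm v + norm u)"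
      "f (x + h *\<^sub>R v + h *\<^sub>R u) - f (x + h *\<^sub>R v) - f (x + h *\<^sub>R u) + f x = h\<^sup>2 * ?D v u z"
      using second_difference_mean_value[OF assms(3) e(2) h(1) hm'] .
    have "h\<^sup>2 * ?D u v y = h\<^sup>2 * ?D v u z"
      using y(2) z(2) by (simp add: algebra_simps)
    then have "?D u v y = ?D v u z"
      using h(1) by simp
    moreover have "dist (?D u v y) (?D u v x) < \<epsilon> / 2" "dist (?D v u z) (?D v u x) < \<epsilon> / 2"
      using d1[of y] d2[of z] y(1) z(1) hm by (simp_all add: add.commute)
    ultimately show ?thesis
      unfolding dist_real_def by arith
  qed
  then show ?thesis
    by (metis abs_ge_zero abs_le_zero_iff dense_ge eq_iff_diff_eq_0)
qed

text \<open>The mean value argument concerns real-valued functions, so it is applied to each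
  coordinate of \<open>f\<close>.\<close>

lemma frechet_derivative_commute:
  fixes f :: "'a::euclidean_space \<Rightarrow> 'b::euclidean_space"
  assumes "open S" "x \<in> S" "smooth_on S f"
  shows "frechet_derivative (\<lambda>y. frechet_derivative f (at y) u) (at x) v
    = frechet_derivative (\<lambda>y. frechet_derivative f (at y) v) (at x) u"
proof (rule euclidean_eqI)
  fix i :: 'b
  have inner: "frechet_derivative (\<lambda>y. h y \<bullet> i) (at y) w = frechet_derivative h (at y) w \<bullet> i"
    if "h differentiable (at y)" for h :: "'a \<Rightarrow> 'b" and y w
    using frechet_derivative_at[OF bounded_linear.has_derivative[OF bounded_linear_inner_left
          frechet_derivative_works[THEN iffD1, OF that], of i]] by metis
  let ?f = "\<lambda>y. f y \<bullet> i"
  have D: "frechet_derivative (\<lambda>y. frechet_derivative f (at y) u) (at x) v \<bullet> i =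
      frechet_derivative (\<lambda>y. frechet_derivative ?f (at y) u) (at x) v" for u v
  proof -
    have "frechet_derivative (\<lambda>y. frechet_derivative ?f (at y) u) (at x)
        = frechet_derivative (\<lambda>y. frechet_derivative f (at y) u \<bullet> i) (at x)"
      using smooth_on_differentiable[OF assms(3)]
      by (intro frechet_derivative_cong_open[OF assms(1,2)] inner)
    then show ?thesis
      using inner[OF smooth_on_differentiable[OF smooth_on_frechet_derivative[OF assms(3)] assms(2)]]
      by simp
  qed
  have "cdiff_on (Suc (Suc 0)) S ?f"
    using smooth_on_linear[OF assms(1) bounded_linear_inner_left assms(3), of i]
    unfolding smooth_on_def by (rule spec)
  then show "frechet_derivative (\<lambda>y. frechet_derivative f (at y) u) (at x) v \<bullet> i
      = frechet_derivative (\<lambda>y. frechet_derivative f (at y) v) (at x) u \<bullet> i"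
    unfolding D by (rule frechet_derivative_commute_real[OF assms(1,2)])
qed

lemma frechet_derivative_along:
  fixes f :: "'a::euclidean_space \<Rightarrow> 'b::euclidean_space"
  assumes "open S" "x \<in> S" "smooth_on S f" "smooth_on S Y"
  shows "frechet_derivative (\<lambda>y. frechet_derivative f (at y) (Y y)) (at x) u =
    frechet_derivative f (at x) (frechet_derivative Y (at x) u)
      + frechet_derivative (\<lambda>y. frechet_derivative f (at y) (Y x)) (at x) u"
proof -
  let ?F = "\<lambda>i y. frechet_derivative f (at y) i"
  have F: "(?F i has_derivative frechet_derivative (?F i) (at x)) (at x)" for i
    by (rule smooth_on_has_derivative[OF smooth_on_frechet_derivative[OF assms(3)] assms(2)])
  have Y: "(Y has_derivative frechet_derivative Y (at x)) (at x)"
    by (rule smooth_on_has_derivative[OF assms(4,2)])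
  have lin: "?F v y = (\<Sum>i\<in>Basis. (v \<bullet> i) *\<^sub>R ?F i y)" if "y \<in> S" for v y
    by (rule linear_sum_Basis[OF linear_frechet_derivative[OF smooth_on_differentiable[OF assms(3) that]]])
  have "((\<lambda>y. \<Sum>i\<in>Basis. (Y y \<bullet> i) *\<^sub>R ?F i y) has_derivative
      (\<lambda>u. \<Sum>i\<in>Basis. (Y x \<bullet> i) *\<^sub>R frechet_derivative (?F i) (at x) u
        + (frechet_derivative Y (at x) u \<bullet> i) *\<^sub>R ?F i x)) (at x)"
    by (intro has_derivative_sum has_derivative_scaleR has_derivative_inner_left Y F)
  then have "((\<lambda>y. ?F (Y y) y) has_derivative
      (\<lambda>u. \<Sum>i\<in>Basis. (Y x \<bullet> i) *\<^sub>R frechet_derivative (?F i) (at x) u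
        + (frechet_derivative Y (at x) u \<bullet> i) *\<^sub>R ?F i x)) (at x)"
    by (rule has_derivative_transform_within_open[OF _ assms(1,2)]) (rule lin[symmetric])
  from frechet_derivative_at[OF this]
  have 1: "frechet_derivative (\<lambda>y. ?F (Y y) y) (at x) u =
      (\<Sum>i\<in>Basis. (Y x \<bullet> i) *\<^sub>R frechet_derivative (?F i) (at x) u)
        + (\<Sum>i\<in>Basis. (frechet_derivative Y (at x) u \<bullet> i) *\<^sub>R ?F i x)"
    by (simp add: fun_eq_iff sum.distrib)
  have "((\<lambda>y. \<Sum>i\<in>Basis. (Y x \<bullet> i) *\<^sub>R ?F i y) has_derivative
      (\<lambda>u. \<Sum>i\<in>Basis. (Y x \<bullet> i) *\<^sub>R frechet_derivative (?F i) (at x) u)) (at x)"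
    by (intro has_derivative_sum has_derivative_scaleR_right F)
  then have "((\<lambda>y. ?F (Y x) y) has_derivative
      (\<lambda>u. \<Sum>i\<in>Basis. (Y x \<bullet> i) *\<^sub>R frechet_derivative (?F i) (at x) u)) (at x)"
    by (rule has_derivative_transform_within_open[OF _ assms(1,2)]) (rule lin[symmetric])
  from fun_cong[OF frechet_derivative_at[OF this], of u]
  have 2: "frechet_derivative (\<lambda>y. ?F (Y x) y) (at x) u =
      (\<Sum>i\<in>Basis. (Y x \<bullet> i) *\<^sub>R frechet_derivative (?F i) (at x) u)"
    by (rule sym)
  show ?thesis
    unfolding 1 2 lin[OF assms(2), of "frechet_derivative Y (at x) u"] by (rule add.commute)
qed

section \<open>Calculus on the manifold\<close>

locale oriented_mfd =
  fixes A :: "'m::{t2_space, second_countable_topology} atlas"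
  assumes oriented: "oriented_manifold A"
begin

lemma is_chart: "c \<in> A \<Longrightarrow> is_chart c"
  using oriented by (simp add: oriented_manifold_def)

lemma open_chart_dom: "c \<in> A \<Longrightarrow> open (chart_dom c)"
  using is_chart by (simp add: is_chart_def)

lemma param_coord[simp]: "c \<in> A \<Longrightarrow> q \<in> chart_dom c \<Longrightarrow> param c (coord c q) = q"
  using is_chart[of c] unfolding is_chart_def homeomorphism_def by blast

lemma continuous_on_coord: "c \<in> A \<Longrightarrow> continuous_on (chart_dom c) (coord c)"
  using is_chart[of c] unfolding is_chart_def homeomorphism_def by blast

lemma open_coord_image:
  assumes "c \<in> A" "open V" "V \<subseteq> chart_dom c" shows "open (coord c ` V)"
proof -
  have h: "homeomorphism (chart_dom c) (coord c ` chart_dom c) (coord c) (param c)"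
    and o: "open (coord c ` chart_dom c)"
    using is_chart[OF assms(1)] by (auto simp: is_chart_def)
  have "openin (top_of_set (chart_dom c)) V"
    using assms by (simp add: open_chart_dom openin_open_eq)
  then have "openin (top_of_set (coord c ` chart_dom c)) (coord c ` V)"
    by (rule homeomorphism_imp_open_map[OF h])
  then show ?thesis
    using o openin_open_eq by blast
qed

lemma open_coord_dom: "c \<in> A \<Longrightarrow> open U \<Longrightarrow> open (coord c ` (chart_dom c \<inter> U))"
  by (intro open_coord_image) (auto simp: open_chart_dom)

lemma chart_at: "chart_at A p \<in> A" "p \<in> chart_dom (chart_at A p)"
proof -
  have "\<exists>c. c \<in> A \<and> p \<in> chart_dom c"
    using oriented unfolding oriented_manifold_def by (metis UNIV_I UN_E)
  from someI_ex[OF this] show "chart_at A p \<in> A" "p \<in> chart_dom (chart_at A p)"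
    by (auto simp: chart_at_def)
qed

lemma smooth_transition:
  "c \<in> A \<Longrightarrow> c' \<in> A \<Longrightarrow> smooth_on (coord c ` (chart_dom c \<inter> chart_dom c')) (coord c' \<circ> param c)"
  using oriented by (simp add: oriented_manifold_def)

lemma smooth_fn_subset: "smooth_fn A U f \<Longrightarrow> V \<subseteq> U \<Longrightarrow> smooth_fn A V f"
  unfolding smooth_fn_def by (meson Int_mono image_mono order_refl smooth_on_subset)

lemma smooth_fn_cong:
  assumes "open U" "\<And>q. q \<in> U \<Longrightarrow> f q = g q" "smooth_fn A U f"
  shows "smooth_fn A U g"
  unfolding smooth_fn_def
proof
  fix c assume c: "c \<in> A"
  show "smooth_on (coord c ` (chart_dom c \<inter> U)) (g \<circ> param c)"
  proof (rule smooth_on_cong[OF open_coord_dom[OF c assms(1)]])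
    show "smooth_on (coord c ` (chart_dom c \<inter> U)) (f \<circ> param c)"
      using assms(3) c by (simp add: smooth_fn_def)
  qed (use c assms(2) in auto)
qed

lemma smooth_fn_const: "smooth_fn A U (\<lambda>q. k)"
  by (simp add: smooth_fn_def o_def smooth_on_const)

lemma smooth_fn_add:
  "open U \<Longrightarrow> smooth_fn A U f \<Longrightarrow> smooth_fn A U g \<Longrightarrow> smooth_fn A U (\<lambda>q. f q + g q)"
  by (simp add: smooth_fn_def o_def smooth_on_add open_coord_dom)

lemma smooth_fn_sum:
  "open U \<Longrightarrow> finite I \<Longrightarrow> (\<And>i. i \<in> I \<Longrightarrow> smooth_fn A U (f i)) \<Longrightarrow> smooth_fn A U (\<lambda>q. \<Sum>i\<in>I. f i q)"
  by (simp add: smooth_fn_def o_def smooth_on_sum open_coord_dom)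

lemma smooth_fn_linear:
  assumes "open U" "bounded_linear L" "smooth_fn A U f"
  shows "smooth_fn A U (\<lambda>q. L (f q))"
  unfolding smooth_fn_def
proof
  fix c assume c: "c \<in> A"
  show "smooth_on (coord c ` (chart_dom c \<inter> U)) ((\<lambda>q. L (f q)) \<circ> param c)"
    using smooth_on_linear[OF open_coord_dom[OF c assms(1)] assms(2), of "f \<circ> param c"] assms(3) c
    by (simp add: smooth_fn_def o_def)
qed

lemma smooth_fn_bilinear:
  assumes "open U" "bounded_bilinear B" "smooth_fn A U f" "smooth_fn A U g"
  shows "smooth_fn A U (\<lambda>q. B (f q) (g q))"
  unfolding smooth_fn_def
proof
  fix c assume c: "c \<in> A"
  show "smooth_on (coord c ` (chart_dom c \<inter> U)) ((\<lambda>q. B (f q) (g q)) \<circ> param c)"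
    using smooth_on_bilinear[OF open_coord_dom[OF c assms(1)] assms(2), of "f \<circ> param c" "g \<circ> param c"]
      assms(3,4) c
    by (simp add: smooth_fn_def o_def)
qed

lemmas smooth_fn_scaleR = smooth_fn_bilinear[OF _ bounded_bilinear_scaleR]
lemmas smooth_fn_inner = smooth_fn_bilinear[OF _ bounded_bilinear_inner]

lemma smooth_fn_minus: "open U \<Longrightarrow> smooth_fn A U f \<Longrightarrow> smooth_fn A U (\<lambda>q. - f q)"
  by (rule smooth_fn_linear[OF _ bounded_linear_minus[OF bounded_linear_ident]])

lemma smooth_fn_diff:
  "open U \<Longrightarrow> smooth_fn A U f \<Longrightarrow> smooth_fn A U g \<Longrightarrow> smooth_fn A U (\<lambda>q. f q - g q)"
  using smooth_fn_add[of U f "\<lambda>q. - g q"] smooth_fn_minus[of U g] by simp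

lemma smooth_fn_one_chart:
  assumes c: "c \<in> A" and U: "open U" "U \<subseteq> chart_dom c" and f: "smooth_on (coord c ` U) (f \<circ> param c)"
  shows "smooth_fn A U f"
  unfolding smooth_fn_def
proof
  fix c' assume c': "c' \<in> A"
  let ?W = "coord c' ` (chart_dom c' \<inter> U)"
  have W: "open ?W"
    using open_coord_dom[OF c' U(1)] .
  have t: "smooth_on ?W (coord c \<circ> param c')"
    using smooth_transition[OF c' c] U by (elim smooth_on_subset) auto
  have "smooth_on ?W (\<lambda>x. (f \<circ> param c) ((coord c \<circ> param c') x))"
    using c' by (intro smooth_on_compose[OF W open_coord_image[OF c U] _ f t]) (auto simp: param_coord)
  then show "smooth_on ?W (f \<circ> param c')"
    by (rule smooth_on_cong[OF W, rotated]) (use c c' U in \<open>auto simp: subset_iff\<close>)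
qed

lemma smooth_fn_coord: "c \<in> A \<Longrightarrow> U \<subseteq> chart_dom c \<Longrightarrow> smooth_fn A U (coord c)"
proof (rule smooth_fn_subset)
  assume c: "c \<in> A"
  show "smooth_fn A (chart_dom c) (coord c)"
  proof (rule smooth_fn_one_chart[OF c open_chart_dom[OF c]])
    show "smooth_on (coord c ` chart_dom c) (coord c \<circ> param c)"
      by (rule smooth_on_cong[OF open_coord_image[OF c open_chart_dom[OF c]] _ smooth_on_ident])
        (use c in auto)
  qed simp
qed

lemma smooth_fn_chart:
  "smooth_fn A U f \<Longrightarrow> c \<in> A \<Longrightarrow> smooth_on (coord c ` (chart_dom c \<inter> U)) (f \<circ> param c)"
  by (simp add: smooth_fn_def)

lemma smooth_fn_has_derivative:
  assumes "smooth_fn A U f" "c \<in> A" "q \<in> U" "q \<in> chart_dom c"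
  shows "((f \<circ> param c) has_derivative frechet_derivative (f \<circ> param c) (at (coord c q))) (at (coord c q))"
  using smooth_on_has_derivative[OF smooth_fn_chart[OF assms(1,2)]] assms by blast

lemma dirderiv_has_derivative:
  assumes "smooth_fn A U f" "q \<in> U"
  shows "((f \<circ> param (chart_at A q)) has_derivative (\<lambda>v. dirderiv A q v f)) (at (coord (chart_at A q) q))"
  using smooth_fn_has_derivative[OF assms(1) chart_at(1) assms(2) chart_at(2)]
  by (simp add: dirderiv_def)

lemma dirderiv_eqI:
  assumes "((f \<circ> param (chart_at A q)) has_derivative D) (at (coord (chart_at A q) q))"
  shows "dirderiv A q v f = D v"
  using frechet_derivative_at[OF assms] by (simp add: dirderiv_def)

lemma dirderiv_linear: "smooth_fn A U f \<Longrightarrow> q \<in> U \<Longrightarrow> linear (\<lambda>v. dirderiv A q v f)"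
  using dirderiv_has_derivative has_derivative_linear by blast

lemma dirderiv_cong:
  assumes "open U" "q \<in> U" "\<And>r. r \<in> U \<Longrightarrow> f r = g r"
  shows "dirderiv A q v f = dirderiv A q v g"
proof -
  let ?c = "chart_at A q"
  have "frechet_derivative (f \<circ> param ?c) (at (coord ?c q)) = frechet_derivative (g \<circ> param ?c) (at (coord ?c q))"
    by (rule frechet_derivative_cong_open[OF open_coord_dom[OF chart_at(1) assms(1)]])
      (use assms chart_at in auto)
  then show ?thesis
    by (simp add: dirderiv_def)
qed

lemma dirderiv_const: "dirderiv A q v (\<lambda>q. k) = 0"
  by (rule dirderiv_eqI) (simp add: o_def)

lemma dirderiv_add:
  assumes "smooth_fn A U f" "smooth_fn A U g" "q \<in> U"
  shows "dirderiv A q v (\<lambda>q. f q + g q) = dirderiv A q v f + dirderiv A q v g"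
  by (rule dirderiv_eqI)
    (use has_derivative_add[OF dirderiv_has_derivative[OF assms(1,3)] dirderiv_has_derivative[OF assms(2,3)]]
      in \<open>simp add: o_def\<close>)

lemma dirderiv_sum:
  assumes "\<And>i. i \<in> I \<Longrightarrow> smooth_fn A U (f i)" "q \<in> U"
  shows "dirderiv A q v (\<lambda>q. \<Sum>i\<in>I. f i q) = (\<Sum>i\<in>I. dirderiv A q v (f i))"
  by (rule dirderiv_eqI)
    (use has_derivative_sum[of I, OF dirderiv_has_derivative[OF assms]] in \<open>simp add: o_def\<close>)

lemma dirderiv_linear_comp:
  assumes "bounded_linear L" "smooth_fn A U f" "q \<in> U"
  shows "dirderiv A q v (\<lambda>q. L (f q)) = L (dirderiv A q v f)"
  by (rule dirderiv_eqI)
    (use bounded_linear.has_derivative[OF assms(1) dirderiv_has_derivative[OF assms(2,3)]]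
      in \<open>simp add: o_def\<close>)

lemma dirderiv_bilinear:
  assumes "bounded_bilinear B" "smooth_fn A U f" "smooth_fn A U g" "q \<in> U"
  shows "dirderiv A q v (\<lambda>q. B (f q) (g q)) = B (f q) (dirderiv A q v g) + B (dirderiv A q v f) (g q)"
  by (rule dirderiv_eqI)
    (use bounded_bilinear.FDERIV[OF assms(1) dirderiv_has_derivative[OF assms(2,4)]
        dirderiv_has_derivative[OF assms(3,4)]] chart_at in \<open>simp add: o_def\<close>)

text \<open>Chain rule through the transition map. It trades the chart chosen at q, which changes
  with q, for one fixed chart \<open>c\<close> in which nearby points can be compared.\<close>

lemma dirderiv_chart:
  assumes "open U" "smooth_fn A U f" "c \<in> A" "q \<in> U" "q \<in> chart_dom c"
  shows "dirderiv A q v f = frechet_derivative (f \<circ> param c) (at (coord c q)) (dirderiv A q v (coord c))"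
proof -
  let ?c = "chart_at A q"
  have 1: "((coord c \<circ> param ?c) has_derivative (\<lambda>v. dirderiv A q v (coord c))) (at (coord ?c q))"
    using dirderiv_has_derivative[OF smooth_fn_coord[OF assms(3) order_refl] assms(5)] .
  have "(coord c \<circ> param ?c) (coord ?c q) = coord c q"
    by (simp add: param_coord chart_at)
  then have 2: "((f \<circ> param c) has_derivative frechet_derivative (f \<circ> param c) (at (coord c q)))
      (at ((coord c \<circ> param ?c) (coord ?c q)))"
    using smooth_fn_has_derivative[OF assms(2,3,4,5)] by simp
  have 3: "((f \<circ> param c) \<circ> (coord c \<circ> param ?c) has_derivative
     (frechet_derivative (f \<circ> param c) (at (coord c q)) \<circ> (\<lambda>v. dirderiv A q v (coord c)))) (at (coord ?c q))"
    by (rule diff_chain_at[OF 1 2])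
  have "((f \<circ> param ?c) has_derivative
     (frechet_derivative (f \<circ> param c) (at (coord c q)) \<circ> (\<lambda>v. dirderiv A q v (coord c)))) (at (coord ?c q))"
  proof (rule has_derivative_transform_within_open[OF 3])
    show "open (coord ?c ` (chart_dom ?c \<inter> chart_dom c))"
      by (intro open_coord_dom chart_at open_chart_dom assms)
    show "coord ?c q \<in> coord ?c ` (chart_dom ?c \<inter> chart_dom c)"
      using chart_at assms by blast
  qed (use assms(3) chart_at in auto)
  from dirderiv_eqI[OF this] show ?thesis
    by simp
qed

lemma dirderiv_coord_chart_at: "dirderiv A q v (coord (chart_at A q)) = v"
proof (rule dirderiv_eqI)
  let ?c = "chart_at A q"
  show "((coord ?c \<circ> param ?c) has_derivative (\<lambda>v. v)) (at (coord ?c q))"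
  proof (rule has_derivative_transform_within_open[OF has_derivative_ident])
    show "open (coord ?c ` chart_dom ?c)"
      by (intro open_coord_image chart_at open_chart_dom) simp
  qed (use chart_at in auto)
qed

lemma dirderiv_coord_inject:
  assumes "c \<in> A" "q \<in> chart_dom c" "dirderiv A q v (coord c) = dirderiv A q w (coord c)"
  shows "v = w"
proof -
  let ?c = "chart_at A q"
  have "dirderiv A q u (coord ?c) =
      frechet_derivative (coord ?c \<circ> param c) (at (coord c q)) (dirderiv A q u (coord c))" for u
    by (rule dirderiv_chart[OF open_chart_dom[OF chart_at(1)] smooth_fn_coord[OF chart_at(1) order_refl]
          assms(1) chart_at(2) assms(2)])
  then show ?thesis
    using assms(3) by (metis dirderiv_coord_chart_at)
qed

lemma smooth_vf_subset: "smooth_vf A U X \<Longrightarrow> V \<subseteq> U \<Longrightarrow> smooth_vf A V X"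
  unfolding smooth_vf_def by (meson Int_mono order_refl smooth_fn_subset)

lemma smooth_vf_cong:
  assumes "open U" "\<And>q. q \<in> U \<Longrightarrow> X q = Y q" "smooth_vf A U X"
  shows "smooth_vf A U Y"
  unfolding smooth_vf_def
proof
  fix c assume c: "c \<in> A"
  show "smooth_fn A (U \<inter> chart_dom c) (\<lambda>q. dirderiv A q (Y q) (coord c))"
    by (rule smooth_fn_cong[of _ "\<lambda>q. dirderiv A q (X q) (coord c)"])
      (use c assms in \<open>auto simp: smooth_vf_def open_chart_dom\<close>)
qed

lemma smooth_vf_add:
  assumes "open U" "smooth_vf A U X" "smooth_vf A U Y"
  shows "smooth_vf A U (\<lambda>q. X q + Y q)"
  unfolding smooth_vf_def
proof
  fix c assume c: "c \<in> A"
  have o: "open (U \<inter> chart_dom c)"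
    using assms c by (auto simp: open_chart_dom)
  have "smooth_fn A (U \<inter> chart_dom c) (\<lambda>q. dirderiv A q (X q) (coord c) + dirderiv A q (Y q) (coord c))"
    using assms c by (intro smooth_fn_add[OF o]) (auto simp: smooth_vf_def)
  then show "smooth_fn A (U \<inter> chart_dom c) (\<lambda>q. dirderiv A q (X q + Y q) (coord c))"
    by (rule smooth_fn_cong[OF o, rotated])
      (simp add: linear_add[OF dirderiv_linear[OF smooth_fn_coord[OF c order_refl]]])
qed

lemma smooth_vf_scaleR:
  assumes "open U" "smooth_fn A U f" "smooth_vf A U X"
  shows "smooth_vf A U (\<lambda>q. f q *\<^sub>R X q)"
  unfolding smooth_vf_def
proof
  fix c assume c: "c \<in> A"
  have o: "open (U \<inter> chart_dom c)"
    using assms c by (auto simp: open_chart_dom)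
  have "smooth_fn A (U \<inter> chart_dom c) (\<lambda>q. f q *\<^sub>R dirderiv A q (X q) (coord c))"
    using assms c by (intro smooth_fn_scaleR[OF o]) (auto simp: smooth_vf_def intro: smooth_fn_subset)
  then show "smooth_fn A (U \<inter> chart_dom c) (\<lambda>q. dirderiv A q (f q *\<^sub>R X q) (coord c))"
    by (rule smooth_fn_cong[OF o, rotated])
      (simp add: linear_scale[OF dirderiv_linear[OF smooth_fn_coord[OF c order_refl]]])
qed

lemma smooth_vf_zero: "smooth_vf A U (\<lambda>q. 0)"
  unfolding smooth_vf_def
proof
  fix c assume c: "c \<in> A"
  have "smooth_on (coord c' ` (chart_dom c' \<inter> (U \<inter> chart_dom c))) ((\<lambda>q. dirderiv A q 0 (coord c)) \<circ> param c')"
    if c': "c' \<in> A" for c'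
    \<comment> \<open>\<open>U\<close> need not be open here, so smoothness is shown over the open
      set \<open>chart_dom c\<close> and then restricted.\<close>
    by (rule smooth_on_subset[OF smooth_on_cong[OF open_coord_dom[OF c' open_chart_dom[OF c]] _ smooth_on_const]])
      (use c c' in \<open>auto simp: param_coord linear_0[OF dirderiv_linear[OF smooth_fn_coord[OF c order_refl]]]\<close>)
  then show "smooth_fn A (U \<inter> chart_dom c) (\<lambda>q. dirderiv A q 0 (coord c))"
    by (simp add: smooth_fn_def)
qed

lemma smooth_vf_sum:
  assumes "open U" "finite I" "\<And>i. i \<in> I \<Longrightarrow> smooth_vf A U (X i)"
  shows "smooth_vf A U (\<lambda>q. \<Sum>i\<in>I. X i q)"
  using assms(2,3) by (induction I) (auto simp: smooth_vf_zero smooth_vf_add assms(1))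

lemma smooth_vf_chart:
  assumes "smooth_vf A U X" "c \<in> A"
  shows "smooth_on (coord c ` (chart_dom c \<inter> U)) ((\<lambda>q. dirderiv A q (X q) (coord c)) \<circ> param c)"
proof -
  have "smooth_fn A (U \<inter> chart_dom c) (\<lambda>q. dirderiv A q (X q) (coord c))"
    using assms by (simp add: smooth_vf_def)
  from smooth_fn_chart[OF this assms(2)] show ?thesis
    by (simp add: Int_ac)
qed

lemma dirderiv_param:
  assumes "open U" "smooth_fn A U f" "c \<in> A" "x \<in> coord c ` (chart_dom c \<inter> U)"
  shows "((\<lambda>q. dirderiv A q (X q) f) \<circ> param c) x =
    frechet_derivative (f \<circ> param c) (at x) (((\<lambda>q. dirderiv A q (X q) (coord c)) \<circ> param c) x)"
  using assms(4) dirderiv_chart[OF assms(1,2,3)] by (auto simp: param_coord[OF assms(3)])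

lemma smooth_fn_dirderiv:
  assumes "open U" "smooth_fn A U f" "smooth_vf A U X"
  shows "smooth_fn A U (\<lambda>q. dirderiv A q (X q) f)"
  unfolding smooth_fn_def
proof
  fix c assume c: "c \<in> A"
  note W = open_coord_dom[OF c assms(1)]
  show "smooth_on (coord c ` (chart_dom c \<inter> U)) ((\<lambda>q. dirderiv A q (X q) f) \<circ> param c)"
    by (rule smooth_on_cong[OF W _ smooth_on_frechet_derivative_along[OF W smooth_fn_chart[OF assms(2) c]
          smooth_vf_chart[OF assms(3) c]]])
      (rule dirderiv_param[OF assms(1,2) c, symmetric])
qed

text \<open>In the chart at q each iterated derivative splits by
  \<open>frechet_derivative_along\<close>: the first-order parts differ by the coordinate formula
  defining the bracket, and the second derivatives of \<open>f\<close> cancel.\<close>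

lemma dirderiv_lie_bracket:
  fixes f :: "'m \<Rightarrow> 'b::euclidean_space"
  assumes "open U" "smooth_fn A U f" "smooth_vf A U X" "smooth_vf A U Y" "q \<in> U"
  shows "dirderiv A q (lie_bracket A X Y q) f =
    dirderiv A q (X q) (\<lambda>q. dirderiv A q (Y q) f) - dirderiv A q (Y q) (\<lambda>q. dirderiv A q (X q) f)"
proof -
  let ?c = "chart_at A q" let ?x = "coord ?c q"
  let ?W = "coord ?c ` (chart_dom ?c \<inter> U)"
  let ?comp = "\<lambda>X. (\<lambda>q. dirderiv A q (X q) (coord ?c)) \<circ> param ?c"
  let ?F = "f \<circ> param ?c"
  note c = chart_at(1)[of q]
  have W: "open ?W" "?x \<in> ?W"
    using open_coord_dom[OF c assms(1)] assms(5) chart_at by auto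
  have at: "?comp X ?x = X q" for X
    by (simp add: param_coord chart_at dirderiv_coord_chart_at)
  have F: "smooth_on ?W ?F"
    by (rule smooth_fn_chart[OF assms(2) c])
  have 1: "dirderiv A q v (\<lambda>q. dirderiv A q (Z q) f) =
      frechet_derivative ?F (at ?x) (frechet_derivative (?comp Z) (at ?x) v)
      + frechet_derivative (\<lambda>y. frechet_derivative ?F (at y) (Z q)) (at ?x) v"
    if "smooth_vf A U Z" for Z v
  proof -
    have "frechet_derivative ((\<lambda>q. dirderiv A q (Z q) f) \<circ> param ?c) (at ?x) =
        frechet_derivative (\<lambda>x. frechet_derivative ?F (at x) (?comp Z x)) (at ?x)"
      by (rule frechet_derivative_cong_open[OF W]) (rule dirderiv_param[OF assms(1,2) c])
    then show ?thesis
      unfolding dirderiv_def[of A q v "\<lambda>q. dirderiv A q (Z q) f"]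
      by (simp only: frechet_derivative_along[OF W F smooth_vf_chart[OF that c]] at)
  qed
  have D: "lie_bracket A X Y q =
      frechet_derivative (?comp Y) (at ?x) (X q) - frechet_derivative (?comp X) (at ?x) (Y q)"
    by (simp add: lie_bracket_def dirderiv_def)
  have "linear (frechet_derivative ?F (at ?x))"
    by (rule linear_frechet_derivative[OF smooth_on_differentiable[OF F W(2)]])
  then have "dirderiv A q (lie_bracket A X Y q) f =
      frechet_derivative ?F (at ?x) (frechet_derivative (?comp Y) (at ?x) (X q))
      - frechet_derivative ?F (at ?x) (frechet_derivative (?comp X) (at ?x) (Y q))"
    unfolding D by (simp add: dirderiv_def linear_diff)
  then show ?thesis
    unfolding 1[OF assms(3)] 1[OF assms(4)]
    by (simp add: frechet_derivative_commute[OF W F, of "X q" "Y q"])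
qed

section \<open>Coordinate fields: partial derivatives in the chart chosen at p\<close>

lemma dirderiv_coord_field:
  assumes "open U" "smooth_fn A U f" "q \<in> U" "q \<in> chart_dom (chart_at A p)"
  shows "dirderiv A q (coord_field A p v q) f
    = frechet_derivative (f \<circ> param (chart_at A p)) (at (coord (chart_at A p) q)) v"
proof -
  let ?p = "chart_at A p" and ?q = "chart_at A q"
  note P = chart_at(1)[of p] and Q = chart_at(1)[of q]
  have x: "coord ?p q \<in> coord ?p ` (chart_dom ?p \<inter> chart_dom ?q)"
    using assms chart_at by blast
  have "((coord ?q \<circ> param ?p) has_derivative frechet_derivative (coord ?q \<circ> param ?p) (at (coord ?p q))) (at (coord ?p q))"
    by (rule smooth_on_has_derivative[OF smooth_transition[OF P Q] x])
  moreover have "((f \<circ> param ?q) has_derivative (\<lambda>v. dirderiv A q v f)) (at ((coord ?q \<circ> param ?p) (coord ?p q)))"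
    using dirderiv_has_derivative[OF assms(2,3)] assms(4) by (simp add: param_coord P)
  ultimately have "((f \<circ> param ?q) \<circ> (coord ?q \<circ> param ?p) has_derivative
      (\<lambda>v. dirderiv A q v f) \<circ> frechet_derivative (coord ?q \<circ> param ?p) (at (coord ?p q))) (at (coord ?p q))"
    by (rule diff_chain_at)
  then have "(f \<circ> param ?p has_derivative
      (\<lambda>v. dirderiv A q v f) \<circ> frechet_derivative (coord ?q \<circ> param ?p) (at (coord ?p q))) (at (coord ?p q))"
    by (rule has_derivative_transform_within_open[OF _ open_coord_dom[OF P open_chart_dom[OF Q]] x])
      (use P Q in auto)
  from frechet_derivative_at[OF this] show ?thesis
    by (metis coord_field_def o_apply)
qed

lemma dirderiv_coord_field_coord:
  assumes "q \<in> chart_dom (chart_at A p)"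
  shows "dirderiv A q (coord_field A p v q) (coord (chart_at A p)) = v"
proof -
  let ?p = "chart_at A p"
  note P = chart_at(1)[of p]
  have "((coord ?p \<circ> param ?p) has_derivative (\<lambda>v. v)) (at (coord ?p q))"
    by (rule has_derivative_transform_within_open[OF has_derivative_ident
          open_coord_image[OF P open_chart_dom[OF P] order_refl]])
      (use P assms in auto)
  from frechet_derivative_at[OF this]
    dirderiv_coord_field[OF open_chart_dom[OF P] smooth_fn_coord[OF P order_refl] assms assms]
  show ?thesis by metis
qed

lemma coord_field_at: "coord_field A p v p = v"
  using dirderiv_coord_field_coord[OF chart_at(2), of p v] by (simp add: dirderiv_coord_chart_at)

lemma smooth_vf_coord_field: "smooth_vf A (chart_dom (chart_at A p)) (coord_field A p v)"
  unfolding smooth_vf_def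
proof
  fix c assume c: "c \<in> A"
  let ?p = "chart_at A p"
  note P = chart_at(1)[of p]
  let ?U = "chart_dom ?p \<inter> chart_dom c"
  have U: "open ?U"
    by (intro open_Int open_chart_dom c P)
  show "smooth_fn A ?U (\<lambda>q. dirderiv A q (coord_field A p v q) (coord c))"
  proof (rule smooth_fn_one_chart[OF P U])
    show "smooth_on (coord ?p ` ?U) ((\<lambda>q. dirderiv A q (coord_field A p v q) (coord c)) \<circ> param ?p)"
    proof (rule smooth_on_cong[OF open_coord_image[OF P U] _
          smooth_on_frechet_derivative[OF smooth_transition[OF P c]]])
      fix x assume "x \<in> coord ?p ` ?U"
      then obtain q where q: "q \<in> ?U" "x = coord ?p q" by blast
      then show "frechet_derivative (coord c \<circ> param ?p) (at x) v =
          ((\<lambda>q. dirderiv A q (coord_field A p v q) (coord c)) \<circ> param ?p) x"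
        using dirderiv_coord_field[OF open_chart_dom[OF c] smooth_fn_coord[OF c order_refl], of q p v]
        by (simp add: param_coord P)
    qed auto
  qed auto
qed

text \<open>The components in the chart at p are constant, so the bracket has zero components there,
  and a tangent vector is determined by its components.\<close>

lemma lie_bracket_coord_field:
  assumes "q \<in> chart_dom (chart_at A p)"
  shows "lie_bracket A (coord_field A p u) (coord_field A p v) q = 0"
proof -
  let ?p = "chart_at A p"
  note P = chart_at(1)[of p]
  note U = open_chart_dom[OF P] and f = smooth_fn_coord[OF P order_refl]
  have "dirderiv A q w (\<lambda>q. dirderiv A q (coord_field A p v q) (coord ?p)) = 0" for v w
    using dirderiv_cong[OF U assms, of "\<lambda>q. dirderiv A q (coord_field A p v q) (coord ?p)" "\<lambda>q. v" w]
    by (simp add: dirderiv_coord_field_coord dirderiv_const)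
  then have "dirderiv A q (lie_bracket A (coord_field A p u) (coord_field A p v) q) (coord ?p) = 0"
    by (simp add: dirderiv_lie_bracket[OF U f smooth_vf_coord_field smooth_vf_coord_field assms])
  moreover have "dirderiv A q 0 (coord ?p) = 0"
    by (rule linear_0[OF dirderiv_linear[OF f assms]])
  ultimately show ?thesis
    using dirderiv_coord_inject[OF P assms] by metis
qed

lemma dirderiv_zero_locally_constant:
  fixes f :: "'m \<Rightarrow> 'b::euclidean_space"
  assumes "open U" "smooth_fn A U f" "p \<in> U" "\<And>q v. q \<in> U \<Longrightarrow> dirderiv A q v f = 0"
  obtains W where "open W" "p \<in> W" "W \<subseteq> U" "\<And>q. q \<in> W \<Longrightarrow> f q = f p"
proof -
  let ?c = "chart_at A p"
  note c = chart_at(1)[of p]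
  have "open (coord ?c ` (chart_dom ?c \<inter> U))" "coord ?c p \<in> coord ?c ` (chart_dom ?c \<inter> U)"
    using open_coord_dom[OF c assms(1)] assms(3) chart_at by auto
  then obtain e where e: "e > 0" "ball (coord ?c p) e \<subseteq> coord ?c ` (chart_dom ?c \<inter> U)"
    by (meson open_contains_ball)
  let ?B = "ball (coord ?c p) e"
  have "((f \<circ> param ?c) has_derivative (\<lambda>h. 0)) (at x within ?B)" if "x \<in> ?B" for x
  proof -
    obtain q where q: "q \<in> chart_dom ?c" "q \<in> U" "x = coord ?c q"
      using \<open>x \<in> ?B\<close> e(2) by blast
    \<comment> \<open>The coordinate field in direction v realises v at every point of the ball,
      which turns the hypothesis into a statement about one fixed chart.\<close>
    have "frechet_derivative (f \<circ> param ?c) (at x) v = 0" for v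
      using dirderiv_coord_field[OF assms(1,2) q(2,1), of v] assms(4)[OF q(2)] q(3) by simp
    then have "frechet_derivative (f \<circ> param ?c) (at x) = (\<lambda>h. 0)" by blast
    then show ?thesis
      using smooth_fn_has_derivative[OF assms(2) c q(2,1)] q(3) has_derivative_at_withinI by metis
  qed
  from has_derivative_zero_constant[OF convex_ball this]
  obtain k where k: "\<And>x. x \<in> ?B \<Longrightarrow> (f \<circ> param ?c) x = k"
    by blast
  show ?thesis
  proof
    let ?W = "(chart_dom ?c \<inter> coord ?c -` ?B) \<inter> U"
    show "open ?W"
      by (intro open_Int continuous_open_preimage continuous_on_coord[OF c] open_chart_dom[OF c] open_ball assms(1))
    show "p \<in> ?W"
      using e(1) assms(3) chart_at by auto
    show "?W \<subseteq> U" by blast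
    have "f q = k" if "q \<in> ?W" for q
      using k[of "coord ?c q"] that param_coord[OF c] by auto
    then show "f q = f p" if "q \<in> ?W" for q
      using that \<open>p \<in> ?W\<close> by metis
  qed
qed

end

section \<open>Metric, connection and orthonormal frames\<close>

unbundle cross3_syntax

lemma vec3_expand: "x = x$1 *\<^sub>R axis 1 1 + x$2 *\<^sub>R axis 2 1 + x$3 *\<^sub>R axis 3 1" for x :: "real^3"
  by (simp add: vec_eq_iff forall_3 axis_def)

lemma linear_axis_expand:
  fixes x :: "real^3"
  assumes "linear f" shows "f x = x$1 *\<^sub>R f (axis 1 1) + x$2 *\<^sub>R f (axis 2 1) + x$3 *\<^sub>R f (axis 3 1)"
  by (subst vec3_expand[of x]) (simp add: linear_add[OF assms] linear_scale[OF assms])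

lemma bounded_bilinear_cross3: "bounded_bilinear cross3"
  using bilinear_cross by (rule bilinear_conv_bounded_bilinear[THEN iffD1])

lemma inner_cross_cyclic: "u \<bullet> (v \<times> w) = w \<bullet> (u \<times> v)" for u v w :: "real^3"
  by (simp add: cross3_simps)

lemma rotation_matrix_inner:
  fixes R :: "real^3^3"
  assumes "rotation_matrix R" shows "(R *v y) \<bullet> (R *v z) = y \<bullet> z"
proof -
  have "orthogonal_transformation ((*v) R)"
    using assms by (simp add: rotation_matrix_def orthogonal_transformation_matrix)
  then show ?thesis
    by (simp add: orthogonal_transformation_def)
qed

text \<open>Since c is orthogonal to a and b, it is parallel to a \<times> b; both are unit vectors,
  so they agree up to a sign, which the positive triple product fixes.\<close>

lemma orthonormal_triple_cross:
  fixes u v w :: "real^3"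
  assumes "u \<bullet> u = 1" "v \<bullet> v = 1" "w \<bullet> w = 1" "u \<bullet> v = 0" "u \<bullet> w = 0" "v \<bullet> w = 0" "u \<bullet> (v \<times> w) > 0"
  shows "u \<times> v = w" "v \<times> w = u" "w \<times> u = v"
proof -
  have *: "a \<times> b = c" if "a \<bullet> a = 1" "b \<bullet> b = 1" "c \<bullet> c = 1" "a \<bullet> b = 0" "a \<bullet> c = 0" "b \<bullet> c = 0"
    "c \<bullet> (a \<times> b) > 0" for a b c :: "real^3"
  proof -
    have 0: "c \<times> (a \<times> b) = 0"
      using that by (simp add: Lagrange inner_commute)
    have 1: "(a \<times> b) \<bullet> (a \<times> b) = 1"
      using that by (simp add: dot_cross inner_commute)
    have "(c \<bullet> (a \<times> b))\<^sup>2 = 1"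
      using norm_cross_dot[of c "a \<times> b"] that(3) 1
      by (simp add: 0 power_mult_distrib power2_norm_eq_inner)
    then have "c \<bullet> (a \<times> b) = 1"
      using that(7) power2_eq_1_iff[of "c \<bullet> (a \<times> b)"] by auto
    then have "(a \<times> b - c) \<bullet> (a \<times> b - c) = 0"
      using 1 that(3) by (simp add: inner_diff_left inner_diff_right inner_commute)
    then show ?thesis by simp
  qed
  have c: "u \<bullet> (v \<times> w) = v \<bullet> (w \<times> u)" "u \<bullet> (v \<times> w) = w \<bullet> (u \<times> v)"
    by (metis inner_cross_cyclic)+
  show "u \<times> v = w" "v \<times> w = u" "w \<times> u = v"
    using *[of u v w] *[of v w u] *[of w u v] assms c by (simp_all add: inner_commute)
qed

locale riemannian_mfd = oriented_mfd A for A :: "'m::{t2_space, second_countable_topology} atlas" +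
  fixes g :: "'m metric" and nab :: "'m connection"
  assumes metric: "riemannian_metric A g" and levi_civita: "levi_civita A g nab"
begin

lemma bilinear_g: "bilinear (g p)" and g_sym: "g p v w = g p w v" and g_pos: "v \<noteq> 0 \<Longrightarrow> g p v v > 0"
  using metric unfolding riemannian_metric_def by blast+

lemmas g_simps = bilinear_ladd[OF bilinear_g] bilinear_radd[OF bilinear_g]
  bilinear_lmul[OF bilinear_g] bilinear_rmul[OF bilinear_g]
  bilinear_lzero[OF bilinear_g] bilinear_rzero[OF bilinear_g]
  bilinear_lneg[OF bilinear_g] bilinear_rneg[OF bilinear_g]
  bilinear_lsub[OF bilinear_g] bilinear_rsub[OF bilinear_g]

lemma linear_g: "linear (\<lambda>v. g p v w)" "linear (g p w)"
  using bilinear_g[of p] by (auto simp: bilinear_def)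

lemma g_nondegenerate: "(\<And>w. g p v w = g p v' w) \<Longrightarrow> v = v'"
  using g_pos[of "v - v'" p] by (force simp: g_simps)

lemma smooth_fn_g: "open U \<Longrightarrow> smooth_vf A U X \<Longrightarrow> smooth_vf A U Y \<Longrightarrow> smooth_fn A U (\<lambda>q. g q (X q) (Y q))"
  using metric unfolding riemannian_metric_def by blast

lemma affine: "affine_connection A nab"
  using levi_civita by (simp add: levi_civita_def)

lemma affine_vf:
  assumes "open U" "smooth_vf A U X" "smooth_vf A U Y"
  shows "smooth_vf A U (\<lambda>q. nab q (X q) Y) \<and> (\<forall>p\<in>U. linear (\<lambda>v. nab p v Y)) \<and>
    (\<forall>p\<in>U. \<forall>v. nab p v (\<lambda>q. X q + Y q) = nab p v X + nab p v Y)"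
  using affine[unfolded affine_connection_def, THEN conjunct1, rule_format, of U X Y] assms by simp

lemma nab_linear: "open U \<Longrightarrow> smooth_vf A U Y \<Longrightarrow> p \<in> U \<Longrightarrow> linear (\<lambda>v. nab p v Y)"
  using affine_vf[of U Y Y] by simp

lemma smooth_vf_nab: "open U \<Longrightarrow> smooth_vf A U X \<Longrightarrow> smooth_vf A U Y \<Longrightarrow> smooth_vf A U (\<lambda>q. nab q (X q) Y)"
  using affine_vf by simp

lemma nab_add:
  "open U \<Longrightarrow> smooth_vf A U X \<Longrightarrow> smooth_vf A U Y \<Longrightarrow> p \<in> U \<Longrightarrow>
    nab p v (\<lambda>q. X q + Y q) = nab p v X + nab p v Y"
  using affine_vf[of U X Y] by simp

lemma nab_scaleR:
  "open U \<Longrightarrow> smooth_fn A U f \<Longrightarrow> smooth_vf A U Y \<Longrightarrow> p \<in> U \<Longrightarrow>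
    nab p v (\<lambda>q. f q *\<^sub>R Y q) = dirderiv A p v f *\<^sub>R Y p + f p *\<^sub>R nab p v Y"
  using affine[unfolded affine_connection_def, THEN conjunct2, rule_format, of U f Y] by simp

text \<open>A field vanishing on \<open>U\<close> is its own multiple by the indicator of the complement of \<open>U\<close>,
  which is smooth on \<open>U\<close>; the Leibniz rule then yields locality without bump functions.\<close>

lemma nab_zero_on:
  assumes "open U" "p \<in> U" "\<And>q. q \<in> U \<Longrightarrow> X q = 0"
  shows "nab p v X = 0"
proof -
  let ?f = "\<lambda>q. if q \<in> U then 0 else 1 :: real"
  have f: "smooth_fn A U ?f"
    by (rule smooth_fn_cong[OF assms(1) _ smooth_fn_const[of U 0]]) simp
  have X: "smooth_vf A U X"
    by (rule smooth_vf_cong[OF assms(1) _ smooth_vf_zero]) (simp add: assms)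
  have "nab p v X = nab p v (\<lambda>q. ?f q *\<^sub>R X q)"
    by (rule arg_cong[of _ _ "nab p v"]) (auto simp: assms)
  also have "\<dots> = 0"
    using nab_scaleR[OF assms(1) f X assms(2)] assms by simp
  finally show ?thesis .
qed

lemma nab_diff:
  assumes "open U" "smooth_vf A U X" "smooth_vf A U Y" "p \<in> U"
  shows "nab p v (\<lambda>q. X q - Y q) = nab p v X - nab p v Y"
proof -
  have D: "smooth_vf A U (\<lambda>q. X q - Y q)"
    using smooth_vf_add[OF assms(1,2) smooth_vf_scaleR[OF assms(1) smooth_fn_const[of U "-1::real"] assms(3)]]
    by simp
  have "nab p v (\<lambda>q. (X q - Y q) + Y q) = nab p v (\<lambda>q. X q - Y q) + nab p v Y"
    by (rule nab_add[OF assms(1) D assms(3,4)])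
  then show ?thesis by simp
qed

lemma nab_cong:
  assumes "open U" "smooth_vf A U X" "p \<in> U" "\<And>q. q \<in> U \<Longrightarrow> X q = Y q"
  shows "nab p v X = nab p v Y"
proof -
  have Y: "smooth_vf A U Y"
    by (rule smooth_vf_cong[OF assms(1,4,2)])
  have "nab p v (\<lambda>q. X q - Y q) = 0"
    by (rule nab_zero_on[OF assms(1,3)]) (simp add: assms)
  then show ?thesis
    using nab_diff[OF assms(1,2) Y assms(3)] by simp
qed

lemma torsion_free:
  assumes "open U" "smooth_vf A U X" "smooth_vf A U Y" "p \<in> U"
  shows "lie_bracket A X Y p = nab p (X p) Y - nab p (Y p) X"
  using levi_civita assms unfolding levi_civita_def by (metis (lifting))

lemma metric_compat:
  assumes "open U" "smooth_vf A U X" "smooth_vf A U Y" "p \<in> U"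
  shows "dirderiv A p v (\<lambda>q. g q (X q) (Y q)) = g p (nab p v X) (Y p) + g p (X p) (nab p v Y)"
  using levi_civita assms unfolding levi_civita_def by blast

text \<open>Coordinate fields commute, so the bracket term of the curvature disappears.\<close>

lemma riem_eq:
  "riem A nab p u v w = nab p u (\<lambda>q. nab q (coord_field A p v q) (coord_field A p w))
    - nab p v (\<lambda>q. nab q (coord_field A p u q) (coord_field A p w))"
proof -
  have "nab p 0 (coord_field A p w) = 0"
    by (rule linear_0[OF nab_linear[OF open_chart_dom[OF chart_at(1)] smooth_vf_coord_field chart_at(2)]])
  then show ?thesis
    by (simp add: riem_def curvature_def coord_field_at lie_bracket_coord_field chart_at)
qed

text \<open>For commuting fields torsion-freeness makes the covariant derivative of one along
  another symmetric near p, and the six second derivatives cancel in pairs.\<close>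

lemma bianchi: "riem A nab p u v w + riem A nab p v w u + riem A nab p w u v = 0"
proof -
  let ?C = "coord_field A p" and ?U = "chart_dom (chart_at A p)"
  have U: "open ?U" "p \<in> ?U"
    by (auto simp: chart_at open_chart_dom)
  have N: "smooth_vf A ?U (\<lambda>q. nab q (?C v q) (?C w))" for v w
    by (rule smooth_vf_nab[OF U(1) smooth_vf_coord_field smooth_vf_coord_field])
  have eq: "nab p u (\<lambda>q. nab q (?C v q) (?C w)) = nab p u (\<lambda>q. nab q (?C w q) (?C v))" for u v w
  proof (rule nab_cong[OF U(1) N U(2)])
    fix q assume "q \<in> ?U"
    then show "nab q (?C v q) (?C w) = nab q (?C w q) (?C v)"
      using torsion_free[OF U(1) smooth_vf_coord_field smooth_vf_coord_field, of q v w]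
      by (simp add: lie_bracket_coord_field)
  qed
  show ?thesis
    unfolding riem_eq using eq[of u v w] eq[of v w u] eq[of w u v] by simp
qed

end

section \<open>Coefficient vectors in an orthonormal frame\<close>

locale orthonormal_frame = riemannian_mfd A g nab
  for A :: "'m::{t2_space, second_countable_topology} atlas" and g :: "'m metric" and nab :: "'m connection" +
  fixes U :: "'m set" and E :: "3 \<Rightarrow> 'm vfield"
  assumes open_U: "open U" and smooth_E: "smooth_vf A U (E a)"
    and orthonormal: "q \<in> U \<Longrightarrow> g q (E a q) (E b q) = (if a = b then 1 else 0)"
    and positive: "q \<in> U \<Longrightarrow> positive_basis (E 1 q) (E 2 q) (E 3 q)"
begin

text \<open>The coefficients of a tangent vector in the frame. They are independent of the chart
  chosen at q, so the coefficient function of a smooth field is a smooth map into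
  \<open>real^3\<close> and may be differentiated.\<close>

definition hat :: "'m \<Rightarrow> real^3 \<Rightarrow> real^3" where "hat q v = (\<chi> a. g q v (E a q))"

definition unhat :: "'m \<Rightarrow> real^3 \<Rightarrow> real^3" where "unhat q x = (\<Sum>a\<in>UNIV. x$a *\<^sub>R E a q)"

lemma linear_hat: "linear (hat q)"
  by (rule linearI) (simp_all add: hat_def vec_eq_iff g_simps)

lemma linear_unhat: "linear (unhat q)"
  by (rule linearI) (simp_all add: unhat_def algebra_simps sum.distrib scaleR_sum_right)

lemmas hat_simps = linear_add[OF linear_hat] linear_diff[OF linear_hat] linear_scale[OF linear_hat]
  linear_neg[OF linear_hat] linear_0[OF linear_hat]

lemma hat_unhat: "q \<in> U \<Longrightarrow> hat q (unhat q x) = x"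
  by (simp add: hat_def unhat_def vec_eq_iff linear_sum[OF linear_g(1)] g_simps orthonormal)
    (simp add: if_distrib cong: if_cong)

lemma unhat_hat: "q \<in> U \<Longrightarrow> unhat q (hat q v) = v"
proof -
  assume q: "q \<in> U"
  have "inj (unhat q)"
    by (rule inj_on_inverseI[of _ "hat q"]) (rule hat_unhat[OF q])
  then have "surj (unhat q)"
    using linear_injective_imp_surjective[OF linear_unhat] by blast
  then obtain x where "v = unhat q x" by blast
  then show ?thesis
    by (simp add: hat_unhat q)
qed

lemma hat_inject: "q \<in> U \<Longrightarrow> hat q v = hat q w \<longleftrightarrow> v = w"
  by (metis unhat_hat)

lemma hat_E: "q \<in> U \<Longrightarrow> hat q (E a q) = axis a 1"
  by (simp add: hat_def vec_eq_iff orthonormal axis_def)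

lemma unhat_axis: "q \<in> U \<Longrightarrow> unhat q (axis a 1) = E a q"
  using unhat_hat[of q "E a q"] by (simp add: hat_E)

lemma g_hat: "q \<in> U \<Longrightarrow> g q v w = hat q v \<bullet> hat q w"
proof -
  assume q: "q \<in> U"
  have "g q v w = g q (unhat q (hat q v)) w"
    by (simp add: unhat_hat q)
  then show ?thesis
    by (simp add: unhat_def linear_sum[OF linear_g(1)] g_simps inner_vec_def hat_def g_sym[of q w])
qed

text \<open>Cyclicity of the trace replaces the chart basis, in which \<open>matrix\<close> is
  written, by the frame.\<close>

lemma trace_frame:
  assumes "q \<in> U" "linear F"
  shows "trace (matrix F) = (\<Sum>a\<in>UNIV. hat q (F (E a q)) $ a)"
proof -
  have "matrix F = matrix (unhat q \<circ> (hat q \<circ> F))"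
    by (simp add: o_def unhat_hat assms(1))
  also have "\<dots> = matrix (unhat q) ** matrix (hat q \<circ> F)"
    by (rule matrix_compose[OF linear_compose[OF assms(2) linear_hat] linear_unhat])
  finally have "trace (matrix F) = trace (matrix (hat q \<circ> F) ** matrix (unhat q))"
    by (rule trans[OF arg_cong[of _ _ trace] trace_mul_sym])
  also have "\<dots> = trace (matrix ((hat q \<circ> F) \<circ> unhat q))"
    by (simp only: matrix_compose[OF linear_unhat linear_compose[OF assms(2) linear_hat]])
  finally show ?thesis
    by (simp add: trace_def matrix_def unhat_axis assms(1))
qed

text \<open>Chart determinant = determinant of the coefficients times that of the frame, and the
  latter is positive.\<close>

lemma positive_basis_hat:
  assumes "q \<in> U"
  shows "positive_basis u v w \<longleftrightarrow> hat q u \<bullet> (hat q v \<times> hat q w) > 0"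
proof -
  have e: "unhat q (hat q x) = x" for x
    by (rule unhat_hat[OF assms])
  have "(vector [u, v, w] :: real^3^3)
      = vector [hat q u, hat q v, hat q w] ** vector [E 1 q, E 2 q, E 3 q]"
    using e[of u] e[of v] e[of w] unfolding unhat_def
    by (simp add: vec_eq_iff forall_3 matrix_matrix_mult_def sum_3)
  then have "det (vector [u, v, w] :: real^3^3)
      = (hat q u \<bullet> (hat q v \<times> hat q w)) * det (vector [E 1 q, E 2 q, E 3 q] :: real^3^3)"
    by (simp add: det_mul dot_cross_det)
  then show ?thesis
    using positive[OF assms] by (simp add: positive_basis_def zero_less_mult_iff)
qed

lemma smooth_fn_hat:
  assumes "open V" "V \<subseteq> U" "smooth_vf A V X"
  shows "smooth_fn A V (\<lambda>q. hat q (X q))"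
proof -
  have "smooth_fn A V (\<lambda>q. \<Sum>a\<in>UNIV. g q (X q) (E a q) *\<^sub>R (axis a 1 :: real^3))"
    by (intro smooth_fn_sum smooth_fn_scaleR smooth_fn_const smooth_fn_g assms
        smooth_vf_subset[OF smooth_E]) auto
  moreover have "(\<Sum>a\<in>UNIV. g q (X q) (E a q) *\<^sub>R (axis a 1 :: real^3)) = hat q (X q)" for q
    by (simp add: hat_def vec_eq_iff forall_3 sum_3 axis_def)
  ultimately show ?thesis by simp
qed

text \<open>Metric compatibility for g(Y, E_c): the derivative of the c-th coefficient is
  g(\<nabla>Y, E_c) + g(Y, \<nabla>E_c), and the last term is minus the c-th entry of twice a
  \<times> Y.\<close>

lemma nab_hat:
  assumes V: "open V" "V \<subseteq> U" "q \<in> V" and Y: "smooth_vf A V Y"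
    and a: "\<And>c. hat q (nab q v (E c)) = 2 *\<^sub>R (a \<times> axis c 1)"
  shows "hat q (nab q v Y) = dirderiv A q v (\<lambda>q. hat q (Y q)) + 2 *\<^sub>R (a \<times> hat q (Y q))"
proof -
  have q: "q \<in> U" using V by blast
  have "hat q (nab q v Y) $ c = (dirderiv A q v (\<lambda>q. hat q (Y q)) + 2 *\<^sub>R (a \<times> hat q (Y q))) $ c" for c
  proof -
    have E: "smooth_vf A V (E c)"
      by (rule smooth_vf_subset[OF smooth_E V(2)])
    have "dirderiv A q v (\<lambda>q. g q (Y q) (E c q)) = g q (nab q v Y) (E c q) + g q (Y q) (nab q v (E c))"
      by (rule metric_compat[OF V(1) Y E V(3)])
    moreover have "dirderiv A q v (\<lambda>q. g q (Y q) (E c q)) = dirderiv A q v (\<lambda>q. hat q (Y q)) $ c"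
      using dirderiv_linear_comp[OF bounded_linear_vec_nth smooth_fn_hat[OF V(1,2) Y] V(3), of v c]
      by (simp add: hat_def)
    moreover have "g q (Y q) (nab q v (E c)) = - (2 *\<^sub>R (a \<times> hat q (Y q))) $ c"
      unfolding g_hat[OF q] a using exhaust_3[of c] by (auto simp: cross3_simps axis_def)
    ultimately show ?thesis
      by (simp add: hat_def)
  qed
  then show ?thesis by (simp add: vec_eq_iff)
qed

text \<open>Half the axial vector of the skew matrix of the connection. The factor 1/2 is the one
  for which the spinorial connection is the derivative plus Clifford multiplication by
  \<open>conn\<close>.\<close>

definition conn :: "'m \<Rightarrow> real^3 \<Rightarrow> real^3" where
  "conn q v = (1/2) *\<^sub>R vector [g q (nab q v (E 2)) (E 3 q), g q (nab q v (E 3)) (E 1 q), g q (nab q v (E 1)) (E 2 q)]"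

lemma conn_skew:
  assumes "q \<in> U" shows "g q (nab q v (E b)) (E a q) = - g q (nab q v (E a)) (E b q)"
proof -
  have "dirderiv A q v (\<lambda>q. g q (E a q) (E b q)) = 0"
    using dirderiv_cong[OF open_U assms, of "\<lambda>q. g q (E a q) (E b q)" "\<lambda>q. if a = b then 1 else 0" v]
    by (simp add: orthonormal dirderiv_const)
  then show ?thesis
    using metric_compat[OF open_U smooth_E smooth_E assms, of v a b] by (simp add: g_sym)
qed

lemma hat_nab_E:
  assumes "q \<in> U" shows "hat q (nab q v (E c)) = 2 *\<^sub>R (conn q v \<times> axis c 1)"
  using exhaust_3[of c] conn_skew[OF assms, of v 1 1] conn_skew[OF assms, of v 2 2] conn_skew[OF assms, of v 3 3]
    conn_skew[OF assms, of v 1 2] conn_skew[OF assms, of v 2 3] conn_skew[OF assms, of v 3 1]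
  by (auto simp: hat_def conn_def vec_eq_iff forall_3 cross3_simps axis_def)

lemma linear_conn:
  assumes "q \<in> U" shows "linear (conn q)"
proof -
  have "linear (\<lambda>u. nab q u (E a))" for a
    by (rule nab_linear[OF open_U smooth_E assms])
  note l = linear_add[OF this] linear_scale[OF this]
  show ?thesis
    by (intro linearI) (simp_all add: l conn_def vec_eq_iff forall_3 g_simps algebra_simps)
qed

context
  fixes U' E' q
  assumes E': "orthonormal_frame A g nab U' E'" and q: "q \<in> U" "q \<in> U'"
begin

interpretation F': orthonormal_frame A g nab U' E' by (rule E')

text \<open>The coefficient change between two frames at the single point \<open>q\<close>. Both are
  orthonormal and positive, so it is a rotation and respects inner and cross products.\<close>

definition change :: "real^3 \<Rightarrow> real^3" where "change x = F'.hat q (unhat q x)"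

lemma change_hat: "change (hat q v) = F'.hat q v"
  by (simp add: change_def unhat_hat q)

lemma linear_change: "linear change"
  unfolding change_def[abs_def] using linear_compose[OF linear_unhat F'.linear_hat] by (simp add: o_def)

lemma change_inner: "change x \<bullet> change y = x \<bullet> y"
  using g_hat[OF q(1), of "unhat q x" "unhat q y"] F'.g_hat[OF q(2), of "unhat q x" "unhat q y"]
  by (simp add: change_def hat_unhat q)

lemma change_cross: "change (x \<times> y) = change x \<times> change y"
proof -
  let ?f = "\<lambda>c. change (axis c 1)"
  have "?f c = F'.hat q (E c q)" for c
    using change_hat[of "E c q"] by (simp add: hat_E q)
  then have pos: "?f 1 \<bullet> (?f 2 \<times> ?f 3) > 0"
    using F'.positive_basis_hat[OF q(2)] positive[OF q(1)] by simp
  have on: "?f a \<bullet> ?f b = (if a = b then 1 else 0)" for a b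
    by (simp add: change_inner inner_axis_axis)
  have c: "?f 1 \<times> ?f 2 = ?f 3" "?f 2 \<times> ?f 3 = ?f 1" "?f 3 \<times> ?f 1 = ?f 2"
    using orthonormal_triple_cross[OF _ _ _ _ _ _ pos] by (simp_all add: on)
  have c': "?f 2 \<times> ?f 1 = - ?f 3" "?f 3 \<times> ?f 2 = - ?f 1" "?f 1 \<times> ?f 3 = - ?f 2"
    by (metis c cross_skew)+
  show ?thesis
    by (subst (1 2 3) linear_axis_expand[OF linear_change])
      (simp add: cross_add_left cross_add_right cross_mult_left cross_mult_right c c' cross_components
        algebra_simps)
qed

end

lemma orthonormal_frame_unhat:
  assumes W: "open W" "W \<subseteq> U" and smooth: "\<And>d. smooth_fn A W (\<rho> d)"
    and on: "\<And>q d e. q \<in> W \<Longrightarrow> \<rho> d q \<bullet> \<rho> e q = (if d = e then 1 else 0)"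
    and pos: "\<And>q. q \<in> W \<Longrightarrow> \<rho> 1 q \<bullet> (\<rho> 2 q \<times> \<rho> 3 q) > 0"
  shows "orthonormal_frame A g nab W (\<lambda>d q. unhat q (\<rho> d q))"
proof unfold_locales
  show "smooth_vf A W (\<lambda>q. unhat q (\<rho> d q))" for d
    unfolding unhat_def
    by (intro smooth_vf_sum smooth_vf_scaleR W smooth_vf_subset[OF smooth_E]
        smooth_fn_linear[OF _ bounded_linear_vec_nth] smooth) auto
  fix q assume "q \<in> W"
  then show "positive_basis (unhat q (\<rho> 1 q)) (unhat q (\<rho> 2 q)) (unhat q (\<rho> 3 q))"
    using W(2) pos by (auto simp: positive_basis_hat hat_unhat subset_iff)
  fix d e
  show "g q (unhat q (\<rho> d q)) (unhat q (\<rho> e q)) = (if d = e then 1 else 0)"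
    using \<open>q \<in> W\<close> W(2) on by (auto simp: g_hat hat_unhat subset_iff)
qed (rule W)

end

section \<open>Clifford multiplication and quaternions\<close>

definition cl :: "real^3 \<Rightarrow> complex^2 \<Rightarrow> complex^2" where
  "cl a x = (\<Sum>c\<in>UNIV. a$c *\<^sub>R (cgamma c *v x))"

lemma cgamma_mult: "cgamma 1 *v x = vector [- \<i> * x$2, - \<i> * x$1]" "cgamma 2 *v x = vector [- x$2, x$1]"
  "cgamma 3 *v x = vector [- \<i> * x$1, \<i> * x$2]"
  by (simp_all add: cgamma_def vec_eq_iff forall_2 matrix_vector_mult_def sum_2)

lemma cl_components:
  "cl a x $ 1 = - \<i> * complex_of_real (a$1) * x$2 - complex_of_real (a$2) * x$2 - \<i> * complex_of_real (a$3) * x$1"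
  "cl a x $ 2 = - \<i> * complex_of_real (a$1) * x$1 + complex_of_real (a$2) * x$1 + \<i> * complex_of_real (a$3) * x$2"
  by (simp_all add: cl_def sum_3 cgamma_mult) (simp_all add: scaleR_conv_of_real algebra_simps)

text \<open>The normalization of the volume element gives \<gamma>_1 \<gamma>_2 = \<gamma>_3 and its
  cyclic analogues, so vectors multiply like imaginary quaternions. This is why a product of two
  vectors reduces to a vector and a scalar.\<close>

lemma cl_cl: "cl a (cl b x) = cl (a \<times> b) x - (a \<bullet> b) *\<^sub>R x"
  by (simp add: vec_eq_iff forall_2 cl_components complex_eq_iff cross_components inner_vec_def sum_3)
    (simp add: algebra_simps)

lemma cl_add: "cl (a + b) x = cl a x + cl b x" and cl_diff: "cl (a - b) x = cl a x - cl b x"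
  and cl_scaleR: "cl (r *\<^sub>R a) x = r *\<^sub>R cl a x"
  by (simp_all add: cl_def sum.distrib algebra_simps sum_subtractf scaleR_sum_right sum_negf)

lemma cl_skew: "cl a x \<bullet> x = 0"
  by (simp add: inner_vec_def sum_2 cl_components inner_complex_def algebra_simps)

text \<open>Each pair of distinct indices occurs twice with equal contributions, and \<gamma>_2
  \<gamma>_3 = \<gamma>_1 cyclically; the diagonal is zero.\<close>

lemma cgamma_double_sum:
  assumes "\<And>a b. W b a = - W a b"
  shows "(\<Sum>a\<in>UNIV. \<Sum>b\<in>UNIV. W a b *\<^sub>R (cgamma a *v (cgamma b *v x)))
    = 2 *\<^sub>R cl (vector [W 2 3, W 3 1, W 1 2]) x"
proof -
  have d: "W a a = 0" for a
    using assms[of a a] by simp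
  show ?thesis
    using assms[of 1 2] assms[of 2 3] assms[of 3 1]
    by (simp add: sum_3 d vec_eq_iff forall_2 cl_components cgamma_mult complex_eq_iff algebra_simps)
qed

text \<open>The spinor \<open>x\<close> is regarded as the quaternion \<open>q\<close> with \<open>x$1 = q\<^sub>0 - \<i> q\<^sub>3\<close> and \<open>x$2 = q\<^sub>2 - \<i> q\<^sub>1\<close>,
  so that \<open>cgamma a\<close> becomes left multiplication by the quaternion unit \<open>e\<^sub>a\<close>, and \<open>rmul c\<close> right
  multiplication by \<open>e\<^sub>c\<close>. Then \<open>qrot c x x\<close> is the imaginary quaternion \<open>q e\<^sub>c q\<^sup>*\<close>.\<close>

definition rmul :: "3 \<Rightarrow> complex^2 \<Rightarrow> complex^2" where
  "rmul c x = (if c = 1 then vector [\<i> * cnj (x$2), - \<i> * cnj (x$1)]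
     else if c = 2 then vector [- cnj (x$2), cnj (x$1)] else vector [- \<i> * x$1, - \<i> * x$2])"

definition qrot :: "3 \<Rightarrow> complex^2 \<Rightarrow> complex^2 \<Rightarrow> real^3" where
  "qrot c x y = (\<chi> a. (cgamma a *v x) \<bullet> rmul c y)"

text \<open>Keeping the two spinor arguments of \<open>qrot\<close> separate makes the quadratic map
  x \<mapsto> \<open>qrot c x x\<close> accessible to the bilinear product rule.\<close>

lemma bounded_bilinear_qrot: "bounded_bilinear (qrot c)"
proof -
  have r: "rmul c (x + y) = rmul c x + rmul c y" "rmul c (k *\<^sub>R x) = k *\<^sub>R rmul c x" for x y and k :: real
    by (simp_all add: rmul_def vec_eq_iff forall_2 complex_eq_iff)
  have c: "cgamma a *v (k *\<^sub>R x) = k *\<^sub>R (cgamma a *v x)" for a x and k :: real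
    by (simp add: vec_eq_iff matrix_vector_mult_def scaleR_sum_right)
  have "bilinear (qrot c)"
    unfolding bilinear_def
    by (intro conjI allI linearI)
      (simp_all add: qrot_def vec_eq_iff r c matrix_vector_right_distrib inner_add_left inner_add_right)
  then show ?thesis
    by (simp add: bilinear_conv_bounded_bilinear)
qed

text \<open>For a quaternion q and imaginary a, the sum of a q e_c conj(q) and q e_c conj(a q) is
  the commutator of a with q e_c conj(q), since conj(a) = -a.\<close>

lemma qrot_derivative: "qrot c (cl a x) x + qrot c x (cl a x) = 2 *\<^sub>R (a \<times> qrot c x x)"
  using exhaust_3[of c]
  by (auto simp: qrot_def vec_eq_iff forall_3 cgamma_mult rmul_def inner_vec_def sum_2 cl_components
      inner_complex_def cross_components algebra_simps)

lemma qrot_orthonormal: "qrot c x x \<bullet> qrot d x x = (if c = d then (x \<bullet> x)\<^sup>2 else 0)"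
  using exhaust_3[of c] exhaust_3[of d]
  by (auto simp: qrot_def cgamma_mult rmul_def inner_vec_def sum_2 sum_3 
      inner_complex_def power2_eq_square algebra_simps)

text \<open>From conj(q) q = |q|^2 and e_1 e_2 = e_3. It fixes the orientation of the frame obtained
  from the spinor.\<close>

lemma qrot_positive: "qrot 1 x x \<times> qrot 2 x x = (x \<bullet> x) *\<^sub>R qrot 3 x x"
  by (auto simp: qrot_def vec_eq_iff forall_3 cgamma_mult rmul_def inner_vec_def sum_2 
      inner_complex_def cross_components power2_eq_square algebra_simps)

section \<open>Riemannian flows\<close>

locale flow = riemannian_mfd A g nab
  for A :: "'m::{t2_space, second_countable_topology} atlas" and g :: "'m metric" and nab :: "'m connection" +
  fixes \<xi> :: "'m vfield" and b :: "'m \<Rightarrow> real"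
  assumes riemannian_flow: "riemannian_flow A g \<xi>" and smooth_b: "smooth_fn A UNIV b"
    and h_tensor: "in_Q g \<xi> p z \<Longrightarrow> h_tensor nab \<xi> p z = b p *\<^sub>R J_Q g \<xi> p z"
begin

lemma smooth_xi: "smooth_vf A V \<xi>" and xi_unit: "g p (\<xi> p) (\<xi> p) = 1"
  using riemannian_flow smooth_vf_subset[of UNIV \<xi> V] by (auto simp: riemannian_flow_def)

lemma smooth_kappa: "smooth_vf A V (kappa nab \<xi>)"
  using smooth_vf_subset[OF smooth_vf_nab[OF open_UNIV smooth_xi smooth_xi], of V]
  by (simp add: kappa_def[abs_def])

lemma g_nab_xi: "g p (nab p v \<xi>) (\<xi> p) = 0"
proof -
  have "dirderiv A p v (\<lambda>q. g q (\<xi> q) (\<xi> q)) = 0"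
    by (simp add: xi_unit dirderiv_const)
  then show ?thesis
    using metric_compat[OF open_UNIV smooth_xi smooth_xi UNIV_I, of p v] by (simp add: g_sym[of p "\<xi> p"])
qed

text \<open>By torsion-freeness the bracket term cancels the terms in which \<open>X\<close> and
  \<open>Y\<close> are differentiated.\<close>

lemma ext_deriv1_kappa:
  assumes "open W" "smooth_vf A W X" "smooth_vf A W Y" "p \<in> W"
  shows "ext_deriv1 A (\<lambda>q v. g q (kappa nab \<xi> q) v) X Y p
    = g p (nab p (X p) (kappa nab \<xi>)) (Y p) - g p (nab p (Y p) (kappa nab \<xi>)) (X p)"
  using metric_compat[OF assms(1) smooth_kappa assms(2,4), of "Y p"]
    metric_compat[OF assms(1) smooth_kappa assms(3,4), of "X p"]
  by (simp add: ext_deriv1_def torsion_free[OF assms] g_simps)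

end

locale flow_frame = orthonormal_frame A g nab U E + flow A g nab \<xi> b
  for A :: "'m::{t2_space, second_countable_topology} atlas" and g nab U E \<xi> b
begin

abbreviation x where "x q \<equiv> hat q (\<xi> q)"
abbreviation k where "k q \<equiv> hat q (kappa nab \<xi> q)"

lemma x_unit: "q \<in> U \<Longrightarrow> x q \<bullet> x q = 1"
  using g_hat[of q "\<xi> q" "\<xi> q"] by (simp add: xi_unit)

lemma x_k: "q \<in> U \<Longrightarrow> x q \<bullet> k q = 0"
  using g_hat[of q "kappa nab \<xi> q" "\<xi> q"] g_nab_xi[of q "\<xi> q"] by (simp add: kappa_def inner_commute)

lemma in_Q_hat: "q \<in> U \<Longrightarrow> in_Q g \<xi> q z \<longleftrightarrow> x q \<bullet> hat q z = 0"
  by (simp add: in_Q_def g_hat inner_commute)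

lemma proj_Q_hat: "q \<in> U \<Longrightarrow> hat q (proj_Q g \<xi> q v) = hat q v - (x q \<bullet> hat q v) *\<^sub>R x q"
  by (simp add: proj_Q_def hat_simps g_hat inner_commute)

lemma positive_onb_Q_cross:
  assumes "q \<in> U" "positive_onb_Q g \<xi> q e1 e2"
  shows "x q \<times> hat q e1 = hat q e2" "hat q e1 \<times> hat q e2 = x q" "hat q e2 \<times> x q = hat q e1"
  using orthonormal_triple_cross[of "x q" "hat q e1" "hat q e2"] assms x_unit[of q]
  by (simp_all add: positive_onb_Q_def in_Q_hat g_hat positive_basis_hat)

lemma ex_positive_onb_Q:
  assumes "q \<in> U"
  obtains e1 e2 where "positive_onb_Q g \<xi> q e1 e2"
proof -
  have "norm (x q) = 1"
    using x_unit[OF assms] by (simp add: norm_eq_1)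
  \<comment> \<open>The basis of \<open>Q\<close> is the image of e_1, e_2 under a rotation taking
    e_3 to \<xi>. It is positive because (e_3, e_1, e_2) is a cyclic permutation of the standard
    basis.\<close>
  then obtain R where R: "rotation_matrix R" "R *v axis 3 1 = x q"
    using rotation_matrix_exists_basis[of "x q" "3::3"] by auto
  have i: "(R *v y) \<bullet> (R *v z) = y \<bullet> z" for y z
    by (rule rotation_matrix_inner[OF R(1)])
  have c: "(R *v y) \<times> (R *v z) = R *v (y \<times> z)" for y z
    by (rule cross_rotation_matrix[OF R(1)])
  show ?thesis
  proof
    show "positive_onb_Q g \<xi> q (unhat q (R *v axis 1 1)) (unhat q (R *v axis 2 1))"
      using assms
      by (simp add: positive_onb_Q_def in_Q_hat g_hat positive_basis_hat hat_unhat
          R(2)[symmetric] i c inner_axis_axis cross_basis)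
  qed
qed

text \<open>The definite description in \<open>J_Q\<close> ranges over all positive bases. Each of
  them yields \<xi> \<times> z, which gives uniqueness, and expanding z in one of them gives
  existence.\<close>

lemma J_Q_hat:
  assumes "q \<in> U" "in_Q g \<xi> q z"
  shows "hat q (J_Q g \<xi> q z) = x q \<times> hat q z"
proof -
  let ?P = "\<lambda>w. \<exists>e1 e2 s t. positive_onb_Q g \<xi> q e1 e2 \<and> z = s *\<^sub>R e1 + t *\<^sub>R e2 \<and> w = s *\<^sub>R e2 - t *\<^sub>R e1"
  have *: "hat q w = x q \<times> hat q z" if w: "?P w" for w
  proof -
    obtain e1 e2 s t where "positive_onb_Q g \<xi> q e1 e2" "z = s *\<^sub>R e1 + t *\<^sub>R e2" "w = s *\<^sub>R e2 - t *\<^sub>R e1"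
      using w by blast
    then show ?thesis
      using positive_onb_Q_cross[OF assms(1), of e1 e2] cross_skew[of "x q" "hat q e2"]
      by (simp add: hat_simps cross_add_right cross_mult_right)
  qed
  obtain e1 e2 where e: "positive_onb_Q g \<xi> q e1 e2"
    using ex_positive_onb_Q[OF assms(1)] .
  let ?s = "hat q z \<bullet> hat q e1" and ?t = "hat q z \<bullet> hat q e2"
  have "hat q z = ?s *\<^sub>R hat q e1 + ?t *\<^sub>R hat q e2"
  proof -
    \<comment> \<open>Since z is orthogonal to \<xi>, two cross products with \<xi> recover it;
      writing \<xi> = e_1 \<times> e_2 in the inner one produces the coefficients.\<close>
    have "x q \<times> (hat q z \<times> x q) = hat q z"
      using assms by (simp add: Lagrange x_unit in_Q_hat)
    moreover have "hat q z \<times> x q = ?t *\<^sub>R hat q e1 - ?s *\<^sub>R hat q e2"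
      by (subst positive_onb_Q_cross(2)[OF assms(1) e, symmetric]) (simp add: Lagrange)
    ultimately show ?thesis
      using positive_onb_Q_cross[OF assms(1) e] cross_skew[of "x q" "hat q e2"]
      by (simp add: Cross3.right_diff_distrib cross_mult_right algebra_simps)
  qed
  then have "hat q z = hat q (?s *\<^sub>R e1 + ?t *\<^sub>R e2)"
    by (simp add: hat_simps)
  then have "z = ?s *\<^sub>R e1 + ?t *\<^sub>R e2"
    using hat_inject[OF assms(1)] by blast
  then have ex: "?P (?s *\<^sub>R e2 - ?t *\<^sub>R e1)"
    using e by blast
  have "?P (J_Q g \<xi> q z)"
    unfolding J_Q_def
  proof (rule theI[of ?P, OF ex])
    show "w = ?s *\<^sub>R e2 - ?t *\<^sub>R e1" if "?P w" for w
      using *[OF that] *[OF ex] hat_inject[OF assms(1)] by metis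
  qed
  then show ?thesis
    by (rule *)
qed

lemma in_Q_proj_Q: "q \<in> U \<Longrightarrow> in_Q g \<xi> q (proj_Q g \<xi> q v)"
  by (simp add: in_Q_hat proj_Q_hat inner_diff_right x_unit)

text \<open>The \<xi>-part of v contributes \<kappa> and its \<open>Q\<close>-part contributes b J.
  The projection to \<open>Q\<close> can be omitted because \<xi> \<times> \<xi> = 0.\<close>

lemma hat_nab_xi:
  assumes "q \<in> U"
  shows "hat q (nab q v \<xi>) = (x q \<bullet> hat q v) *\<^sub>R k q + b q *\<^sub>R (x q \<times> hat q v)"
proof -
  let ?z = "proj_Q g \<xi> q v"
  have "nab q v \<xi> = nab q (g q v (\<xi> q) *\<^sub>R \<xi> q + ?z) \<xi>"
    by (simp add: proj_Q_def)
  also have "\<dots> = g q v (\<xi> q) *\<^sub>R kappa nab \<xi> q + b q *\<^sub>R J_Q g \<xi> q ?z"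
    using h_tensor[OF in_Q_proj_Q[OF assms, of v]] nab_linear[OF open_UNIV smooth_xi UNIV_I, of q]
    by (simp only: linear_add[of "\<lambda>v. nab q v \<xi>"] linear_scale[of "\<lambda>v. nab q v \<xi>"] kappa_def h_tensor_def)
  finally show ?thesis
    by (simp add: hat_simps J_Q_hat[OF assms in_Q_proj_Q[OF assms]] proj_Q_hat assms g_hat inner_commute
        Cross3.right_diff_distrib cross_mult_right)
qed

lemma hat_h_tensor:
  assumes "q \<in> U" "in_Q g \<xi> q z"
  shows "hat q (h_tensor nab \<xi> q z) = b q *\<^sub>R (x q \<times> hat q z)"
  using hat_nab_xi[OF assms(1), of z] assms by (simp add: h_tensor_def in_Q_hat)

lemma Omega_hat:
  assumes "q \<in> U"
  shows "Omega g nab \<xi> q v w = b q * (x q \<bullet> (hat q v \<times> hat q w))"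
  unfolding Omega_def g_hat[OF assms] hat_h_tensor[OF assms in_Q_proj_Q[OF assms]] proj_Q_hat[OF assms]
  by (simp add: Cross3.right_diff_distrib cross_mult_right inner_diff_right dot_cross_self)
    (simp add: cross3_simps)

end

section \<open>The frame determined by a Killing spinor\<close>

text \<open>With \<open>x\<close> and \<open>k\<close> the components of \<open>\<xi>\<close> and \<open>\<kappa>\<close>, the equation for a transversal Killing
  spinor says that the Levi-Civita derivative of \<open>\<psi>\<close> along \<open>w\<close> is the Clifford product of
  \<open>killing_form \<alpha> \<beta> b x k w\<close> and \<open>\<psi>\<close>.\<close>

definition killing_form :: "real \<Rightarrow> real \<Rightarrow> real \<Rightarrow> real^3 \<Rightarrow> real^3 \<Rightarrow> real^3 \<Rightarrow> real^3" where
  "killing_form \<alpha> \<beta> b x k w =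
    (x \<bullet> w) *\<^sub>R ((\<alpha> + b) *\<^sub>R x + (1/2) *\<^sub>R (x \<times> k)) + \<beta> *\<^sub>R (x \<times> w) - (b/2) *\<^sub>R w"

text \<open>All that the curvature computation needs from the spinor; the spinor itself no longer
  occurs.\<close>

locale killing_frame = flow_frame A g nab U E \<xi> b
  for A :: "'m::{t2_space, second_countable_topology} atlas" and g nab U E \<xi> b +
  fixes \<alpha> \<beta> :: real
  assumes hat_nab_frame: "q \<in> U \<Longrightarrow>
    hat q (nab q v (E c)) = 2 *\<^sub>R (killing_form \<alpha> \<beta> (b q) (x q) (k q) (hat q v) \<times> axis c 1)"

locale killing_flow = flow A g nab \<xi> b
  for A :: "'m::{t2_space, second_countable_topology} atlas" and g nab \<xi> b +
  fixes S :: "('i, 'm) spin_data" and \<psi> :: "('i, 'm) spinor" and \<alpha> \<beta> :: real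
  assumes spin: "spin_structure A g S"
    and killing: "transversal_killing_spinor A g nab \<xi> S \<alpha> \<beta> \<psi>"
    and nonzero: "nonzero_spinor S \<psi>"
begin

lemma flow_frame_spin: "i \<in> sindex S \<Longrightarrow> flow_frame A g nab (sdom S i) (sframe S i) \<xi> b"
  using spin by unfold_locales (auto simp: spin_structure_def)

lemma smooth_psi: "i \<in> sindex S \<Longrightarrow> smooth_fn A (sdom S i) (\<psi> i)"
  using killing by (simp add: transversal_killing_spinor_def spinor_field_def)

lemma open_sdom: "i \<in> sindex S \<Longrightarrow> open (sdom S i)"
  using spin by (simp add: spin_structure_def)

lemma dirderiv_psi:
  assumes i: "i \<in> sindex S" and q: "q \<in> sdom S i"
  defines "h \<equiv> orthonormal_frame.hat g (sframe S i)"
  shows "dirderiv A q v (\<psi> i) = cl (killing_form \<alpha> \<beta> (b q) (h q (\<xi> q)) (h q (kappa nab \<xi> q)) (h q v)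
    - orthonormal_frame.conn g nab (sframe S i) q v) (\<psi> i q)"
proof -
  interpret F: flow_frame A g nab "sdom S i" "sframe S i" \<xi> b
    by (rule flow_frame_spin[OF i])
  let ?\<psi> = "\<psi> i q"
  let ?K = "\<lambda>v. killing_form \<alpha> \<beta> (b q) (F.x q) (F.k q) (F.hat q v)"
  have h: "h = F.hat" by (simp add: h_def)
  have cliff: "cliff g S i q u y = cl (F.hat q u) y" for u y
    by (simp add: cliff_def cl_def F.hat_def)
  have spin_nabla: "spin_nabla A g nab S i q u \<psi> = dirderiv A q u (\<psi> i) + cl (F.conn q u) ?\<psi>" for u
  proof -
    let ?W = "\<lambda>a b. g q (nab q u (sframe S i a)) (sframe S i b q)"
    have "(\<Sum>a\<in>UNIV. \<Sum>b\<in>UNIV. ?W a b *\<^sub>R (cgamma a *v (cgamma b *v ?\<psi>)))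
        = 2 *\<^sub>R cl (vector [?W 2 3, ?W 3 1, ?W 1 2]) ?\<psi>"
      by (rule cgamma_double_sum) (rule F.conn_skew[OF q])
    then show ?thesis
      by (simp add: spin_nabla_def F.conn_def cl_scaleR)
  qed
  \<comment> \<open>\<Omega> is b times the contraction of the volume form with \<xi>, and e_1 e_2
    acts as \<xi>, so \<Omega> acts as multiplication by b \<xi>.\<close>
  have cliff2: "cliff2 S i q (Omega g nab \<xi> q) ?\<psi> = cl (b q *\<^sub>R F.x q) ?\<psi>"
  proof -
    let ?W = "\<lambda>a c. Omega g nab \<xi> q (sframe S i a q) (sframe S i c q)"
    have "(\<Sum>a\<in>UNIV. \<Sum>b\<in>UNIV. ?W a b *\<^sub>R (cgamma a *v (cgamma b *v ?\<psi>)))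
        = 2 *\<^sub>R cl (vector [?W 2 3, ?W 3 1, ?W 1 2]) ?\<psi>"
    proof (rule cgamma_double_sum)
      show "?W d a = - ?W a d" for a d
        using cross_skew[of "F.hat q (sframe S i d q)" "F.hat q (sframe S i a q)"]
        by (simp add: F.Omega_hat[OF q])
    qed
    moreover have "vector [?W 2 3, ?W 3 1, ?W 1 2] = b q *\<^sub>R F.x q"
      by (simp add: F.Omega_hat[OF q] F.hat_E[OF q] cross_basis vec_eq_iff forall_3 inner_axis)
    ultimately show ?thesis
      by (simp add: cliff2_def)
  qed
  have K: "transversal_spin_nabla_xi A g nab \<xi> S i q \<psi> = \<alpha> *\<^sub>R cliff g S i q (\<xi> q) ?\<psi> \<and>
      (\<forall>z. in_Q g \<xi> q z \<longrightarrow> transversal_spin_nabla_Q A g nab \<xi> S i q z \<psi>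
        = \<beta> *\<^sub>R cliff g S i q (\<xi> q) (cliff g S i q z ?\<psi>))"
    using killing i q by (simp add: transversal_killing_spinor_def)
  have eq_xi: "spin_nabla A g nab S i q (\<xi> q) \<psi> - (1/2) *\<^sub>R cl (b q *\<^sub>R F.x q) ?\<psi>
      - (1/2) *\<^sub>R cl (F.x q) (cl (F.k q) ?\<psi>) = \<alpha> *\<^sub>R cl (F.x q) ?\<psi>"
    using K[THEN conjunct1] unfolding transversal_spin_nabla_xi_def cliff cliff2 .
  have eq_Q: "spin_nabla A g nab S i q z \<psi> - (1/2) *\<^sub>R cl (F.x q) (cl (F.hat q (h_tensor nab \<xi> q z)) ?\<psi>)
      = \<beta> *\<^sub>R cl (F.x q) (cl (F.hat q z) ?\<psi>)" if "in_Q g \<xi> q z" for z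
    using K[THEN conjunct2, rule_format, OF that] unfolding transversal_spin_nabla_Q_def cliff .
  have xi: "spin_nabla A g nab S i q (\<xi> q) \<psi> = cl (?K (\<xi> q)) ?\<psi>"
  proof -
    have "spin_nabla A g nab S i q (\<xi> q) \<psi> = \<alpha> *\<^sub>R cl (F.x q) ?\<psi> + (1/2) *\<^sub>R cl (b q *\<^sub>R F.x q) ?\<psi>
        + (1/2) *\<^sub>R cl (F.x q) (cl (F.k q) ?\<psi>)"
      using eq_xi by (simp add: algebra_simps)
    also have "\<dots> = cl (\<alpha> *\<^sub>R F.x q + (b q / 2) *\<^sub>R F.x q + (1/2) *\<^sub>R (F.x q \<times> F.k q)) ?\<psi>"
      by (simp add: cl_cl F.x_k[OF q] cl_add cl_scaleR)
    \<comment> \<open>Here the coefficient \<alpha> + b in \<open>killing_form\<close> arises: on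
      \<open>Q\<close> the term with h gives -(b/2) z, and extending it to all vectors must be
      compensated along \<xi>, where \<alpha> + b/2 is required.\<close>
    also have "\<alpha> *\<^sub>R F.x q + (b q / 2) *\<^sub>R F.x q + (1/2) *\<^sub>R (F.x q \<times> F.k q) = ?K (\<xi> q)"
      by (simp add: killing_form_def F.x_unit[OF q] vec_eq_iff field_simps)
    finally show ?thesis .
  qed
  have Q: "spin_nabla A g nab S i q z \<psi> = cl (?K z) ?\<psi>" if z: "in_Q g \<xi> q z" for z
  proof -
    have xz: "F.x q \<bullet> F.hat q z = 0"
      using z by (simp add: F.in_Q_hat[OF q])
    then have xxz: "F.x q \<times> (F.x q \<times> F.hat q z) = - F.hat q z"
      by (simp add: Lagrange F.x_unit[OF q])
    have 1: "cl (F.x q) (cl (F.hat q (h_tensor nab \<xi> q z)) ?\<psi>) = cl (b q *\<^sub>R - F.hat q z) ?\<psi>"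
      by (simp add: cl_cl F.hat_h_tensor[OF q z] cross_mult_right xxz dot_cross_self)
    have 2: "cl (F.x q) (cl (F.hat q z) ?\<psi>) = cl (F.x q \<times> F.hat q z) ?\<psi>"
      by (simp add: cl_cl xz)
    have "spin_nabla A g nab S i q z \<psi> = (1/2) *\<^sub>R cl (F.x q) (cl (F.hat q (h_tensor nab \<xi> q z)) ?\<psi>)
        + \<beta> *\<^sub>R cl (F.x q) (cl (F.hat q z) ?\<psi>)"
      using eq_Q[OF z] by (simp add: algebra_simps)
    also have "\<dots> = cl ((1/2) *\<^sub>R (b q *\<^sub>R - F.hat q z) + \<beta> *\<^sub>R (F.x q \<times> F.hat q z)) ?\<psi>"
      by (simp only: 1 2 cl_add cl_scaleR)
    also have "(1/2) *\<^sub>R (b q *\<^sub>R - F.hat q z) + \<beta> *\<^sub>R (F.x q \<times> F.hat q z) = ?K z"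
      by (simp add: killing_form_def xz)
    finally show ?thesis .
  qed
  note conn = F.linear_conn[OF q]
  have lin: "linear (\<lambda>u. spin_nabla A g nab S i q u \<psi>)"
    unfolding spin_nabla
    by (intro linearI) (simp_all add: linear_add[OF conn] linear_scale[OF conn] cl_add cl_scaleR
        linear_add[OF dirderiv_linear[OF smooth_psi[OF i] q]]
        linear_scale[OF dirderiv_linear[OF smooth_psi[OF i] q]] algebra_simps)
  \<comment> \<open>Both sides are linear in v, so the cases of \<xi> and of \<open>Q\<close>
    combine.\<close>
  have "spin_nabla A g nab S i q v \<psi> = spin_nabla A g nab S i q (g q v (\<xi> q) *\<^sub>R \<xi> q + proj_Q g \<xi> q v) \<psi>"
    by (simp add: proj_Q_def)
  also have "\<dots> = cl (g q v (\<xi> q) *\<^sub>R ?K (\<xi> q) + ?K (proj_Q g \<xi> q v)) ?\<psi>"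
    by (simp add: linear_add[OF lin] linear_scale[OF lin] xi Q[OF F.in_Q_proj_Q[OF q]] cl_add cl_scaleR)
  also have "g q v (\<xi> q) *\<^sub>R ?K (\<xi> q) + ?K (proj_Q g \<xi> q v) = ?K v"
    by (simp add: killing_form_def F.proj_Q_hat[OF q] F.x_unit[OF q] F.g_hat[OF q] inner_commute
        inner_diff_right cross_mult_right Cross3.right_diff_distrib algebra_simps)
  finally show ?thesis
    by (simp add: spin_nabla cl_diff h algebra_simps)
qed

section \<open>The spinor has locally constant norm and no zeros\<close>

lemma psi_norm_derivative:
  assumes "i \<in> sindex S" "q \<in> sdom S i"
  shows "dirderiv A q v (\<lambda>q. \<psi> i q \<bullet> \<psi> i q) = 0"
  using dirderiv_bilinear[OF bounded_bilinear_inner smooth_psi smooth_psi assms(2), of v] assms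
  by (simp add: dirderiv_psi cl_skew inner_commute[of "\<psi> i q" "cl _ (\<psi> i q)"])

lemma psi_norm_locally_constant:
  assumes "i \<in> sindex S" "p \<in> sdom S i"
  shows "\<exists>W. open W \<and> p \<in> W \<and> W \<subseteq> sdom S i \<and> (\<forall>q\<in>W. \<psi> i q \<bullet> \<psi> i q = \<psi> i p \<bullet> \<psi> i p)"
proof (rule dirderiv_zero_locally_constant[OF open_sdom[OF assms(1)]
      smooth_fn_inner[OF open_sdom[OF assms(1)] smooth_psi[OF assms(1)] smooth_psi[OF assms(1)]] assms(2)
      psi_norm_derivative[OF assms(1)]])
  fix W assume "open W" "p \<in> W" "W \<subseteq> sdom S i" "\<And>q. q \<in> W \<Longrightarrow> \<psi> i q \<bullet> \<psi> i q = \<psi> i p \<bullet> \<psi> i p"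
  then show ?thesis by blast
qed

lemma psi_zero_glue:
  assumes "i \<in> sindex S" "j \<in> sindex S" "p \<in> sdom S i" "p \<in> sdom S j" "\<psi> j p = 0"
  shows "\<psi> i p = 0"
proof -
  have "\<forall>i\<in>sindex S. \<forall>j\<in>sindex S. \<forall>p \<in> sdom S i \<inter> sdom S j. \<psi> i p = slift S i j p *v \<psi> j p"
    using killing unfolding transversal_killing_spinor_def spinor_field_def by blast
  then have "\<psi> i p = slift S i j p *v \<psi> j p"
    using assms by blast
  then show ?thesis
    using assms(5) by simp
qed

lemma ex_sdom: obtains i where "i \<in> sindex S" "p \<in> sdom S i"
proof -
  have "p \<in> (\<Union>i\<in>sindex S. sdom S i)"
    using spin by (simp add: spin_structure_def)
  then show ?thesis
    using that by blast
qed

lemma psi_nowhere_zero: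
  assumes "i \<in> sindex S" "p \<in> sdom S i"
  shows "\<psi> i p \<noteq> 0"
proof
  assume zero: "\<psi> i p = 0"
  \<comment> \<open>\<open>Z True\<close> and \<open>Z False\<close> collect the points where \<psi>
    vanishes, respectively does not, in some trivialization. Local constancy of the norm makes both
    open and gluing makes them disjoint, so connectedness leaves only one.\<close>
  define Z where "Z P = {p. \<exists>i\<in>sindex S. p \<in> sdom S i \<and> ((\<psi> i p = 0) = P)}" for P
  have "open (Z P)" for P
  proof (subst open_subopen, rule ballI)
    fix q assume "q \<in> Z P"
    then obtain j where j: "j \<in> sindex S" "q \<in> sdom S j" "(\<psi> j q = 0) = P"
      unfolding Z_def by blast
    obtain W where W: "open W" "q \<in> W" "W \<subseteq> sdom S j" "\<And>r. r \<in> W \<Longrightarrow> \<psi> j r \<bullet> \<psi> j r = \<psi> j q \<bullet> \<psi> j q"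
      using psi_norm_locally_constant[OF j(1,2)] by blast
    have "(\<psi> j r = 0) = P" if "r \<in> W" for r
      using W(4)[OF that] j(3) inner_eq_zero_iff by metis
    then have "W \<subseteq> Z P"
      using W(3) j(1) unfolding Z_def by blast
    then show "\<exists>T. open T \<and> q \<in> T \<and> T \<subseteq> Z P"
      using W by blast
  qed
  moreover have "Z True \<inter> Z False = {}"
    using psi_zero_glue unfolding Z_def by blast
  moreover have "UNIV \<subseteq> Z True \<union> Z False"
  proof
    fix q :: 'm
    obtain j where "j \<in> sindex S" "q \<in> sdom S j"
      by (rule ex_sdom)
    then show "q \<in> Z True \<union> Z False"
      unfolding Z_def by blast
  qed
  moreover have "connected (UNIV :: 'm set)"
    using oriented by (simp add: oriented_manifold_def)
  ultimately have "Z True = {} \<or> Z False = {}"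
    using connectedD[of UNIV "Z True" "Z False"] by simp
  moreover have "p \<in> Z True"
    using zero assms unfolding Z_def by blast
  moreover have "Z False \<noteq> {}"
    using nonzero unfolding Z_def nonzero_spinor_def by blast
  ultimately show False by blast
qed

text \<open>The frame of \<open>\<psi>\<close> is followed by a constant rotation, chosen so that its third vector is \<open>\<xi>\<close> at \<open>p\<close>.\<close>

lemma ex_killing_frame:
  obtains U E where "p \<in> U" "killing_frame A g nab U E \<xi> b \<alpha> \<beta>" "E 3 p = \<xi> p"
proof -
  obtain i where i: "i \<in> sindex S" "p \<in> sdom S i"
    by (rule ex_sdom)
  interpret F: flow_frame A g nab "sdom S i" "sframe S i" \<xi> b
    by (rule flow_frame_spin[OF i(1)])
  define N where "N = \<psi> i p \<bullet> \<psi> i p"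
  have N: "N > 0"
    using psi_nowhere_zero[OF i] by (simp add: N_def)
  obtain W where W: "open W" "p \<in> W" "W \<subseteq> sdom S i" and WN: "\<And>q. q \<in> W \<Longrightarrow> \<psi> i q \<bullet> \<psi> i q = N"
    using psi_norm_locally_constant[OF i] unfolding N_def by blast
  define G where "G c q = qrot c (\<psi> i q) (\<psi> i q)" for c q
  \<comment> \<open>The vectors \<open>G c q\<close> have length \<open>N\<close>, so after division
    they are orthonormal. For fixed q the map y \<mapsto> \<open>L y q\<close> is a rotation; for
    fixed y it follows the frame of \<psi> with constant coefficients.\<close>
  define L where "L y q = (\<Sum>c\<in>UNIV. (y$c / N) *\<^sub>R G c q)" for y :: "real^3" and q
  have GG: "G c q \<bullet> G d q = (if c = d then N\<^sup>2 else 0)" if "q \<in> W" for c d q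
    by (simp add: G_def qrot_orthonormal WN[OF that])
  have L_inner: "L y q \<bullet> L z q = y \<bullet> z" if "q \<in> W" for y z q
  proof -
    have "y \<bullet> z = y$1 * z$1 + y$2 * z$2 + y$3 * z$3"
      by (simp add: inner_vec_def sum_3)
    then show ?thesis
      using N by (simp add: L_def sum_3 inner_add_left inner_add_right GG[OF that] power2_eq_square)
  qed
  have linL: "linear (\<lambda>y. L y q)" for q
    by (rule linearI) (simp_all add: L_def sum_3 add_divide_distrib algebra_simps)
  have L_cross: "L y q \<times> L z q = L (y \<times> z) q" if q: "q \<in> W" for y z q
  proof -
    have G12: "G 1 q \<times> G 2 q = N *\<^sub>R G 3 q"
      by (simp add: G_def qrot_positive WN[OF q])
    let ?f = "\<lambda>c. (1/N) *\<^sub>R G c q"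
    have on: "?f c \<bullet> ?f d = (if c = d then 1 else 0)" for c d
      using N by (simp add: GG[OF q] power2_eq_square)
    have "?f 1 \<bullet> (?f 2 \<times> ?f 3) = ?f 3 \<bullet> (?f 1 \<times> ?f 2)"
      by (rule inner_cross_cyclic)
    also have "?f 1 \<times> ?f 2 = ?f 3"
      using N by (simp add: cross_mult_left cross_mult_right G12)
    finally have "?f 1 \<bullet> (?f 2 \<times> ?f 3) > 0"
      by (simp only: on) simp
    note c = orthonormal_triple_cross[OF _ _ _ _ _ _ this, simplified on, simplified]
    have c': "?f 2 \<times> ?f 1 = - ?f 3" "?f 3 \<times> ?f 2 = - ?f 1" "?f 1 \<times> ?f 3 = - ?f 2"
      by (metis c cross_skew)+
    have L: "L y q = y$1 *\<^sub>R ?f 1 + y$2 *\<^sub>R ?f 2 + y$3 *\<^sub>R ?f 3" for y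
      by (simp add: L_def sum_3)
    have "L y q \<times> L z q = (y$2 * z$3 - z$2 * y$3) *\<^sub>R ?f 1 + (y$3 * z$1 - z$3 * y$1) *\<^sub>R ?f 2
        + (y$1 * z$2 - z$1 * y$2) *\<^sub>R ?f 3"
      unfolding L cross_add_left cross_add_right cross_mult_left[of "y$_"] cross_mult_right[of _ "z$_"] c c' cross_refl
      by (simp add: algebra_simps)
    then show ?thesis
      by (simp add: L cross_components)
  qed
  have "orthogonal_transformation (\<lambda>y. L y p)"
    using linL L_inner[OF W(2)] by (simp add: orthogonal_transformation_def)
  then have "surj (\<lambda>y. L y p)"
    by (rule orthogonal_transformation_surj)
  \<comment> \<open>y holds the coefficients of \<xi> at p in the frame of \<psi>; the constant
    rotation \<open>R\<close> takes e_3 to it.\<close>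
  then obtain y where y: "L y p = F.x p"
    by (metis surjD)
  have "norm y = 1"
    using L_inner[OF W(2), of y y] F.x_unit[OF i(2)] by (simp add: y norm_eq_1)
  then obtain R where R: "rotation_matrix R" "R *v axis 3 1 = y"
    using rotation_matrix_exists_basis[of y "3::3"] by auto
  have R_inner: "(R *v u) \<bullet> (R *v w) = u \<bullet> w" for u w
    by (rule rotation_matrix_inner[OF R(1)])
  define \<rho> where "\<rho> d q = L (R *v axis d 1) q" for d q
  define E where "E d q = F.unhat q (\<rho> d q)" for d q
  have smooth_G: "smooth_fn A W (G c)" for c
    unfolding G_def
    by (intro smooth_fn_bilinear[OF W(1) bounded_bilinear_qrot] smooth_fn_subset[OF smooth_psi[OF i(1)] W(3)])
  have smooth_\<rho>: "smooth_fn A W (\<rho> d)" for d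
    unfolding \<rho>_def L_def
    by (intro smooth_fn_sum[OF W(1)] smooth_fn_linear[OF W(1) bounded_linear_scaleR_right] smooth_G) simp
  have on: "\<rho> d q \<bullet> \<rho> e q = (if d = e then 1 else 0)" if "q \<in> W" for d e q
    by (simp add: \<rho>_def L_inner[OF that] R_inner inner_axis_axis)
  have pos: "\<rho> 1 q \<bullet> (\<rho> 2 q \<times> \<rho> 3 q) > 0" if "q \<in> W" for q
    by (simp add: \<rho>_def L_inner[OF that] L_cross[OF that] R_inner cross_rotation_matrix[OF R(1)]
        cross_basis inner_axis_axis)
  have "orthonormal_frame A g nab W E"
    unfolding E_def[abs_def]
    by (rule F.orthonormal_frame_unhat[OF W(1,3) smooth_\<rho> on pos])
  then interpret E: flow_frame A g nab W E \<xi> b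
    by (simp add: flow_frame_def flow_axioms)
  have kf: "E.hat q (nab q v (E d)) = 2 *\<^sub>R (killing_form \<alpha> \<beta> (b q) (E.x q) (E.k q) (E.hat q v) \<times> axis d 1)"
    if q: "q \<in> W" for q v d
  proof -
    have q': "q \<in> sdom S i"
      using q W by blast
    define a where "a = killing_form \<alpha> \<beta> (b q) (F.x q) (F.k q) (F.hat q v)"
    have dpsi: "dirderiv A q v (\<psi> i) = cl (a - F.conn q v) (\<psi> i q)"
      using dirderiv_psi[OF i(1) q'] by (simp add: a_def)
    have dG: "dirderiv A q v (G c) = 2 *\<^sub>R ((a - F.conn q v) \<times> G c q)" for c
      unfolding G_def dirderiv_bilinear[OF bounded_bilinear_qrot smooth_psi[OF i(1)] smooth_psi[OF i(1)] q'] dpsi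
      by (subst add.commute) (rule qrot_derivative)
    have "dirderiv A q v (\<lambda>q. L z q) = 2 *\<^sub>R ((a - F.conn q v) \<times> L z q)" for z
      unfolding L_def
      by (subst dirderiv_sum[OF smooth_fn_linear[OF W(1) bounded_linear_scaleR_right smooth_G] q])
        (simp add: dirderiv_linear_comp[OF bounded_linear_scaleR_right smooth_G q] dG sum_3
          cross_add_right cross_mult_right algebra_simps)
    then have d\<rho>: "dirderiv A q v (\<rho> d) = 2 *\<^sub>R ((a - F.conn q v) \<times> \<rho> d q)"
      by (simp add: \<rho>_def[abs_def])
    have hE: "F.hat r (E d r) = \<rho> d r" if "r \<in> W" for r
      using that W(3) by (auto simp: E_def F.hat_unhat)
    have "F.hat q (nab q v (E d)) = dirderiv A q v (\<lambda>q. F.hat q (E d q)) + 2 *\<^sub>R (F.conn q v \<times> F.hat q (E d q))"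
      by (rule F.nab_hat[OF W(1,3) q E.smooth_E]) (rule F.hat_nab_E[OF q'])
    also have "dirderiv A q v (\<lambda>q. F.hat q (E d q)) = dirderiv A q v (\<rho> d)"
      by (rule dirderiv_cong[OF W(1) q hE])
    \<comment> \<open>The connection of the spin frame enters once through the derivative of \<rho>
      and once, with opposite sign, through \<open>nab_hat\<close>, leaving only the Killing
      term.\<close>
    finally have nabE: "F.hat q (nab q v (E d)) = 2 *\<^sub>R (a \<times> F.hat q (E d q))"
      by (simp add: d\<rho> hE[OF q] Cross3.left_diff_distrib algebra_simps)
    note F.change_hat[OF E.orthonormal_frame_axioms q' q, simp]
    note lin = F.linear_change[OF E.orthonormal_frame_axioms q' q]
    note cr = F.change_cross[OF E.orthonormal_frame_axioms q' q]
    note inn = F.change_inner[OF E.orthonormal_frame_axioms q' q]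
    let ?f = "F.change E q"
    have "E.hat q (nab q v (E d)) = ?f (2 *\<^sub>R (a \<times> F.hat q (E d q)))"
      using nabE F.change_hat[OF E.orthonormal_frame_axioms q' q] by metis
    also have "\<dots> = 2 *\<^sub>R (?f a \<times> axis d 1)"
      by (simp add: linear_scale[OF lin] cr E.hat_E[OF q])
    \<comment> \<open>\<open>killing_form\<close> is an expression in inner and cross products,
      hence equivariant under the rotation \<open>?f\<close>.\<close>
    also have "?f a = killing_form \<alpha> \<beta> (b q) (?f (F.x q)) (?f (F.k q)) (?f (F.hat q v))"
      unfolding a_def killing_form_def
      by (simp only: linear_add[OF lin] linear_diff[OF lin] linear_scale[OF lin] cr inn)
    finally show ?thesis
      by simp
  qed
  show ?thesis
  proof
    show "p \<in> W" by (rule W(2))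
    show "killing_frame A g nab W E \<xi> b \<alpha> \<beta>"
      by unfold_locales (rule kf)
    have "\<rho> 3 p = F.x p"
      by (simp add: \<rho>_def R(2) y)
    then show "E 3 p = \<xi> p"
      by (simp add: E_def F.unhat_hat[OF i(2)])
  qed
qed

end

section \<open>Curvature in the Killing frame\<close>

text \<open>The derivative of \<open>killing_form\<close> with \<open>w\<close> held fixed; primes
  denote the derivatives of x, k and b.\<close>

definition killing_form' ::
    "real \<Rightarrow> real \<Rightarrow> real \<Rightarrow> real^3 \<Rightarrow> real^3 \<Rightarrow> real^3 \<Rightarrow> real^3 \<Rightarrow> real \<Rightarrow> real^3 \<Rightarrow> real^3" where
  "killing_form' \<alpha> \<beta> b x k x' k' b' w =
    (x' \<bullet> w) *\<^sub>R ((\<alpha> + b) *\<^sub>R x + (1/2) *\<^sub>R (x \<times> k))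
    + (x \<bullet> w) *\<^sub>R (b' *\<^sub>R x + (\<alpha> + b) *\<^sub>R x' + (1/2) *\<^sub>R (x' \<times> k + x \<times> k'))
    + \<beta> *\<^sub>R (x' \<times> w) - (b'/2) *\<^sub>R w"

text \<open>In a frame with \<open>\<xi> = e\<^sub>3\<close> at the given point, \<open>R(u,v)w = 2 D(u \<times> v) \<times> w\<close> for
  \<open>D = killing_curv \<alpha> \<beta> b k dk db\<close>, where \<open>dk\<close> and \<open>db\<close> are the derivatives of \<open>k\<close> and \<open>b\<close>. The first
  Bianchi identity makes the matrix of \<open>D\<close> symmetric.\<close>

definition killing_curv ::
    "real \<Rightarrow> real \<Rightarrow> real \<Rightarrow> real^3 \<Rightarrow> (real^3 \<Rightarrow> real^3) \<Rightarrow> (real^3 \<Rightarrow> real) \<Rightarrow> real^3 \<Rightarrow> real^3" where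
  "killing_curv \<alpha> \<beta> b k dk db y =
    y$1 *\<^sub>R vector [((k$2)\<^sup>2 - b\<^sup>2 - dk (axis 2 1)$2) / 2,
      (db (axis 3 1) + dk (axis 2 1)$1 - 4*\<alpha>*\<beta> - k$1 * k$2) / 2, db (axis 2 1)/2 - \<alpha> * k$2 - b * k$2]
    + y$2 *\<^sub>R vector [(4*\<alpha>*\<beta> - db (axis 3 1) + dk (axis 1 1)$2 - k$1 * k$2) / 2,
      ((k$1)\<^sup>2 - b\<^sup>2 - dk (axis 1 1)$1) / 2, \<alpha> * k$1 + b * k$1 - db (axis 1 1)/2]
    + y$3 *\<^sub>R vector [db (axis 2 1)/2 - b * k$2, b * k$1 - db (axis 1 1)/2,
      2*\<alpha>*b + 3*b\<^sup>2/2 - 2*\<beta>\<^sup>2]"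

text \<open>Once the known derivative of \<xi> and third component of \<open>dk\<close> are
  substituted, the claim is a polynomial identity in components. The derivative of k along \<xi>
  drops out: \<open>dk\<close> occurs only in x \<times> ((x \<bullet> v) dk u - (x \<bullet> u) dk
  v).\<close>

lemma killing_curv_components:
  fixes k :: "real^3" and dk :: "real^3 \<Rightarrow> real^3" and db :: "real^3 \<Rightarrow> real" and \<alpha> \<beta> b :: real
  defines "x \<equiv> axis 3 1 :: real^3"
  defines "K \<equiv> killing_form \<alpha> \<beta> b x k"
    and "dx \<equiv> \<lambda>u. (- 2 * \<beta>) *\<^sub>R (u - (x \<bullet> u) *\<^sub>R x)"
  defines "K' \<equiv> \<lambda>u. killing_form' \<alpha> \<beta> b x k (dx u) (dk u) (db u)"
  assumes "k$3 = 0" "linear dk" "linear db" and dk3: "\<And>u. dk u $ 3 = 2 * \<beta> * (k \<bullet> u)"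
  shows "K' u v - K' v u - 2 *\<^sub>R K (K u \<times> v - K v \<times> u) + 2 *\<^sub>R (K u \<times> K v)
    = killing_curv \<alpha> \<beta> b k dk db (u \<times> v)"
proof -
  note lk = linear_axis_expand[OF assms(6)] and lb = linear_axis_expand[OF assms(7)]
  have d3: "dk (axis 1 1) $ 3 = 2 * \<beta> * k$1" "dk (axis 2 1) $ 3 = 2 * \<beta> * k$2"
    "dk (axis 3 1) $ 3 = 0"
    by (simp_all add: dk3 inner_axis assms(5))
  show ?thesis
    unfolding K_def K'_def dx_def killing_form_def killing_form'_def killing_curv_def x_def
      lk[of u] lk[of v] lb[of u] lb[of v]
    by (simp add: vec_eq_iff forall_3 cross_components inner_vec_def sum_3 axis_def assms(5)
        d3[unfolded axis_def])
      (simp add: field_simps power2_eq_square)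
qed

lemma linear_killing_form: "linear (killing_form \<alpha> \<beta> b x k)"
  by (rule linearI) (simp_all add: killing_form_def inner_add_right cross_add_right cross_mult_right algebra_simps)

lemma killing_form_has_derivative:
  fixes B :: "'a::real_normed_vector \<Rightarrow> real" and X k W :: "'a \<Rightarrow> real^3"
  assumes "(B has_derivative B') (at y)" "(X has_derivative X') (at y)" "(k has_derivative k') (at y)"
    "(W has_derivative W') (at y)"
  shows "((\<lambda>y. killing_form \<alpha> \<beta> (B y) (X y) (k y) (W y)) has_derivative
    (\<lambda>u. killing_form' \<alpha> \<beta> (B y) (X y) (k y) (X' u) (k' u) (B' u) (W y)
      + killing_form \<alpha> \<beta> (B y) (X y) (k y) (W' u))) (at y)"
proof -
  note cross = bounded_bilinear.FDERIV[OF bounded_bilinear_cross3]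
  have half: "((\<lambda>y. B y / 2) has_derivative (\<lambda>u. B' u / 2)) (at y)"
    using bounded_linear.has_derivative[OF bounded_linear_divide assms(1), of 2] .
  have "((\<lambda>y. killing_form \<alpha> \<beta> (B y) (X y) (k y) (W y)) has_derivative
    (\<lambda>u. (X y \<bullet> W y) *\<^sub>R ((\<alpha> + B y) *\<^sub>R X' u + (0 + B' u) *\<^sub>R X y + (1/2) *\<^sub>R (X y \<times> k' u + X' u \<times> k y))
      + (X y \<bullet> W' u + X' u \<bullet> W y) *\<^sub>R ((\<alpha> + B y) *\<^sub>R X y + (1/2) *\<^sub>R (X y \<times> k y))
      + \<beta> *\<^sub>R (X y \<times> W' u + X' u \<times> W y) - ((B y / 2) *\<^sub>R W' u + (B' u / 2) *\<^sub>R W y))) (at y)"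
    unfolding killing_form_def
    by (intro has_derivative_diff has_derivative_add has_derivative_scaleR[OF half]
        has_derivative_scaleR has_derivative_scaleR_right has_derivative_inner cross has_derivative_const assms)
  then show ?thesis
    by (rule has_derivative_eq_rhs)
      (simp add: killing_form_def killing_form'_def fun_eq_iff algebra_simps add_divide_distrib)
qed

context killing_frame
begin

abbreviation K where "K q w \<equiv> killing_form \<alpha> \<beta> (b q) (x q) (k q) w"

abbreviation K' where
  "K' q v w \<equiv> killing_form' \<alpha> \<beta> (b q) (x q) (k q) (dirderiv A q v x) (dirderiv A q v k) (dirderiv A q v b) w"

lemma smooth_fn_x: "open V \<Longrightarrow> V \<subseteq> U \<Longrightarrow> smooth_fn A V x"
  and smooth_fn_k: "open V \<Longrightarrow> V \<subseteq> U \<Longrightarrow> smooth_fn A V k"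
  and smooth_fn_b: "smooth_fn A V b"
  using smooth_fn_hat[OF _ _ smooth_xi] smooth_fn_hat[OF _ _ smooth_kappa] smooth_fn_subset[OF smooth_b, of V]
  by auto

lemma smooth_fn_K:
  assumes V: "open V" "V \<subseteq> U" and f: "smooth_fn A V f"
  shows "smooth_fn A V (\<lambda>q. K q (f q))"
proof -
  note x = smooth_fn_x[OF V] and k = smooth_fn_k[OF V]
  have half: "smooth_fn A V (\<lambda>q. b q / 2)"
    using smooth_fn_linear[OF V(1) bounded_linear_divide smooth_fn_b[of V], of 2] .
  show ?thesis
    unfolding killing_form_def
    by (intro smooth_fn_diff[OF V(1)] smooth_fn_add[OF V(1)] smooth_fn_scaleR[OF V(1)] smooth_fn_inner[OF V(1)]
        smooth_fn_bilinear[OF V(1) bounded_bilinear_cross3] smooth_fn_const half x k f smooth_fn_b)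
qed

lemma dirderiv_K:
  assumes V: "open V" "V \<subseteq> U" "q \<in> V" and f: "smooth_fn A V f"
  shows "dirderiv A q v (\<lambda>q. K q (f q)) = K' q v (f q) + K q (dirderiv A q v f)"
proof (rule dirderiv_eqI)
  let ?c = "chart_at A q"
  note d = killing_form_has_derivative[OF dirderiv_has_derivative[OF smooth_fn_b V(3)]
      dirderiv_has_derivative[OF smooth_fn_x[OF V(1,2)] V(3)]
      dirderiv_has_derivative[OF smooth_fn_k[OF V(1,2)] V(3)] dirderiv_has_derivative[OF f V(3)],
      of \<alpha> \<beta>]
  show "((\<lambda>q. K q (f q)) \<circ> param ?c has_derivative
      (\<lambda>v. K' q v (f q) + K q (dirderiv A q v f))) (at (coord ?c q))"
    using d by (simp add: o_def chart_at)
qed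

lemma nab_hat_K:
  assumes "open V" "V \<subseteq> U" "q \<in> V" "smooth_vf A V Y"
  shows "hat q (nab q v Y) = dirderiv A q v (\<lambda>q. hat q (Y q)) + 2 *\<^sub>R (K q (hat q v) \<times> hat q (Y q))"
  by (rule nab_hat[OF assms]) (use hat_nab_frame assms in blast)

lemma dirderiv_x:
  assumes q: "q \<in> U"
  shows "dirderiv A q v x = (- 2 * \<beta>) *\<^sub>R (hat q v - (x q \<bullet> hat q v) *\<^sub>R x q)"
proof -
  let ?v = "hat q v"
  have c: "(x q \<times> w) \<times> x q = w - (x q \<bullet> w) *\<^sub>R x q" for w
    by (subst cross_skew) (simp add: Lagrange x_unit[OF q])
  have "dirderiv A q v x + 2 *\<^sub>R (K q ?v \<times> x q) = (x q \<bullet> ?v) *\<^sub>R k q + b q *\<^sub>R (x q \<times> ?v)"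
    using nab_hat_K[OF open_U order_refl q smooth_xi] hat_nab_xi[OF q] by simp
  \<comment> \<open>The \<alpha>-term is parallel to \<xi> and drops out. Doubled, the \<kappa>- and
    b-terms are exactly those of \<open>hat_nab_xi\<close>, so only the \<beta>-term remains for the
    derivative of x.\<close>
  moreover have "K q ?v \<times> x q = (x q \<bullet> ?v) *\<^sub>R ((1/2) *\<^sub>R k q) + \<beta> *\<^sub>R (?v - (x q \<bullet> ?v) *\<^sub>R x q)
      + (b q / 2) *\<^sub>R (x q \<times> ?v)"
    using cross_skew[of ?v "x q"]
    by (simp add: killing_form_def cross_add_left Cross3.left_diff_distrib cross_mult_left c x_k[OF q])
  ultimately show ?thesis
    by (simp add: algebra_simps)
qed

text \<open>Differentiates \<xi> \<bullet> \<kappa> = 0; thus the \<xi>-component of the derivative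
  of \<kappa> is not a free quantity.\<close>

lemma x_dirderiv_k:
  assumes q: "q \<in> U"
  shows "x q \<bullet> dirderiv A q v k = 2 * \<beta> * (k q \<bullet> hat q v)"
proof -
  have "dirderiv A q v (\<lambda>q. x q \<bullet> k q) = 0"
    using dirderiv_cong[OF open_U q, of "\<lambda>q. x q \<bullet> k q" "\<lambda>q. 0" v] by (simp add: x_k dirderiv_const)
  moreover have "dirderiv A q v (\<lambda>q. x q \<bullet> k q) = x q \<bullet> dirderiv A q v k + dirderiv A q v x \<bullet> k q"
    by (rule dirderiv_bilinear[OF bounded_bilinear_inner smooth_fn_x[OF open_U order_refl]
          smooth_fn_k[OF open_U order_refl] q])
  moreover have "x q \<bullet> k q = 0" "hat q v \<bullet> k q = k q \<bullet> hat q v"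
    by (simp_all add: x_k[OF q] inner_commute)
  ultimately show ?thesis
    by (simp add: dirderiv_x[OF q] inner_diff_left)
qed

text \<open>Cartan's structure equation for the connection form 2 K. The coordinate fields commute,
  but their coefficients in the frame vary, and the inner \<open>K p\<close> term accounts for
  this.\<close>

lemma hat_riem:
  assumes p: "p \<in> U"
  shows "hat p (riem A nab p u v w) = 2 *\<^sub>R ((K' p u (hat p v) - K' p v (hat p u)
      - 2 *\<^sub>R K p (K p (hat p u) \<times> hat p v - K p (hat p v) \<times> hat p u)
      + 2 *\<^sub>R (K p (hat p u) \<times> K p (hat p v))) \<times> hat p w)"
proof -
  define V where "V = U \<inter> chart_dom (chart_at A p)"
  have V: "open V" "V \<subseteq> U" "p \<in> V"
    using p chart_at by (auto simp: V_def open_U open_chart_dom)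
  let ?C = "coord_field A p"
  have C: "smooth_vf A V (?C u)" for u
    by (rule smooth_vf_subset[OF smooth_vf_coord_field]) (simp add: V_def)
  let ?h = "\<lambda>u q. hat q (?C u q)"
  have h: "smooth_fn A V (?h u)" for u
    by (rule smooth_fn_hat[OF V(1,2) C])
  have hp: "?h u p = hat p u" for u
    by (simp add: coord_field_at)
  have bracket: "lie_bracket A (?C u) (?C v) p = 0" for u v
    by (rule lie_bracket_coord_field[OF chart_at(2)])
  have N: "smooth_vf A V (\<lambda>q. nab q (?C v q) (?C w))" for v w
    by (rule smooth_vf_nab[OF V(1) C C])
  have iter: "hat p (nab p u (\<lambda>q. nab q (?C v q) (?C w))) =
      dirderiv A p u (\<lambda>q. dirderiv A q (?C v q) (?h w))
      + 2 *\<^sub>R ((K' p u (hat p v) + K p (dirderiv A p u (?h v))) \<times> hat p w + K p (hat p v) \<times> dirderiv A p u (?h w))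
      + 2 *\<^sub>R (K p (hat p u) \<times> (dirderiv A p v (?h w) + 2 *\<^sub>R (K p (hat p v) \<times> hat p w)))" for u v w
  proof -
    let ?f = "\<lambda>q. dirderiv A q (?C v q) (?h w)" and ?g = "\<lambda>q. K q (?h v q)"
    have f: "smooth_fn A V ?f"
      by (rule smooth_fn_dirderiv[OF V(1) h C])
    have g: "smooth_fn A V ?g"
      by (rule smooth_fn_K[OF V(1,2) h])
    have gh: "smooth_fn A V (\<lambda>q. ?g q \<times> ?h w q)"
      by (rule smooth_fn_bilinear[OF V(1) bounded_bilinear_cross3 g h])
    have nab: "hat q (nab q (?C v q) (?C w)) = ?f q + 2 *\<^sub>R (?g q \<times> ?h w q)" if "q \<in> V" for q
      by (rule nab_hat_K[OF V(1,2) that C])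
    have "dirderiv A p u (\<lambda>q. hat q (nab q (?C v q) (?C w))) = dirderiv A p u (\<lambda>q. ?f q + 2 *\<^sub>R (?g q \<times> ?h w q))"
      by (rule dirderiv_cong[OF V(1,3) nab])
    also have "\<dots> = dirderiv A p u ?f + 2 *\<^sub>R dirderiv A p u (\<lambda>q. ?g q \<times> ?h w q)"
      by (simp add: dirderiv_add[OF f smooth_fn_linear[OF V(1) bounded_linear_scaleR_right gh] V(3)]
          dirderiv_linear_comp[OF bounded_linear_scaleR_right gh V(3)])
    also have "dirderiv A p u (\<lambda>q. ?g q \<times> ?h w q) = ?g p \<times> dirderiv A p u (?h w) + dirderiv A p u ?g \<times> ?h w p"
      by (rule dirderiv_bilinear[OF bounded_bilinear_cross3 g h V(3)])
    also have "dirderiv A p u ?g = K' p u (hat p v) + K p (dirderiv A p u (?h v))"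
      using dirderiv_K[OF V h, of u v] by (simp add: hp)
    finally show ?thesis
      unfolding nab_hat_K[OF V N] nab[OF V(3)] by (simp add: hp coord_field_at add_ac)
  qed
  \<comment> \<open>Second derivatives of the coefficients of w cancel because the coordinate fields
    commute.\<close>
  have commute: "dirderiv A p u (\<lambda>q. dirderiv A q (?C v q) (?h w)) = dirderiv A p v (\<lambda>q. dirderiv A q (?C u q) (?h w))"
    using dirderiv_lie_bracket[OF V(1) h C C V(3), of u v w] linear_0[OF dirderiv_linear[OF h[of w] V(3)]]
    by (simp add: bracket coord_field_at)
  have "nab p u (?C v) = nab p v (?C u)"
    using torsion_free[OF V(1) C C V(3), of u v] by (simp add: bracket coord_field_at)
  then have "dirderiv A p u (?h v) + 2 *\<^sub>R (K p (hat p u) \<times> hat p v)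
      = dirderiv A p v (?h u) + 2 *\<^sub>R (K p (hat p v) \<times> hat p u)"
    using nab_hat_K[OF V C, of u v] nab_hat_K[OF V C, of v u] by (simp add: hp)
  then have "dirderiv A p u (?h v) - dirderiv A p v (?h u)
      = - 2 *\<^sub>R (K p (hat p u) \<times> hat p v - K p (hat p v) \<times> hat p u)"
    by (simp add: algebra_simps)
  then have torsion: "K p (dirderiv A p u (?h v)) - K p (dirderiv A p v (?h u))
      = - 2 *\<^sub>R K p (K p (hat p u) \<times> hat p v - K p (hat p v) \<times> hat p u)"
    unfolding linear_diff[OF linear_killing_form, symmetric] linear_scale[OF linear_killing_form, symmetric]
    by simp
  \<comment> \<open>The commutator of two cross product operators is the cross product with K(u)
    \<times> K(v).\<close>
  have jacobi: "K p (hat p u) \<times> (K p (hat p v) \<times> hat p w) - K p (hat p v) \<times> (K p (hat p u) \<times> hat p w)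
      = (K p (hat p u) \<times> K p (hat p v)) \<times> hat p w"
    using Jacobi[of "K p (hat p u)" "K p (hat p v)" "hat p w"]
      cross_skew[of "hat p w" "K p (hat p u)"] cross_skew[of "hat p w" "K p (hat p u) \<times> K p (hat p v)"]
    by simp
  have "hat p (riem A nab p u v w) = 2 *\<^sub>R ((K' p u (hat p v) - K' p v (hat p u)
      + (K p (dirderiv A p u (?h v)) - K p (dirderiv A p v (?h u)))) \<times> hat p w)
      + 4 *\<^sub>R (K p (hat p u) \<times> (K p (hat p v) \<times> hat p w) - K p (hat p v) \<times> (K p (hat p u) \<times> hat p w))"
    unfolding riem_eq hat_simps iter commute
    by (simp add: cross_add_left cross_add_right Cross3.left_diff_distrib cross_mult_right algebra_simps)
  then show ?thesis
    unfolding torsion jacobi by (simp add: cross_add_left Cross3.left_diff_distrib cross_mult_left algebra_simps)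
qed

end

lemma axis_nth3: "(axis a 1 :: real^3) $ c = (if c = a then 1 else 0)"
  by (simp add: axis_def)

lemma linear_killing_curv: "linear (killing_curv \<alpha> \<beta> b k dk db)"
  by (rule linearI) (simp_all add: killing_curv_def algebra_simps)

text \<open>The vector of inner products is the transpose of C applied to v. Contracting R(u,v)w = 2
  C(u \<times> v) \<times> w over u therefore gives Ricci as twice the transpose of C minus its
  trace.\<close>

lemma trace_cross_form:
  fixes C :: "real^3 \<Rightarrow> real^3"
  assumes "linear C"
  shows "(\<Sum>a\<in>UNIV. (C (axis a 1 \<times> v) \<times> w) $ a)
    = (vector [C (axis 1 1) \<bullet> v, C (axis 2 1) \<bullet> v, C (axis 3 1) \<bullet> v]
      - (C (axis 1 1) $ 1 + C (axis 2 1) $ 2 + C (axis 3 1) $ 3) *\<^sub>R v) \<bullet> w"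
proof -
  note C = linear_axis_expand[OF assms]
  show ?thesis
    by (subst (1) sum_3) (simp add: C[of "_ \<times> v"] cross_components inner_vec_def sum_3 axis_def algebra_simps)
qed

section \<open>Ricci and scalar curvature at a point\<close>

locale killing_frame_at = killing_frame A g nab U E \<xi> b \<alpha> \<beta>
  for A :: "'m::{t2_space, second_countable_topology} atlas" and g nab U E \<xi> b \<alpha> \<beta> +
  fixes p :: 'm
  assumes p: "p \<in> U" and xi_p: "E 3 p = \<xi> p"
begin

abbreviation k0 where "k0 \<equiv> k p"
definition dk where "dk u = dirderiv A p (unhat p u) k"
definition db where "db u = dirderiv A p (unhat p u) b"

lemma x_p: "x p = axis 3 1"
  using hat_E[OF p, of 3] by (simp add: xi_p)

lemma k_p3: "k0 $ 3 = 0"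
  using x_k[OF p] by (simp add: x_p inner_axis_axis inner_axis')

lemma linear_dk: "linear dk" and linear_db: "linear db"
proof -
  have "linear (\<lambda>v. dirderiv A p v k)" "linear (\<lambda>v. dirderiv A p v b)"
    by (rule dirderiv_linear[OF smooth_fn_k[OF open_U order_refl] p], rule dirderiv_linear[OF smooth_fn_b UNIV_I])
  from this[THEN linear_compose[OF linear_unhat[of p]]] show "linear dk" "linear db"
    by (simp_all add: dk_def[abs_def] db_def[abs_def] o_def)
qed

lemma dk_hat: "dirderiv A p v k = dk (hat p v)" and db_hat: "dirderiv A p v b = db (hat p v)"
  by (simp_all add: dk_def db_def unhat_hat[OF p])

lemma dk3: "dk u $ 3 = 2 * \<beta> * (k0 \<bullet> u)"
  using x_dirderiv_k[OF p, of "unhat p u"] by (simp add: dk_hat hat_unhat[OF p] x_p inner_axis')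

abbreviation C where "C \<equiv> killing_curv \<alpha> \<beta> (b p) k0 dk db"

lemma hat_riem_C: "hat p (riem A nab p u v w) = 2 *\<^sub>R (C (hat p u \<times> hat p v) \<times> hat p w)"
  unfolding hat_riem[OF p] dirderiv_x[OF p] dk_hat db_hat x_p
  by (subst killing_curv_components[OF k_p3 linear_dk linear_db dk3]) (rule refl)

text \<open>On the frame vectors the cyclic sum is twice the sum of C(e_a) \<times> e_a, the axial
  vector of the skew part of C. The entries pairing e_3 with e_1 and e_2 give \<alpha> \<kappa> = 0;
  the remaining one gives the third relation.\<close>

lemma bianchi_relations:
  shows "\<alpha> * k0 $ 1 = 0" "\<alpha> * k0 $ 2 = 0"
    "dk (axis 1 1) $ 2 - dk (axis 2 1) $ 1 = 2 * db (axis 3 1) - 8 * \<alpha> * \<beta>"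
proof -
  have "hat p (riem A nab p (E 1 p) (E 2 p) (E 3 p) + riem A nab p (E 2 p) (E 3 p) (E 1 p)
      + riem A nab p (E 3 p) (E 1 p) (E 2 p)) = 0"
    by (simp only: bianchi hat_simps)
  then have "C (axis 3 1) \<times> axis 3 1 + C (axis 1 1) \<times> axis 1 1 + C (axis 2 1) \<times> axis 2 1 = 0"
    unfolding hat_simps hat_riem_C hat_E[OF p] cross_basis by (simp flip: scaleR_add_right)
  then show "\<alpha> * k0 $ 1 = 0" "\<alpha> * k0 $ 2 = 0"
    "dk (axis 1 1) $ 2 - dk (axis 2 1) $ 1 = 2 * db (axis 3 1) - 8 * \<alpha> * \<beta>"
    by (simp_all add: vec_eq_iff forall_3 cross_components killing_curv_def axis_nth3 field_simps)
qed

lemma alpha_kappa: "\<alpha> = 0 \<or> kappa nab \<xi> p = 0"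
proof -
  have "hat p (\<alpha> *\<^sub>R kappa nab \<xi> p) = hat p 0"
    using bianchi_relations(1,2) by (auto simp: hat_simps vec_eq_iff forall_3 k_p3)
  then show ?thesis
    by (simp add: hat_inject[OF p])
qed

lemma hat_nab_kappa: "hat p (nab p v (kappa nab \<xi>)) = dk (hat p v) + 2 *\<^sub>R (K p (hat p v) \<times> k0)"
  using nab_hat_K[OF open_U order_refl p smooth_kappa] by (simp add: dk_hat)

lemma ext_deriv1_kappa_eq:
  assumes "open W" "smooth_vf A W X" "smooth_vf A W Y" "p \<in> W" "positive_onb_Q g \<xi> p (X p) (Y p)"
  shows "ext_deriv1 A (\<lambda>q v. g q (kappa nab \<xi> q) v) X Y p = 2 * (dirderiv A p (\<xi> p) b - 4 * \<alpha> * \<beta>)"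
proof -
  let ?u = "hat p (X p)" and ?v = "hat p (Y p)"
  have v: "?v = axis 3 1 \<times> ?u"
    using positive_onb_Q_cross(1)[OF p assms(5)] by (simp add: x_p)
  have u3: "?u $ 3 = 0" and "?u \<bullet> ?u = 1"
    using assms(5) by (simp_all add: positive_onb_Q_def in_Q_hat[OF p] g_hat[OF p] x_p inner_axis')
  then have u: "(?u $ 1)\<^sup>2 + (?u $ 2)\<^sup>2 = 1"
    by (simp add: inner_vec_def sum_3 power2_eq_square)
  have "ext_deriv1 A (\<lambda>q v. g q (kappa nab \<xi> q) v) X Y p
      = (dk ?u + 2 *\<^sub>R (K p ?u \<times> k0)) \<bullet> ?v - (dk ?v + 2 *\<^sub>R (K p ?v \<times> k0)) \<bullet> ?u"
    by (simp add: ext_deriv1_kappa[OF assms(1-4)] g_hat[OF p] hat_nab_kappa)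
  \<comment> \<open>The terms with \<open>K\<close> vanish because \<kappa> is orthogonal to \<xi>,
    and the skew part of \<open>dk\<close> on \<open>Q\<close> is multiplied by the determinant of
    the change of basis, which is 1.\<close>
  also have "\<dots> = (dk (axis 1 1) $ 2 - dk (axis 2 1) $ 1) * ((?u $ 1)\<^sup>2 + (?u $ 2)\<^sup>2)"
    unfolding v linear_axis_expand[OF linear_dk, of ?u] linear_axis_expand[OF linear_dk, of "_ \<times> ?u"] x_p
    by (simp add: killing_form_def cross_components inner_vec_def sum_3 u3 k_p3 axis_nth3)
      (simp add: algebra_simps power2_eq_square)
  finally show ?thesis
    by (simp add: u bianchi_relations db_hat x_p)
qed

definition Rc :: "real^3 \<Rightarrow> real^3" where
  "Rc v = 2 *\<^sub>R (vector [C (axis 1 1) \<bullet> v, C (axis 2 1) \<bullet> v, C (axis 3 1) \<bullet> v]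
      - (C (axis 1 1) $ 1 + C (axis 2 1) $ 2 + C (axis 3 1) $ 3) *\<^sub>R v)"

lemma ricci_form_hat: "ricci_form A nab p v w = Rc (hat p v) \<bullet> hat p w"
proof -
  have "linear (\<lambda>u. riem A nab p u v w)"
    by (rule linearI; subst hat_inject[OF p, symmetric])
      (simp_all add: hat_simps hat_riem_C cross_add_left cross_mult_left linear_add[OF linear_killing_curv]
        linear_scale[OF linear_killing_curv] algebra_simps)
  then show ?thesis
    unfolding ricci_form_def trace_frame[OF p \<open>linear _\<close>] hat_riem_C hat_E[OF p] Rc_def
    using trace_cross_form[OF linear_killing_curv]
    by (simp add: sum_distrib_left[symmetric])
qed

lemma hat_ricci: "hat p (ricci A g nab p v) = Rc (hat p v)"
proof -
  have "ricci A g nab p v = unhat p (Rc (hat p v))"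
    unfolding ricci_def
  proof (rule the_equality)
    show eq: "\<forall>w. g p (unhat p (Rc (hat p v))) w = ricci_form A nab p v w"
      by (simp add: g_hat[OF p] hat_unhat[OF p] ricci_form_hat)
    show "r = unhat p (Rc (hat p v))" if "\<forall>w. g p r w = ricci_form A nab p v w" for r
      using that eq by (intro g_nondegenerate[of p]) simp
  qed
  then show ?thesis
    by (simp add: hat_unhat[OF p])
qed

lemma hat_grad: "hat p (grad A g b p) = vector [db (axis 1 1), db (axis 2 1), db (axis 3 1)]"
proof -
  let ?G = "vector [db (axis 1 1), db (axis 2 1), db (axis 3 1)] :: real^3"
  have "grad A g b p = unhat p ?G"
    unfolding grad_def
  proof (rule the_equality)
    show eq: "\<forall>v. g p (unhat p ?G) v = dirderiv A p v b"
      using linear_axis_expand[OF linear_db, of "hat p _"]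
      by (simp add: g_hat[OF p] hat_unhat[OF p] db_hat inner_vec_def sum_3 mult.commute)
    show "r = unhat p ?G" if "\<forall>v. g p r v = dirderiv A p v b" for r
      using that eq by (intro g_nondegenerate[of p]) simp
  qed
  then show ?thesis
    by (simp add: hat_unhat[OF p])
qed

text \<open>The squares come from the direction \<xi>: there \<open>K\<close> contains half of \<xi>
  \<times> \<kappa>, so the \<xi>-component of \<nabla>\<kappa> along \<xi> is -|\<kappa>|^2, and
  \<open>divergence\<close> reverses the sign.\<close>

lemma divergence_kappa: "divergence nab (kappa nab \<xi>) p
    = (k0 $ 1)\<^sup>2 + (k0 $ 2)\<^sup>2 - dk (axis 1 1) $ 1 - dk (axis 2 1) $ 2"
  unfolding divergence_def trace_frame[OF p nab_linear[OF open_U smooth_kappa p]] hat_nab_kappa hat_E[OF p] x_p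
  by (simp add: sum_3 killing_form_def cross_components inner_vec_def k_p3 axis_nth3)
    (simp add: dk3 inner_vec_def sum_3 k_p3 axis_nth3 algebra_simps power2_eq_square)

lemma scal_eq:
  "scal A g nab p = 2 * (4 * \<beta>\<^sup>2 - (b p)\<^sup>2 - 4 * \<alpha> * b p - divergence nab (kappa nab \<xi>) p)"
proof -
  have "linear (ricci A g nab p)"
    by (rule linearI; subst hat_inject[OF p, symmetric])
      (simp_all add: hat_simps hat_ricci Rc_def inner_add_right vec_eq_iff forall_3 algebra_simps)
  then show ?thesis
    unfolding scal_def trace_frame[OF p \<open>linear _\<close>] hat_ricci hat_E[OF p] divergence_kappa Rc_def
    by (simp add: sum_3 inner_vec_def killing_curv_def axis_nth3 field_simps power2_eq_square)
qed

context
  fixes V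
  defines "V \<equiv> (2 * b p) *\<^sub>R kappa nab \<xi> p - proj_Q g \<xi> p (grad A g b p)"
begin

lemma hat_JV: "hat p (J_Q g \<xi> p V)
  = vector [db (axis 2 1) - 2 * b p * k0 $ 2, 2 * b p * k0 $ 1 - db (axis 1 1), 0]"
proof -
  have V: "hat p V = vector [2 * b p * k0 $ 1 - db (axis 1 1), 2 * b p * k0 $ 2 - db (axis 2 1), 0]"
    by (simp add: V_def hat_simps proj_Q_hat[OF p] hat_grad x_p inner_vec_def sum_3 vec_eq_iff forall_3 axis_nth3 k_p3)
  have "in_Q g \<xi> p V"
    by (simp add: in_Q_hat[OF p] x_p inner_vec_def sum_3 axis_nth3 V)
  then show ?thesis
    by (simp add: J_Q_hat[OF p] x_p V vec_eq_iff forall_3 cross_components axis_nth3)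
qed

lemma ricci_xi: "ricci A g nab p (\<xi> p)
    = (2 * (b p)\<^sup>2 - divergence nab (kappa nab \<xi>) p) *\<^sub>R \<xi> p + J_Q g \<xi> p V"
proof (subst hat_inject[OF p, symmetric])
  show "hat p (ricci A g nab p (\<xi> p))
      = hat p ((2 * (b p)\<^sup>2 - divergence nab (kappa nab \<xi>) p) *\<^sub>R \<xi> p + J_Q g \<xi> p V)"
    \<comment> \<open>The contraction produces additional terms \<alpha> k in the
      \<open>Q\<close>-components; they vanish by the Bianchi relations.\<close>
    using bianchi_relations
    by (simp add: hat_ricci hat_simps hat_JV x_p Rc_def inner_vec_def sum_3 divergence_kappa vec_eq_iff forall_3
        killing_curv_def axis_nth3) (auto simp: field_simps)
qed

lemma ricci_Q:
  assumes z: "in_Q g \<xi> p z"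
  shows "ricci A g nab p z = (2 * (2 * \<beta>\<^sup>2 - (b p)\<^sup>2 - 2 * \<alpha> * b p)) *\<^sub>R z
    + (4 * \<alpha> * \<beta> - dirderiv A p (\<xi> p) b) *\<^sub>R J_Q g \<xi> p z
    + g p (J_Q g \<xi> p V) z *\<^sub>R \<xi> p
    + transversal_nabla A g nab \<xi> p z (kappa nab \<xi>)
    - g p z (kappa nab \<xi> p) *\<^sub>R kappa nab \<xi> p"
proof (subst hat_inject[OF p, symmetric])
  let ?z = "hat p z"
  have z3: "?z $ 3 = 0"
    using z by (simp add: in_Q_hat[OF p] x_p inner_axis')
  have gz: "g p z (\<xi> p) = 0"
    using z by (simp add: in_Q_def)
  \<comment> \<open>K(z) and \<kappa> both lie in \<open>Q\<close>, so their cross product is along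
    \<xi> and the projection removes it; what remains is the derivative of the coefficients. The
    bracket term has the factor g(z, \<xi>) = 0.\<close>
  have t: "hat p (transversal_nabla A g nab \<xi> p z (kappa nab \<xi>))
      = vector [?z $ 1 * dk (axis 1 1) $ 1 + ?z $ 2 * dk (axis 2 1) $ 1,
          ?z $ 1 * dk (axis 1 1) $ 2 + ?z $ 2 * dk (axis 2 1) $ 2, 0]"
    unfolding transversal_nabla_def gz
    by (simp add: proj_Q_hat[OF p] proj_Q_def[of g \<xi> p z] gz hat_nab_kappa x_p
        linear_axis_expand[OF linear_dk, of ?z] z3 vec_eq_iff forall_3 killing_form_def cross_components
        inner_vec_def sum_3 axis_nth3 k_p3)
  show "hat p (ricci A g nab p z) = hat p ((2 * (2 * \<beta>\<^sup>2 - (b p)\<^sup>2 - 2 * \<alpha> * b p)) *\<^sub>R z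
    + (4 * \<alpha> * \<beta> - dirderiv A p (\<xi> p) b) *\<^sub>R J_Q g \<xi> p z
    + g p (J_Q g \<xi> p V) z *\<^sub>R \<xi> p
    + transversal_nabla A g nab \<xi> p z (kappa nab \<xi>)
    - g p z (kappa nab \<xi> p) *\<^sub>R kappa nab \<xi> p)"
    using bianchi_relations
    unfolding hat_simps hat_ricci t g_hat[OF p] hat_JV J_Q_hat[OF p z] db_hat x_p Rc_def
    by (simp add: vec_eq_iff forall_3 killing_curv_def axis_nth3 cross_components inner_vec_def sum_3 z3 k_p3)
      (simp add: field_simps power2_eq_square)
qed

end

end

unbundle no cross3_syntax

theorem proposition6p1:
  fixes A :: "'m::{t2_space, second_countable_topology} atlas"
    and g :: "'m metric" and nab :: "'m connection" and \<xi> :: "'m vfield"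
    and S :: "('i, 'm) spin_data" and \<psi> :: "('i, 'm) spinor"
    and \<alpha> \<beta> :: real and b :: "'m \<Rightarrow> real"
  defines "\<kappa> \<equiv> kappa nab \<xi>"
    and "J \<equiv> J_Q g \<xi>"
    and "V \<equiv> (\<lambda>p. (2 * b p) *\<^sub>R kappa nab \<xi> p - proj_Q g \<xi> p (grad A g b p))"
  assumes "oriented_manifold A" and "riemannian_metric A g" and "levi_civita A g nab"
    and "riemannian_flow A g \<xi>"
    and "spin_structure A g S"
    and "transversal_killing_spinor A g nab \<xi> S \<alpha> \<beta> \<psi>" and "nonzero_spinor S \<psi>"
    and "smooth_fn A UNIV b"
    and "\<And>p z. in_Q g \<xi> p z \<Longrightarrow> h_tensor nab \<xi> p z = b p *\<^sub>R J p z"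
  shows "(\<alpha> = 0 \<or> (\<forall>p. \<kappa> p = 0))
    \<and> (\<forall>U e\<^sub>1 e\<^sub>2. open U \<and> smooth_vf A U e\<^sub>1 \<and> smooth_vf A U e\<^sub>2 \<and>
          (\<forall>p\<in>U. positive_onb_Q g \<xi> p (e\<^sub>1 p) (e\<^sub>2 p)) \<longrightarrow>
          (\<forall>p\<in>U. ext_deriv1 A (\<lambda>q v. g q (\<kappa> q) v) e\<^sub>1 e\<^sub>2 p
             = 2 * (dirderiv A p (\<xi> p) b - 4 * \<alpha> * \<beta>)))
    \<and> (\<forall>p. scal A g nab p
          = 2 * (4 * \<beta>\<^sup>2 - (b p)\<^sup>2 - 4 * \<alpha> * b p - divergence nab \<kappa> p))
    \<and> (\<forall>p. ricci A g nab p (\<xi> p)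
          = (2 * (b p)\<^sup>2 - divergence nab \<kappa> p) *\<^sub>R \<xi> p + J p (V p))
    \<and> (\<forall>U Z. open U \<and> smooth_vf A U Z \<and> (\<forall>p\<in>U. in_Q g \<xi> p (Z p)) \<longrightarrow>
          (\<forall>p\<in>U. ricci A g nab p (Z p)
             = (2 * (2 * \<beta>\<^sup>2 - (b p)\<^sup>2 - 2 * \<alpha> * b p)) *\<^sub>R Z p
               + (4 * \<alpha> * \<beta> - dirderiv A p (\<xi> p) b) *\<^sub>R J p (Z p)
               + g p (J p (V p)) (Z p) *\<^sub>R \<xi> p
               + transversal_nabla A g nab \<xi> p (Z p) \<kappa>
               - g p (Z p) (\<kappa> p) *\<^sub>R \<kappa> p))"
proof -
  interpret killing_flow A g nab \<xi> b S \<psi> \<alpha> \<beta>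
    by unfold_locales (use assms(4-12) in \<open>simp_all add: J_def\<close>)
  \<comment> \<open>All assertions are checked point by point, with a frame adapted to \<xi> at that
    point.\<close>
  have frame: "\<exists>U E. killing_frame_at A g nab U E \<xi> b \<alpha> \<beta> p" for p
    by (rule ex_killing_frame[of p])
      (auto simp: killing_frame_at_def killing_frame_at_axioms_def)
  \<comment> \<open>\<alpha> is a constant, so the pointwise alternative is already the global
    one.\<close>
  have "\<alpha> = 0 \<or> \<kappa> p = 0" for p
    using frame[of p] killing_frame_at.alpha_kappa unfolding \<kappa>_def by blast
  moreover have "ext_deriv1 A (\<lambda>q v. g q (\<kappa> q) v) e1 e2 p = 2 * (dirderiv A p (\<xi> p) b - 4 * \<alpha> * \<beta>)"
    if "open U" "smooth_vf A U e1" "smooth_vf A U e2" "\<forall>p\<in>U. positive_onb_Q g \<xi> p (e1 p) (e2 p)" "p \<in> U"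
    for U e1 e2 p
    using frame[of p] killing_frame_at.ext_deriv1_kappa_eq[OF _ that(1,2,3,5)] that(4,5)
    unfolding \<kappa>_def by blast
  moreover have "scal A g nab p = 2 * (4 * \<beta>\<^sup>2 - (b p)\<^sup>2 - 4 * \<alpha> * b p - divergence nab \<kappa> p)" for p
    using frame[of p] killing_frame_at.scal_eq unfolding \<kappa>_def by blast
  moreover have "ricci A g nab p (\<xi> p) = (2 * (b p)\<^sup>2 - divergence nab \<kappa> p) *\<^sub>R \<xi> p + J p (V p)" for p
    using frame[of p] killing_frame_at.ricci_xi unfolding \<kappa>_def J_def V_def by blast
  moreover have "ricci A g nab p z
             = (2 * (2 * \<beta>\<^sup>2 - (b p)\<^sup>2 - 2 * \<alpha> * b p)) *\<^sub>R z
               + (4 * \<alpha> * \<beta> - dirderiv A p (\<xi> p) b) *\<^sub>R J p z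
               + g p (J p (V p)) z *\<^sub>R \<xi> p
               + transversal_nabla A g nab \<xi> p z \<kappa>
               - g p z (\<kappa> p) *\<^sub>R \<kappa> p" if "in_Q g \<xi> p z" for p z
    using frame[of p] killing_frame_at.ricci_Q[OF _ that] unfolding \<kappa>_def J_def V_def by blast
  ultimately show ?thesis
    by blast
qed

end
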